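(* Let $\mathscr{R}$ be a type $II_1$ von Neumann algebra. Then every unitary $U \in \mathscr{R}$ can be written as a product $U = R_1R_2R_3R_4R_5R_6$ of six symmetries (self-adjoint unitaries) $R_1,\dots,R_6 \in \mathscr{R}$.
   Context: A symmetry is a self-adjoint unitary. *)

theory Defs
  imports Complex_Main
begin

class complex_vector = real_vector +
  fixes scaleC :: "complex \<Rightarrow> 'a \<Rightarrow> 'a" (infixr \<open>*\<^sub>C\<close> 75)
  assumes scaleC_add_right: "a *\<^sub>C (x + y) = a *\<^sub>C x + a *\<^sub>C y"
    and scaleC_add_left: "(a + b) *\<^sub>C x = a *\<^sub>C x + b *\<^sub>C x"
    and scaleC_scaleC: "a *\<^sub>C (b *\<^sub>C x) = (a * b) *\<^sub>C x"
    and scaleC_one: "1 *\<^sub>C x = x"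
    and scaleR_scaleC: "scaleR r x = complex_of_real r *\<^sub>C x"

class complex_inner = complex_vector + real_normed_vector +
  fixes cinner :: "'a \<Rightarrow> 'a \<Rightarrow> complex"
  assumes cinner_commute: "cinner x y = cnj (cinner y x)"
    and cinner_add_left: "cinner (x + y) z = cinner x z + cinner y z"
    and cinner_scaleC_left: "cinner (r *\<^sub>C x) y = cnj r * cinner x y"
    and cinner_ge_zero: "Im (cinner x x) = 0 \<and> 0 \<le> Re (cinner x x)"
    and cinner_eq_zero_iff: "cinner x x = 0 \<longleftrightarrow> x = 0"
    and norm_eq_sqrt_cinner: "norm x = sqrt (Re (cinner x x))"

class chilbert_space = complex_inner + complete_space

definition bounded_clinear_op :: "('a::complex_inner \<Rightarrow> 'a) \<Rightarrow> bool" where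
  "bounded_clinear_op A \<longleftrightarrow>
     (\<forall>x y. A (x + y) = A x + A y) \<and> (\<forall>c x. A (c *\<^sub>C x) = c *\<^sub>C A x) \<and>
     (\<exists>K. \<forall>x. norm (A x) \<le> norm x * K)"

definition adj :: "('a::complex_inner \<Rightarrow> 'a) \<Rightarrow> ('a \<Rightarrow> 'a)" where
  "adj A = (THE B. \<forall>x y. cinner (A x) y = cinner x (B y))"

definition commutant :: "('a::complex_inner \<Rightarrow> 'a) set \<Rightarrow> ('a \<Rightarrow> 'a) set" where
  "commutant S = {T. bounded_clinear_op T \<and> (\<forall>A\<in>S. T \<circ> A = A \<circ> T)}"

definition von_neumann_algebra :: "('a::chilbert_space \<Rightarrow> 'a) set \<Rightarrow> bool" where
  "von_neumann_algebra M \<longleftrightarrow>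
     (\<forall>A\<in>M. bounded_clinear_op A) \<and> id \<in> M \<and>
     (\<forall>A\<in>M. \<forall>B\<in>M. (\<lambda>x. A x + B x) \<in> M) \<and>
     (\<forall>A\<in>M. \<forall>B\<in>M. A \<circ> B \<in> M) \<and>
     (\<forall>c. \<forall>A\<in>M. (\<lambda>x. c *\<^sub>C A x) \<in> M) \<and>
     (\<forall>A\<in>M. adj A \<in> M) \<and>
     commutant (commutant M) = M"

definition is_projection_in :: "('a::chilbert_space \<Rightarrow> 'a) set \<Rightarrow> ('a \<Rightarrow> 'a) \<Rightarrow> bool" where
  "is_projection_in M P \<longleftrightarrow> P \<in> M \<and> P \<circ> P = P \<and> adj P = P"

text \<open>Order on projections: Q \<le> P iff range Q \<subseteq> range P, i.e. Q = P Q.\<close>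
definition proj_le :: "('a::chilbert_space \<Rightarrow> 'a) \<Rightarrow> ('a \<Rightarrow> 'a) \<Rightarrow> bool" where
  "proj_le Q P \<longleftrightarrow> P \<circ> Q = Q"

definition mvn_equiv :: "('a::chilbert_space \<Rightarrow> 'a) set \<Rightarrow> ('a \<Rightarrow> 'a) \<Rightarrow> ('a \<Rightarrow> 'a) \<Rightarrow> bool" where
  "mvn_equiv M P Q \<longleftrightarrow> (\<exists>V\<in>M. adj V \<circ> V = P \<and> V \<circ> adj V = Q)"

definition finite_projection :: "('a::chilbert_space \<Rightarrow> 'a) set \<Rightarrow> ('a \<Rightarrow> 'a) \<Rightarrow> bool" where
  "finite_projection M E \<longleftrightarrow> is_projection_in M E \<and>
     (\<forall>F. is_projection_in M F \<and> proj_le F E \<and> mvn_equiv M F E \<longrightarrow> F = E)"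

definition abelian_projection :: "('a::chilbert_space \<Rightarrow> 'a) set \<Rightarrow> ('a \<Rightarrow> 'a) \<Rightarrow> bool" where
  "abelian_projection M E \<longleftrightarrow> is_projection_in M E \<and>
     (\<forall>A\<in>M. \<forall>B\<in>M. (E \<circ> A \<circ> E) \<circ> (E \<circ> B \<circ> E) = (E \<circ> B \<circ> E) \<circ> (E \<circ> A \<circ> E))"

definition type_II1 :: "('a::chilbert_space \<Rightarrow> 'a) set \<Rightarrow> bool" where
  "type_II1 M \<longleftrightarrow> von_neumann_algebra M \<and> finite_projection M id \<and>
     (\<forall>E. abelian_projection M E \<longrightarrow> E = (\<lambda>_. 0))"

definition unitary_in :: "('a::chilbert_space \<Rightarrow> 'a) set \<Rightarrow> ('a \<Rightarrow> 'a) \<Rightarrow> bool" where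
  "unitary_in M U \<longleftrightarrow> U \<in> M \<and> adj U \<circ> U = id \<and> U \<circ> adj U = id"

definition symmetry_in :: "('a::chilbert_space \<Rightarrow> 'a) set \<Rightarrow> ('a \<Rightarrow> 'a) \<Rightarrow> bool" where
  "symmetry_in M R \<longleftrightarrow> unitary_in M R \<and> adj R = R"

end

theory Submission
  imports Defs "HOL-Analysis.Analysis"
begin

text \<open>Choose orthogonal projections \<open>Q\<^sub>0, Q\<^sub>1, \<dots>\<close> commuting with \<open>U\<close> and with sum \<open>1\<close>, where \<open>Q\<^sub>n\<close> is
  equivalent to half of what \<open>Q\<^sub>0, \<dots>, Q\<^bsub>n-1\<^esub>\<close> leave over. Any unitary \<open>d\<close> on \<open>Q\<^sub>n\<close> commutes with a
  projection \<open>g\<close> that halves \<open>Q\<^sub>n\<close>; then \<open>d = diag (a, b) = diag (c, 1) * diag (b\<^sup>\<star>, b)\<close>, and \<open>diag (b\<^sup>\<star>, b)\<close>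
  is a product of two symmetries. The remaining \<open>c\<close> on \<open>g \<sim> Q\<^bsub>n+1\<^esub>\<close> is pushed to \<open>Q\<^bsub>n+1\<^esub>\<close> by
  \<open>diag (c, \<tau>\<^sup>\<star>)\<close> on \<open>g + Q\<^bsub>n+1\<^esub>\<close>, again a product of two symmetries, where \<open>\<tau>\<close> is the copy of \<open>c\<close> on
  \<open>Q\<^bsub>n+1\<^esub>\<close>, and absorbed in the next block. The pushes for even \<open>n\<close> act on orthogonal blocks, as do
  those for odd \<open>n\<close>, and so do the factors \<open>diag (b\<^sup>\<star>, b)\<close> for all \<open>n\<close>: three products of two symmetries.

  A halving projection that commutes with \<open>d\<close> is found without a trace: if \<open>e \<preceq> f\<close> and \<open>f\<close> commutes
  with \<open>d\<close>, some nonzero projection below \<open>f\<close> commuting with \<open>d\<close> embeds in \<open>e\<close>, since otherwise \<open>e\<close>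
  would embed in each of infinitely many orthogonal projections. A maximal orthogonal family of such
  embeddings exhausts \<open>e\<close> by cancellation in a finite algebra.\<close>

subsection \<open>Hilbert spaces\<close>

text \<open>The obstacle is finiteness: a correction cannot be shifted along infinitely many blocks
  of one size, because \<open>orthogonal_sequence_zero\<close> excludes infinite orthogonal
  sequences of nonzero equivalent projections. Only half of each block needs correcting, so the
  blocks may shrink by halves; the same lemma then shows that they leave no remainder. A push from
  block n occupies blocks n and n+1, so consecutive pushes overlap. This costs two pairs of
  symmetries instead of one, and the parity of n decides whether the incoming correction stands to
  the right or to the left of the outgoing one. The halving projection has to commute with
  \<open>d\<close>, which depends on all earlier blocks and not only on \<open>U\<close>; commuting
  halves are therefore constructed for an arbitrary normal element. The absence of abelian
  projections enters once, to produce two nonzero orthogonal equivalent subprojections. Finiteness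
  enters through cancellation, which stands in for comparing traces. Spectral theory is reduced to
  square roots and range projections, and the bicommutant property keeps all results in the
  algebra.\<close>

instance chilbert_space \<subseteq> banach ..

lemma cinner_add_right: "cinner x (y + z) = cinner x y + cinner x z"
  by (metis cinner_add_left cinner_commute complex_cnj_add)

lemma cinner_scaleC_right: "cinner x (r *\<^sub>C y) = r * cinner x y"
  by (metis cinner_commute cinner_scaleC_left complex_cnj_cnj complex_cnj_mult)

lemma cinner_zero_left [simp]: "cinner 0 x = 0"
  by (metis add_cancel_right_right cinner_add_left)

lemma cinner_zero_right [simp]: "cinner x 0 = 0"
  by (metis add_cancel_right_right cinner_add_right)

lemma cinner_minus_left: "cinner (- x) y = - cinner x y"
  by (metis add.right_inverse add_eq_0_iff cinner_add_left cinner_zero_left)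

lemma cinner_minus_right: "cinner x (- y) = - cinner x y"
  by (metis add.right_inverse add_eq_0_iff cinner_add_right cinner_zero_right)

lemma cinner_diff_left: "cinner (x - y) z = cinner x z - cinner y z"
  by (metis cinner_add_left cinner_minus_left diff_conv_add_uminus)

lemma cinner_diff_right: "cinner x (y - z) = cinner x y - cinner x z"
  by (metis cinner_add_right cinner_minus_right diff_conv_add_uminus)

lemma scaleC_zero_right [simp]: "c *\<^sub>C 0 = (0::'a::complex_vector)"
  by (metis add_cancel_right_right scaleC_add_right)

lemma scaleC_zero_left [simp]: "0 *\<^sub>C x = (0::'a::complex_vector)"
  by (metis add_cancel_right_right scaleC_add_left)

lemma scaleC_minus_right: "c *\<^sub>C (- x) = - (c *\<^sub>C (x::'a::complex_vector))"
  by (metis add.right_inverse add_eq_0_iff scaleC_add_right scaleC_zero_right)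

lemma scaleC_diff_right: "c *\<^sub>C (x - y) = c *\<^sub>C x - c *\<^sub>C (y::'a::complex_vector)"
  by (metis diff_conv_add_uminus scaleC_add_right scaleC_minus_right)

lemma cinner_scaleR_left: "cinner (r *\<^sub>R x) y = of_real r * cinner x y"
  by (simp add: scaleR_scaleC cinner_scaleC_left)

lemma cinner_scaleR_right: "cinner x (r *\<^sub>R y) = of_real r * cinner x y"
  by (simp add: scaleR_scaleC cinner_scaleC_right)

lemmas cinner_simps = cinner_add_left cinner_add_right cinner_diff_left cinner_diff_right
  cinner_scaleC_left cinner_scaleC_right cinner_minus_left cinner_minus_right
  cinner_scaleR_left cinner_scaleR_right

lemma cinner_self: "cinner x x = of_real ((norm x)\<^sup>2)"
  using cinner_ge_zero[of x] norm_eq_sqrt_cinner[of x] by (simp add: complex_eq_iff)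

lemma norm_sq_cinner: "(norm x)\<^sup>2 = Re (cinner x x)"
  by (simp add: cinner_self)

lemma norm_scaleC: "norm (c *\<^sub>C (x::'a::complex_inner)) = cmod c * norm x"
proof -
  have "(norm (c *\<^sub>C x))\<^sup>2 = (cmod c * norm x)\<^sup>2"
    unfolding norm_sq_cinner power_mult_distrib cmod_power2
    by (simp add: cinner_simps) (simp add: cinner_self power2_eq_square algebra_simps)
  then show ?thesis by (simp add: power2_eq_iff_nonneg)
qed

lemma norm_add_sq: "(norm (x + y))\<^sup>2 = (norm x)\<^sup>2 + (norm y)\<^sup>2 + 2 * Re (cinner x (y::'a::complex_inner))"
proof -
  have "Re (cinner y x) = Re (cinner x y)" by (subst cinner_commute) simp
  then show ?thesis by (simp add: norm_sq_cinner cinner_simps)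
qed

lemma norm_diff_sq: "(norm (x - y))\<^sup>2 = (norm x)\<^sup>2 + (norm y)\<^sup>2 - 2 * Re (cinner x (y::'a::complex_inner))"
  using norm_add_sq[of x "-y"] by (simp add: cinner_simps)

lemma cauchy_schwarz: "cmod (cinner x y) \<le> norm x * norm (y::'a::complex_inner)"
proof (cases "y = 0")
  case False
  define r where "r = (norm y)\<^sup>2"
  have r: "r > 0" using False by (simp add: r_def)
  define k where "k = cinner x y"
  have yx: "cinner y x = cnj k" unfolding k_def by (rule cinner_commute)
  \<comment> \<open>\<open>c *\<^sub>C y\<close> is the component of \<open>x\<close> along
    \<open>y\<close>; as \<open>cinner\<close> is conjugate-linear on the left, the coefficient is
    \<open>cinner y x / r\<close>.\<close>
  define c where "c = cnj k / of_real r"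
  have cc: "cnj c = k / of_real r" by (simp add: c_def)
  have "cinner (x - c *\<^sub>C y) (x - c *\<^sub>C y) = of_real ((norm x)\<^sup>2) - k * cnj k / of_real r"
    using r by (simp add: cinner_simps yx k_def[symmetric] cc) (simp add: cinner_self c_def r_def field_simps)
  also have "\<dots> = of_real ((norm x)\<^sup>2 - (cmod k)\<^sup>2 / r)"
    by (simp add: complex_norm_square[symmetric] flip: of_real_power)
  finally have "(norm x)\<^sup>2 - (cmod k)\<^sup>2 / r \<ge> 0"
    using cinner_ge_zero[of "x - c *\<^sub>C y"] by simp
  then have "(cmod k)\<^sup>2 \<le> (norm x * norm y)\<^sup>2"
    using r by (simp add: field_simps r_def power_mult_distrib)
  then show ?thesis unfolding k_def[symmetric] by (meson mult_nonneg_nonneg norm_ge_zero power2_le_imp_le)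
qed simp

lemma cinner_eqI: "(\<And>x. cinner x y = cinner x z) \<Longrightarrow> y = z"
  by (metis cinner_diff_right cinner_eq_zero_iff right_minus_eq)

lemma bounded_linear_cinner_right: "bounded_linear (cinner (x::'a::complex_inner))"
  by (rule bounded_linear_intro[of _ "norm x"])
     (auto simp: cinner_simps scaleR_conv_of_real mult.commute cauchy_schwarz[THEN order_trans])

lemma bounded_linear_scaleC: "bounded_linear (\<lambda>x::'a::complex_inner. c *\<^sub>C x)"
  by (rule bounded_linear_intro[of _ "cmod c"])
     (auto simp: scaleC_add_right scaleR_scaleC scaleC_scaleC mult.commute norm_scaleC)

definition closed_csubspace :: "'a::complex_inner set \<Rightarrow> bool" where
  "closed_csubspace K \<longleftrightarrow> closed K \<and> 0 \<in> K \<and> (\<forall>x\<in>K. \<forall>y\<in>K. x + y \<in> K) \<and> (\<forall>c. \<forall>x\<in>K. c *\<^sub>C x \<in> K)"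

lemma closed_csubspaceD:
  assumes "closed_csubspace K"
  shows "closed K" "0 \<in> K" "x \<in> K \<Longrightarrow> y \<in> K \<Longrightarrow> x + y \<in> K" "x \<in> K \<Longrightarrow> c *\<^sub>C x \<in> K"
    "x \<in> K \<Longrightarrow> y \<in> K \<Longrightarrow> x - y \<in> K" "x \<in> K \<Longrightarrow> r *\<^sub>R x \<in> K"
proof -
  show *: "closed K" "0 \<in> K" "\<And>x y. x \<in> K \<Longrightarrow> y \<in> K \<Longrightarrow> x + y \<in> K" "\<And>c x. x \<in> K \<Longrightarrow> c *\<^sub>C x \<in> K"
    using assms by (auto simp: closed_csubspace_def)
  show R: "\<And>x r. x \<in> K \<Longrightarrow> r *\<^sub>R x \<in> K" by (simp add: scaleR_scaleC *)
  show "x \<in> K \<Longrightarrow> y \<in> K \<Longrightarrow> x - y \<in> K"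
    using *(3)[of x "-y"] R[of y "-1"] by simp
qed

text \<open>A minimising sequence for the distance from \<open>x\<close> to \<open>K\<close> is
  Cauchy by the parallelogram law, because midpoints stay in \<open>K\<close>. At its limit no step
  along a vector of \<open>K\<close> shortens the distance, which is orthogonality.\<close>

lemma orthogonal_projection_exists:
  fixes x :: "'a::chilbert_space"
  assumes K: "closed_csubspace K"
  shows "\<exists>p\<in>K. \<forall>k\<in>K. cinner k (x - p) = 0"
proof -
  note KD = closed_csubspaceD[OF K]
  define d where "d = (INF k\<in>K. norm (x - k))"
  have bd: "bdd_below ((\<lambda>k. norm (x - k)) ` K)" by (rule bdd_belowI2[of _ 0]) simp
  have dle: "d \<le> norm (x - k)" if "k \<in> K" for k
    unfolding d_def by (rule cINF_lower[OF bd that])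
  have d0: "d \<ge> 0" unfolding d_def using KD(2) by (intro cINF_greatest) auto
  have "\<exists>k\<in>K. norm (x - k) < d + inverse (Suc n)" for n
  proof -
    have "(INF k\<in>K. norm (x - k)) < d + inverse (Suc n)" by (simp add: d_def)
    then show ?thesis using cINF_less_iff[OF _ bd] KD(2) by blast
  qed
  then obtain k where k: "\<And>n. k n \<in> K" "\<And>n. norm (x - k n) < d + inverse (Suc n)" by metis
  have par: "(norm (a - b))\<^sup>2 \<le> 2 * (norm (x - a))\<^sup>2 + 2 * (norm (x - b))\<^sup>2 - 4 * d\<^sup>2"
    if "a \<in> K" "b \<in> K" for a b
  proof -
    have "(1/2) *\<^sub>R (a + b) \<in> K" using that KD by auto
    then have "d \<le> norm (x - (1/2) *\<^sub>R (a + b))" by (rule dle)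
    also have "\<dots> = norm ((1/2) *\<^sub>R ((x - a) + (x - b)))"
      by (rule arg_cong[of _ _ norm]) (simp add: algebra_simps flip: scaleR_add_left)
    finally have "2 * d \<le> norm ((x - a) + (x - b))" by simp
    then have "(2 * d)\<^sup>2 \<le> (norm ((x - a) + (x - b)))\<^sup>2" using d0 by (intro power_mono) auto
    moreover have "(norm (a - b))\<^sup>2 = (norm ((x - a) - (x - b)))\<^sup>2"
      by (simp add: norm_minus_commute)
    ultimately show ?thesis unfolding norm_diff_sq[of "x - a"] norm_add_sq[of "x - a"] by (simp add: power_mult_distrib)
  qed
  have lim: "(\<lambda>n. d + inverse (real (Suc n))) \<longlonglongrightarrow> d"
    using tendsto_add[OF tendsto_const LIMSEQ_inverse_real_of_nat] by simp
  have lim2: "(\<lambda>n. (d + inverse (real (Suc n)))\<^sup>2) \<longlonglongrightarrow> d\<^sup>2" by (intro tendsto_power lim)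
  have "Cauchy k"
  proof (rule metric_CauchyI)
    fix e :: real assume e: "e > 0"
    have "eventually (\<lambda>n. (d + inverse (real (Suc n)))\<^sup>2 < d\<^sup>2 + e\<^sup>2 / 4) sequentially"
      by (rule order_tendstoD(2)[OF lim2]) (use e in simp)
    then obtain N where N: "\<And>n. n \<ge> N \<Longrightarrow> (d + inverse (real (Suc n)))\<^sup>2 < d\<^sup>2 + e\<^sup>2 / 4"
      by (auto simp: eventually_sequentially)
    have kN: "(norm (x - k n))\<^sup>2 < d\<^sup>2 + e\<^sup>2 / 4" if "n \<ge> N" for n
    proof -
      have "(norm (x - k n))\<^sup>2 \<le> (d + inverse (real (Suc n)))\<^sup>2"
        using k(2)[of n] by (intro power_mono) auto
      then show ?thesis using N[OF that] by simp
    qed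
    have "dist (k m) (k n) < e" if "m \<ge> N" "n \<ge> N" for m n
    proof -
      have "(norm (k m - k n))\<^sup>2 < e\<^sup>2"
        using par[OF k(1)[of m] k(1)[of n]] kN[OF that(1)] kN[OF that(2)] by simp
      then show ?thesis using e by (simp add: dist_norm power2_less_imp_less)
    qed
    then show "\<exists>M. \<forall>m\<ge>M. \<forall>n\<ge>M. dist (k m) (k n) < e" by blast
  qed
  then obtain p where p: "k \<longlonglongrightarrow> p" using Cauchy_convergent convergent_def by blast
  have pK: "p \<in> K" using closed_sequentially[OF KD(1) _ p] k(1) by blast
  have "norm (x - p) \<le> d"
    by (rule LIMSEQ_le[OF tendsto_norm[OF tendsto_diff[OF tendsto_const p]] lim])
       (use k(2) less_imp_le in blast)
  then have dp: "norm (x - p) = d" using dle[OF pK] by simp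
  have "cinner h (x - p) = 0" if h: "h \<in> K" for h
  proof (cases "h = 0")
    case False
    define w where "w = x - p"
    define r where "r = (norm h)\<^sup>2"
    have r: "r > 0" using False by (simp add: r_def)
    \<comment> \<open>This coefficient minimises the norm of \<open>w - c *\<^sub>C h\<close> and
      lowers its square by \<open>(cmod (cinner h w))\<^sup>2 / r\<close>; minimality of
      \<open>d\<close> makes the drop zero.\<close>
    define c where "c = cinner h w / of_real r"
    have "p + c *\<^sub>C h \<in> K" using pK h KD by auto
    then have "d\<^sup>2 \<le> (norm (x - (p + c *\<^sub>C h)))\<^sup>2" using dle d0 by (intro power_mono) auto
    also have "x - (p + c *\<^sub>C h) = w - c *\<^sub>C h" by (simp add: w_def)
    also have "(norm (w - c *\<^sub>C h))\<^sup>2 = d\<^sup>2 + (norm (c *\<^sub>C h))\<^sup>2 - 2 * Re (cinner w (c *\<^sub>C h))"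
      by (simp add: norm_diff_sq w_def dp)
    also have "(norm (c *\<^sub>C h))\<^sup>2 = (cmod (cinner h w))\<^sup>2 / r"
      using r by (simp add: norm_scaleC power_mult_distrib c_def norm_divide power_divide flip: r_def)
        (simp add: power2_eq_square)
    also have "cinner w (c *\<^sub>C h) = cinner h w * cnj (cinner h w) / of_real r"
      by (subst cinner_commute) (simp add: cinner_simps c_def)
    also have "\<dots> = of_real ((cmod (cinner h w))\<^sup>2 / r)" by (simp add: complex_norm_square[symmetric] flip: of_real_power)
    finally have "(cmod (cinner h w))\<^sup>2 / r \<le> 0" by simp
    then have "cmod (cinner h w) = 0" using r by (simp add: divide_le_0_iff)
    then show ?thesis by (simp add: w_def)
  qed simp
  with pK show ?thesis by blast
qed

text \<open>A vector \<open>w\<close> orthogonal to the kernel of \<open>f\<close> represents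
  \<open>f\<close> up to a scalar, since \<open>y - (f y / f w) *\<^sub>C w\<close> always lies in
  that kernel.\<close>

lemma riesz_representation:
  fixes f :: "'a::chilbert_space \<Rightarrow> complex"
  assumes bl: "bounded_linear f" and fC: "\<And>c x. f (c *\<^sub>C x) = c * f x"
  shows "\<exists>z. \<forall>x. f x = cinner z x"
proof (cases "\<forall>x. f x = 0")
  case True
  then show ?thesis by (intro exI[of _ 0]) simp
next
  case False
  then obtain a where a: "f a \<noteq> 0" by blast
  interpret f: bounded_linear f by (rule bl)
  have "closed {x. f x = 0}"
    by (intro closed_Collect_eq continuous_intros f.continuous_on)
  then have "closed_csubspace {x. f x = 0}"
    by (auto simp: closed_csubspace_def f.zero f.add fC)
  from orthogonal_projection_exists[OF this, of a]
  obtain p where p: "f p = 0" "\<And>k. f k = 0 \<Longrightarrow> cinner k (a - p) = 0" by blast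
  define w where "w = a - p"
  have fw: "f w \<noteq> 0" using a p by (simp add: w_def f.diff)
  then have w0: "cinner w w \<noteq> 0" using cinner_eq_zero_iff f.zero by metis
  have "f y = cinner ((cnj (f w) / cinner w w) *\<^sub>C w) y" for y
  proof -
    have "f (y - (f y / f w) *\<^sub>C w) = 0" using fw by (simp add: f.diff fC)
    then have "cinner (y - (f y / f w) *\<^sub>C w) w = 0" using p(2) w_def by blast
    then have "cinner w (y - (f y / f w) *\<^sub>C w) = 0" by (subst cinner_commute) simp
    then have "cinner w y = (f y / f w) * cinner w w" by (simp add: cinner_simps)
    then show ?thesis using fw w0 by (simp add: cinner_simps cinner_self)
  qed
  then show ?thesis by blast
qed

subsection \<open>The algebra of bounded operators\<close>

lemma bounded_clinear_op_bounded_linear: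
  assumes "bounded_clinear_op (A :: 'a::chilbert_space \<Rightarrow> 'a)"
  shows "bounded_linear A"
proof -
  obtain K where "\<And>x. norm (A x) \<le> norm x * K" using assms by (auto simp: bounded_clinear_op_def)
  then show ?thesis using assms
    by (intro bounded_linear_intro[of _ K]) (auto simp: bounded_clinear_op_def scaleR_scaleC)
qed

lemma bounded_clinear_opI:
  assumes "bounded_linear A" "\<And>c x. A (c *\<^sub>C x) = c *\<^sub>C A x"
  shows "bounded_clinear_op (A :: 'a::chilbert_space \<Rightarrow> 'a)"
  using assms bounded_linear.bounded[OF assms(1)]
  by (auto simp: bounded_clinear_op_def linear_simps)

lemma bounded_clinear_op_plus:
  fixes A B :: "'a::chilbert_space \<Rightarrow> 'a"
  assumes "bounded_clinear_op A" "bounded_clinear_op B"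
  shows "bounded_clinear_op (\<lambda>x. A x + B x)"
  using assms bounded_linear_add[OF assms[THEN bounded_clinear_op_bounded_linear]]
  by (intro bounded_clinear_opI) (auto simp: bounded_clinear_op_def scaleC_add_right)

lemma bounded_clinear_op_diff:
  fixes A B :: "'a::chilbert_space \<Rightarrow> 'a"
  assumes "bounded_clinear_op A" "bounded_clinear_op B"
  shows "bounded_clinear_op (\<lambda>x. A x - B x)"
  using assms bounded_linear_sub[OF assms[THEN bounded_clinear_op_bounded_linear]]
  by (intro bounded_clinear_opI) (auto simp: bounded_clinear_op_def scaleC_diff_right)

lemma bounded_clinear_op_comp:
  fixes A B :: "'a::chilbert_space \<Rightarrow> 'a"
  assumes "bounded_clinear_op A" "bounded_clinear_op B"
  shows "bounded_clinear_op (\<lambda>x. A (B x))"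
  using assms bounded_linear_compose[OF assms[THEN bounded_clinear_op_bounded_linear]]
  by (intro bounded_clinear_opI) (auto simp: bounded_clinear_op_def)

lemma bounded_clinear_op_minus:
  fixes A :: "'a::chilbert_space \<Rightarrow> 'a"
  assumes "bounded_clinear_op A"
  shows "bounded_clinear_op (\<lambda>x. - A x)"
  using assms bounded_linear_minus[OF assms[THEN bounded_clinear_op_bounded_linear]]
  by (intro bounded_clinear_opI) (auto simp: bounded_clinear_op_def scaleC_minus_right)

lemma bounded_clinear_op_scaleC:
  fixes A :: "'a::chilbert_space \<Rightarrow> 'a"
  assumes "bounded_clinear_op A"
  shows "bounded_clinear_op (\<lambda>x. c *\<^sub>C A x)"
  using assms bounded_linear_compose[OF bounded_linear_scaleC assms[THEN bounded_clinear_op_bounded_linear], of c]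
  by (intro bounded_clinear_opI) (auto simp: bounded_clinear_op_def scaleC_scaleC mult.commute)

lemma adjoint_exists:
  fixes A :: "'a::chilbert_space \<Rightarrow> 'a"
  assumes "bounded_clinear_op A"
  shows "\<exists>B. bounded_clinear_op B \<and> (\<forall>x y. cinner (A x) y = cinner x (B y))"
proof -
  interpret A: bounded_linear A using assms by (rule bounded_clinear_op_bounded_linear)
  have AC: "\<And>c x. A (c *\<^sub>C x) = c *\<^sub>C A x" using assms by (simp add: bounded_clinear_op_def)
  have "\<exists>z. \<forall>x. cinner y (A x) = cinner z x" for y
    by (rule riesz_representation)
       (simp_all add: bounded_linear_compose[OF bounded_linear_cinner_right A.bounded_linear_axioms] AC cinner_simps)
  then obtain B where B: "\<And>y x. cinner y (A x) = cinner (B y) x" by metis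
  have B': "cinner (A x) y = cinner x (B y)" for x y
    using B[of y x] by (metis cinner_commute)
  obtain K where K: "\<And>x. norm (A x) \<le> norm x * K" "K \<ge> 0" using A.nonneg_bounded by blast
  have "bounded_clinear_op B"
    unfolding bounded_clinear_op_def
  proof (intro conjI allI exI[of _ K])
    fix x y c
    show "B (x + y) = B x + B y" by (rule cinner_eqI) (simp add: cinner_simps flip: B')
    show "B (c *\<^sub>C x) = c *\<^sub>C B x" by (rule cinner_eqI) (simp add: cinner_simps flip: B')
    have "(norm (B x))\<^sup>2 = Re (cinner (A (B x)) x)" by (simp add: norm_sq_cinner B')
    also have "\<dots> \<le> cmod (cinner (A (B x)) x)" by (rule complex_Re_le_cmod)
    also have "\<dots> \<le> norm (A (B x)) * norm x" by (rule cauchy_schwarz)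
    also have "\<dots> \<le> (norm (B x) * K) * norm x" by (intro mult_right_mono K) simp
    finally have "norm (B x) * norm (B x) \<le> norm (B x) * (norm x * K)" by (simp add: power2_eq_square ac_simps)
    then show "norm (B x) \<le> norm x * K"
      by (metis K(2) mult_le_cancel_left_pos mult_nonneg_nonneg norm_ge_zero order_less_le)
  qed
  with B' show ?thesis by blast
qed

lemma adj_eqI:
  assumes "\<And>x y. cinner (A x) y = cinner x (B y)"
  shows "adj A = (B :: 'a::complex_inner \<Rightarrow> 'a)"
  unfolding adj_def
proof (rule the_equality)
  fix C assume C: "\<forall>x y. cinner (A x) y = cinner x (C y)"
  show "C = B" by (rule ext, rule cinner_eqI) (metis C assms)
qed (use assms in blast)

lemma adj_bounded_clinear_op: "bounded_clinear_op A \<Longrightarrow> bounded_clinear_op (adj (A :: 'a::chilbert_space \<Rightarrow> 'a))"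
  using adjoint_exists adj_eqI by metis

lemma cinner_adj: "bounded_clinear_op A \<Longrightarrow> cinner (A x) y = cinner x (adj (A :: 'a::chilbert_space \<Rightarrow> 'a) y)"
  using adjoint_exists adj_eqI by metis

text \<open>With boundedness and linearity packed into a type, operator identities become ring
  identities open to simplification. The sets of functions in the theorem are translated only at the
  end.\<close>

typedef (overloaded) 'a bop = "{A :: 'a::chilbert_space \<Rightarrow> 'a. bounded_clinear_op A}"
  morphisms app Bop
  by (rule exI[of _ "\<lambda>x. 0"]) (auto simp: bounded_clinear_op_def intro: exI[of _ 0])

setup_lifting type_definition_bop

notation app (infixr \<open>\<rhd>\<close> 76)

lemma bounded_linear_app: "bounded_linear (app A)"
  using app[of A] by (auto intro: bounded_clinear_op_bounded_linear)

lemma app_add_right: "A \<rhd> (x + y) = A \<rhd> x + A \<rhd> y"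
  and app_diff_right: "A \<rhd> (x - y) = A \<rhd> x - A \<rhd> y"
  and app_minus_right: "A \<rhd> (- x) = - (A \<rhd> x)"
  and app_zero_right [simp]: "A \<rhd> 0 = 0"
  and app_scaleR_right: "A \<rhd> (r *\<^sub>R x) = r *\<^sub>R (A \<rhd> x)"
  by (simp_all add: linear_simps[OF bounded_linear_app])

lemma app_scaleC_right: "A \<rhd> (c *\<^sub>C x) = c *\<^sub>C (A \<rhd> x)"
  using app[of A] by (simp add: bounded_clinear_op_def)

lemma app_bounded: "\<exists>K>0. \<forall>x. norm (A \<rhd> x) \<le> K * norm x"
  using bounded_linear.pos_bounded[OF bounded_linear_app[of A]] by (simp add: mult.commute)

lemma bop_eqI: "(\<And>x. A \<rhd> x = B \<rhd> x) \<Longrightarrow> A = B"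
  by (metis app_inject ext)

text \<open>\<open>ring\<close> and \<open>monoid_mult\<close> rather than \<open>ring_1\<close>,
  because \<open>0 = 1\<close> holds for operators on the zero space.\<close>

instantiation bop :: (chilbert_space) "{ring, monoid_mult, complex_vector, real_algebra}"
begin

lift_definition zero_bop :: "'a bop" is "\<lambda>x. 0"
  by (auto simp: bounded_clinear_op_def intro: exI[of _ 0])

lift_definition one_bop :: "'a bop" is "\<lambda>x. x"
  by (auto simp: bounded_clinear_op_def intro: exI[of _ 1])

lift_definition plus_bop :: "'a bop \<Rightarrow> 'a bop \<Rightarrow> 'a bop" is "\<lambda>A B x. A x + B x"
  by (rule bounded_clinear_op_plus)

lift_definition minus_bop :: "'a bop \<Rightarrow> 'a bop \<Rightarrow> 'a bop" is "\<lambda>A B x. A x - B x"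
  by (rule bounded_clinear_op_diff)

lift_definition uminus_bop :: "'a bop \<Rightarrow> 'a bop" is "\<lambda>A x. - A x"
  by (rule bounded_clinear_op_minus)

lift_definition times_bop :: "'a bop \<Rightarrow> 'a bop \<Rightarrow> 'a bop" is "\<lambda>A B x. A (B x)"
  by (rule bounded_clinear_op_comp)

lift_definition scaleC_bop :: "complex \<Rightarrow> 'a bop \<Rightarrow> 'a bop" is "\<lambda>c A x. c *\<^sub>C A x"
  by (rule bounded_clinear_op_scaleC)

definition scaleR_bop :: "real \<Rightarrow> 'a bop \<Rightarrow> 'a bop" where
  "scaleR_bop r A = of_real r *\<^sub>C A"

instance
proof
  fix A B C :: "'a bop" and a b :: complex and r s :: real
  show "(A + B) * C = A * C + B * C" by transfer simp
  show "A * (B + C) = A * B + A * C" by transfer (simp add: bounded_clinear_op_def)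
  show "A * B * C = A * (B * C)" by transfer simp
  show "1 * A = A" "A * 1 = A" by (transfer, simp)+
  show "A + B + C = A + (B + C)" "A + B = B + A" "0 + A = A" "- A + A = 0" "A - B = A + - B"
    by (transfer, simp add: algebra_simps)+
  show "a *\<^sub>C (A + B) = a *\<^sub>C A + a *\<^sub>C B" by transfer (simp add: scaleC_add_right)
  show "(a + b) *\<^sub>C A = a *\<^sub>C A + b *\<^sub>C A" by transfer (simp add: scaleC_add_left)
  show "a *\<^sub>C b *\<^sub>C A = (a * b) *\<^sub>C A" by transfer (simp add: scaleC_scaleC)
  show "1 *\<^sub>C A = A" by transfer (simp add: scaleC_one)
  show "r *\<^sub>R A = of_real r *\<^sub>C A" by (simp add: scaleR_bop_def)
  show "r *\<^sub>R (A + B) = r *\<^sub>R A + r *\<^sub>R B"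
    unfolding scaleR_bop_def by transfer (simp add: scaleC_add_right)
  show "(r + s) *\<^sub>R A = r *\<^sub>R A + s *\<^sub>R A"
    unfolding scaleR_bop_def by transfer (simp add: scaleC_add_left)
  show "r *\<^sub>R s *\<^sub>R A = (r * s) *\<^sub>R A"
    unfolding scaleR_bop_def by transfer (simp add: scaleC_scaleC)
  show "1 *\<^sub>R A = A" unfolding scaleR_bop_def by transfer (simp add: scaleC_one)
  show "r *\<^sub>R A * B = r *\<^sub>R (A * B)" unfolding scaleR_bop_def by transfer simp
  show "A * r *\<^sub>R B = r *\<^sub>R (A * B)" unfolding scaleR_bop_def by transfer (simp add: bounded_clinear_op_def)
qed

end

lemma app_zero [simp]: "0 \<rhd> x = 0" and app_one [simp]: "1 \<rhd> x = x"
  and app_add: "(A + B) \<rhd> x = A \<rhd> x + B \<rhd> x"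
  and app_diff: "(A - B) \<rhd> x = A \<rhd> x - B \<rhd> x"
  and app_minus: "(- A) \<rhd> x = - (A \<rhd> x)"
  and app_times: "(A * B) \<rhd> x = A \<rhd> B \<rhd> x"
  and app_scaleC: "(c *\<^sub>C A) \<rhd> x = c *\<^sub>C (A \<rhd> x)"
  by (transfer, simp)+

lemma app_scaleR: "(r *\<^sub>R A) \<rhd> x = r *\<^sub>R (A \<rhd> x)"
  by (simp add: scaleR_scaleC app_scaleC)

lemmas app_simps = app_add app_diff app_minus app_times app_scaleC app_scaleR
  app_add_right app_diff_right app_minus_right app_scaleC_right app_scaleR_right

lemma scaleC_times_left: "(c *\<^sub>C A) * B = c *\<^sub>C (A * (B :: 'a::chilbert_space bop))"
  and scaleC_times_right: "A * (c *\<^sub>C B) = c *\<^sub>C (A * (B :: 'a::chilbert_space bop))"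
  by (rule bop_eqI, simp add: app_simps)+

lift_definition star :: "'a::chilbert_space bop \<Rightarrow> 'a bop" (\<open>_\<^sup>\<star>\<close> [1000] 1000) is adj
  by (rule adj_bounded_clinear_op)

lemma cinner_star: "cinner (A \<rhd> x) y = cinner x (A\<^sup>\<star> \<rhd> y)"
  by transfer (rule cinner_adj)

lemma star_eqI: "(\<And>x y. cinner (A \<rhd> x) y = cinner x (B \<rhd> y)) \<Longrightarrow> A\<^sup>\<star> = B"
  by (intro bop_eqI cinner_eqI) (metis cinner_star)

lemma cinner_star': "cinner x (A \<rhd> y) = cinner (A\<^sup>\<star> \<rhd> x) y"
  by (metis cinner_commute cinner_star)

lemma star_star [simp]: "A\<^sup>\<star>\<^sup>\<star> = A"
  by (rule star_eqI) (simp add: cinner_star')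

lemma star_add: "(A + B)\<^sup>\<star> = A\<^sup>\<star> + B\<^sup>\<star>" and star_diff: "(A - B)\<^sup>\<star> = A\<^sup>\<star> - B\<^sup>\<star>"
  and star_minus: "(- A)\<^sup>\<star> = - A\<^sup>\<star>" and star_times: "(A * B)\<^sup>\<star> = B\<^sup>\<star> * A\<^sup>\<star>"
  and star_scaleR: "(r *\<^sub>R A)\<^sup>\<star> = r *\<^sub>R A\<^sup>\<star>"
  and star_scaleC: "(c *\<^sub>C A)\<^sup>\<star> = cnj c *\<^sub>C A\<^sup>\<star>"
  by (rule star_eqI, simp add: app_simps cinner_simps cinner_star)+

lemma star_zero [simp]: "0\<^sup>\<star> = (0 :: 'a::chilbert_space bop)" and star_one [simp]: "1\<^sup>\<star> = (1 :: 'a::chilbert_space bop)"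
  by (rule star_eqI, simp)+

lemmas star_simps = star_add star_diff star_minus star_times star_scaleR star_scaleC

lemma star_times_self_eq_zero: "A\<^sup>\<star> * A = 0 \<longleftrightarrow> A = 0"
proof
  assume A: "A\<^sup>\<star> * A = 0"
  show "A = 0"
  proof (rule bop_eqI)
    fix x
    have "cinner (A \<rhd> x) (A \<rhd> x) = 0" using A by (simp add: cinner_star flip: app_times)
    then show "A \<rhd> x = 0 \<rhd> x" by (simp add: cinner_eq_zero_iff)
  qed
qed simp

subsection \<open>Positive operators, projections and square roots\<close>

text \<open>The operator order is expressed through this predicate: \<open>A \<le> c\<close> is
  written \<open>pos (c *\<^sub>R 1 - A)\<close>.\<close>

definition pos :: "'a::chilbert_space bop \<Rightarrow> bool" where
  "pos A \<longleftrightarrow> A\<^sup>\<star> = A \<and> (\<forall>x. 0 \<le> Re (cinner x (A \<rhd> x)))"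

lemma pos_selfadjoint: "pos A \<Longrightarrow> A\<^sup>\<star> = A"
  by (simp add: pos_def)

lemma pos_add: "pos A \<Longrightarrow> pos B \<Longrightarrow> pos (A + B)"
  by (auto simp: pos_def star_simps app_simps cinner_simps)

lemma pos_scaleR: "pos A \<Longrightarrow> 0 \<le> r \<Longrightarrow> pos (r *\<^sub>R A)"
  by (auto simp: pos_def star_simps app_simps cinner_simps)

lemma pos_conj: "pos A \<Longrightarrow> pos (B\<^sup>\<star> * A * B)"
  by (auto simp: pos_def star_simps app_simps cinner_star[symmetric] mult.assoc)

lemma pos_one: "pos 1"
  by (simp add: pos_def cinner_self)

lemma pos_star_times: "pos (A\<^sup>\<star> * A)"
  using pos_conj[OF pos_one, of A] by simp

lemma bounded_above:
  fixes A :: "'a::chilbert_space bop"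
  assumes "A\<^sup>\<star> = A"
  shows "\<exists>c>0. pos (c *\<^sub>R 1 - A) \<and> pos (c *\<^sub>R 1 + A)"
proof -
  obtain K where K: "K > 0" "\<And>x. norm (A \<rhd> x) \<le> K * norm x" using app_bounded by blast
  have "\<bar>Re (cinner x (A \<rhd> x))\<bar> \<le> K * (norm x)\<^sup>2" for x
  proof -
    have "\<bar>Re (cinner x (A \<rhd> x))\<bar> \<le> norm x * norm (A \<rhd> x)"
      using abs_Re_le_cmod cauchy_schwarz order_trans by blast
    also have "\<dots> \<le> norm x * (K * norm x)" by (intro mult_left_mono K) simp
    finally show ?thesis by (simp add: power2_eq_square ac_simps)
  qed
  then have "pos (K *\<^sub>R 1 - A)" "pos (K *\<^sub>R 1 + A)" using assms
    by (auto simp: pos_def star_simps app_simps cinner_simps cinner_self abs_le_iff)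
       (metis add.commute add.inverse_inverse le_diff_eq add_0 diff_minus_eq_add)+
  then show ?thesis using K(1) by blast
qed

text \<open>The claim is positivity of \<open>T * D\<close> for \<open>D = c - T\<close>. It follows
  because \<open>c\<close> times this product is \<open>T * D * T + D * T * D\<close>, a sum of
  conjugates of positive operators.\<close>

lemma norm_sq_le_pos:
  assumes T: "pos T" and cT: "pos (c *\<^sub>R 1 - T)" and c: "c > 0"
  shows "(norm (T \<rhd> x))\<^sup>2 \<le> c * Re (cinner x (T \<rhd> x))"
proof -
  let ?D = "c *\<^sub>R 1 - T"
  have "pos (T * ?D * T + ?D * T * ?D)"
    using pos_add[OF pos_conj[OF cT, of T] pos_conj[OF T, of ?D]] pos_selfadjoint[OF T] pos_selfadjoint[OF cT]
    by (simp only:)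
  moreover have "T * ?D * T + ?D * T * ?D = c *\<^sub>R (c *\<^sub>R T - T * T)"
    by (simp add: algebra_simps)
  ultimately have "0 \<le> c * Re (cinner x ((c *\<^sub>R T - T * T) \<rhd> x))"
    by (auto simp: pos_def app_simps cinner_simps)
  then have "0 \<le> Re (cinner x ((c *\<^sub>R T - T * T) \<rhd> x))" using c by (simp add: zero_le_mult_iff)
  moreover have "cinner x (T \<rhd> T \<rhd> x) = of_real ((norm (T \<rhd> x))\<^sup>2)"
    using pos_selfadjoint[OF T] by (metis cinner_self cinner_star)
  ultimately show ?thesis by (simp add: app_simps cinner_simps)
qed

lemma norm_le_pos:
  assumes T: "pos T" and cT: "pos (c *\<^sub>R 1 - T)" and c: "c > 0"
  shows "norm (T \<rhd> x) \<le> c * norm x"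
proof -
  have "Re (cinner x (T \<rhd> x)) \<le> c * (norm x)\<^sup>2"
    using cT by (auto simp: pos_def app_simps cinner_simps cinner_self)
  then have "(norm (T \<rhd> x))\<^sup>2 \<le> c * (c * (norm x)\<^sup>2)"
    using norm_sq_le_pos[OF assms, of x] c by (meson mult_left_mono order_trans less_imp_le)
  then have "(norm (T \<rhd> x))\<^sup>2 \<le> (c * norm x)\<^sup>2" by (simp add: power2_eq_square ac_simps)
  then show ?thesis using c by (simp add: power2_le_iff_abs_le abs_mult)
qed

lemma strong_limit_exists:
  fixes Y :: "nat \<Rightarrow> 'a::chilbert_space bop"
  assumes conv: "\<And>x. convergent (\<lambda>n. Y n \<rhd> x)" and bd: "\<And>n x. norm (Y n \<rhd> x) \<le> norm x"
  shows "\<exists>L. (\<forall>x. (\<lambda>n. Y n \<rhd> x) \<longlonglongrightarrow> L \<rhd> x) \<and> (\<forall>x. norm (L \<rhd> x) \<le> norm x)"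
proof -
  define L where "L x = lim (\<lambda>n. Y n \<rhd> x)" for x
  have L: "(\<lambda>n. Y n \<rhd> x) \<longlonglongrightarrow> L x" for x
    unfolding L_def using conv convergent_LIMSEQ_iff by blast
  have nL: "norm (L x) \<le> norm x" for x
    by (rule LIMSEQ_le_const2[OF tendsto_norm[OF L]]) (use bd in blast)
  have "bounded_clinear_op L"
    unfolding bounded_clinear_op_def
  proof (intro conjI allI exI[of _ 1])
    fix x y c
    show "L (x + y) = L x + L y"
      by (rule LIMSEQ_unique[OF L]) (use tendsto_add[OF L[of x] L[of y]] in \<open>simp add: app_simps\<close>)
    show "L (c *\<^sub>C x) = c *\<^sub>C L x"
      by (rule LIMSEQ_unique[OF L])
         (use bounded_linear.tendsto[OF bounded_linear_scaleC L[of x]] in \<open>simp add: app_simps\<close>)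
    show "norm (L x) \<le> norm x * 1" using nL by simp
  qed
  then show ?thesis using L nL by (intro exI[of _ "Bop L"]) (simp add: Bop_inverse)
qed

text \<open>The iteration \<open>Y \<mapsto> (B + Y\<^sup>2) / 2\<close> converges to \<open>1 - sqrt (1 - B)\<close>; each increment is dominated
  in norm by the increment of the same iteration on the scalar \<open>1\<close>.\<close>

fun sqrt_iter :: "'a::chilbert_space bop \<Rightarrow> nat \<Rightarrow> 'a bop" where
  "sqrt_iter B 0 = 0"
| "sqrt_iter B (Suc n) = (1/2) *\<^sub>R (B + sqrt_iter B n * sqrt_iter B n)"

fun sqrt_iter_real :: "nat \<Rightarrow> real" where
  "sqrt_iter_real 0 = 0"
| "sqrt_iter_real (Suc n) = (1 + sqrt_iter_real n * sqrt_iter_real n) / 2"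

lemma sqrt_iter_real_bounds: "0 \<le> sqrt_iter_real n \<and> sqrt_iter_real n \<le> 1"
proof (induction n)
  case (Suc n)
  then have "sqrt_iter_real n * sqrt_iter_real n \<le> 1 * 1" by (intro mult_mono) auto
  then show ?case using Suc by simp
qed simp

lemma sqrt_iter_real_Suc: "sqrt_iter_real n \<le> sqrt_iter_real (Suc n)"
  using zero_le_square[of "1 - sqrt_iter_real n"] by (simp add: algebra_simps)

lemma sqrt_iter_increment:
  fixes B :: "'a::chilbert_space bop"
  assumes B: "\<And>x. norm (B \<rhd> x) \<le> norm x"
  shows "(\<forall>x. norm (sqrt_iter B n \<rhd> x) \<le> sqrt_iter_real n * norm x) \<and>
    (\<forall>x. norm (sqrt_iter B (Suc n) \<rhd> x) \<le> sqrt_iter_real (Suc n) * norm x) \<and>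
    (\<forall>x. norm ((sqrt_iter B (Suc n) - sqrt_iter B n) \<rhd> x)
       \<le> (sqrt_iter_real (Suc n) - sqrt_iter_real n) * norm x)"
proof (induction n)
  case 0
  show ?case using B by (auto simp: app_simps)
next
  case (Suc n)
  let ?Y = "sqrt_iter B" and ?y = "sqrt_iter_real"
  let ?D = "?Y (Suc n) - ?Y n" and ?d = "?y (Suc n) - ?y n"
  have y0: "0 \<le> ?y n" "0 \<le> ?y (Suc n)" "0 \<le> ?d"
    using sqrt_iter_real_bounds[of n] sqrt_iter_real_bounds[of "Suc n"] sqrt_iter_real_Suc[of n]
    by (auto simp del: sqrt_iter_real.simps)
  have Y1: "norm (?Y (Suc n) \<rhd> x) \<le> ?y (Suc n) * norm x" for x using Suc by blast
  have Y0: "norm (?Y n \<rhd> x) \<le> ?y n * norm x" for x using Suc by blast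
  have D: "norm (?D \<rhd> x) \<le> ?d * norm x" for x using Suc by blast
  have "norm (?Y (Suc (Suc n)) \<rhd> x) \<le> ?y (Suc (Suc n)) * norm x" for x
  proof -
    have "norm (?Y (Suc n) \<rhd> ?Y (Suc n) \<rhd> x) \<le> ?y (Suc n) * (?y (Suc n) * norm x)"
      using Y1[of "?Y (Suc n) \<rhd> x"] Y1[of x] y0 by (meson mult_left_mono order_trans)
    then have "norm (B \<rhd> x + ?Y (Suc n) \<rhd> ?Y (Suc n) \<rhd> x) \<le> norm x + ?y (Suc n) * (?y (Suc n) * norm x)"
      by (intro norm_triangle_mono B)
    then show ?thesis by (subst sqrt_iter.simps, subst sqrt_iter_real.simps)
      (simp add: app_scaleR app_add app_times algebra_simps del: sqrt_iter.simps sqrt_iter_real.simps scaleR_add_right)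
  qed
  moreover have "norm ((?Y (Suc (Suc n)) - ?Y (Suc n)) \<rhd> x) \<le> (?y (Suc (Suc n)) - ?y (Suc n)) * norm x" for x
  proof -
    \<comment> \<open>The difference of two squares is split so that \<open>?D\<close> appears once
      in each summand; the scalar sequence satisfies the same identity, so the bounds match term by
      term.\<close>
    have "?Y (Suc (Suc n)) - ?Y (Suc n) = (1/2) *\<^sub>R (?Y (Suc n) * ?D + ?D * ?Y n)"
      by (subst sqrt_iter.simps, subst (2) sqrt_iter.simps)
         (simp add: algebra_simps del: sqrt_iter.simps)
    then have "norm ((?Y (Suc (Suc n)) - ?Y (Suc n)) \<rhd> x) = norm (?Y (Suc n) \<rhd> ?D \<rhd> x + ?D \<rhd> ?Y n \<rhd> x) / 2"
      by (simp add: app_add app_times app_scaleR del: sqrt_iter.simps)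
    also have "\<dots> \<le> (?y (Suc n) * (?d * norm x) + ?d * (?y n * norm x)) / 2"
    proof -
      have "norm (?Y (Suc n) \<rhd> ?D \<rhd> x) \<le> ?y (Suc n) * (?d * norm x)"
        using Y1[of "?D \<rhd> x"] D[of x] y0 by (meson mult_left_mono order_trans)
      moreover have "norm (?D \<rhd> ?Y n \<rhd> x) \<le> ?d * (?y n * norm x)"
        using D[of "?Y n \<rhd> x"] Y0[of x] y0 by (meson mult_left_mono order_trans)
      ultimately show ?thesis by (intro divide_right_mono norm_triangle_mono) auto
    qed
    also have "\<dots> = (?y (Suc (Suc n)) - ?y (Suc n)) * norm x"
    proof -
      have "?y (Suc (Suc n)) = (1 + ?y (Suc n) * ?y (Suc n)) / 2" "?y (Suc n) = (1 + ?y n * ?y n) / 2"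
        by simp_all
      then have "?y (Suc (Suc n)) - ?y (Suc n) = (?y (Suc n) * ?d + ?d * ?y n) / 2"
        by (simp only: right_diff_distrib left_diff_distrib add_divide_distrib diff_divide_distrib)
      then show ?thesis by (simp only:) argo
    qed
    finally show ?thesis .
  qed
  ultimately show ?case using Suc by (auto simp del: sqrt_iter.simps sqrt_iter_real.simps)
qed

text \<open>The strong limit \<open>L\<close> of the iteration solves
  \<open>L + L = B + L * L\<close>, that is, \<open>1 - L\<close> squares to \<open>1 - B\<close>.
  Self-adjointness and commutation hold for every iterate and pass to the limit.\<close>

lemma sqrt_one_minus_exists:
  fixes B :: "'a::chilbert_space bop"
  assumes B: "\<And>x. norm (B \<rhd> x) \<le> norm x" and sa: "B\<^sup>\<star> = B"
  shows "\<exists>S. pos S \<and> S * S = 1 - B \<and> (\<forall>C. C * B = B * C \<longrightarrow> C * S = S * C)"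
proof -
  let ?Y = "sqrt_iter B" and ?y = "sqrt_iter_real"
  have nY: "norm (?Y n \<rhd> x) \<le> norm x" for n x
  proof -
    have "norm (?Y n \<rhd> x) \<le> ?y n * norm x" using sqrt_iter_increment[OF B] by blast
    also have "\<dots> \<le> 1 * norm x" using sqrt_iter_real_bounds by (intro mult_right_mono) auto
    finally show ?thesis by simp
  qed
  have diff: "norm (?Y (n + k) \<rhd> x - ?Y n \<rhd> x) \<le> (?y (n + k) - ?y n) * norm x" for n k x
  proof (induction k)
    case (Suc k)
    have "norm (?Y (Suc (n + k)) \<rhd> x - ?Y (n + k) \<rhd> x) \<le> (?y (Suc (n + k)) - ?y (n + k)) * norm x"
      using sqrt_iter_increment[OF B, of "n + k"] by (simp only: app_diff)
    from norm_triangle_mono[OF this Suc] show ?case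
      by (simp add: algebra_simps del: sqrt_iter.simps sqrt_iter_real.simps)
  qed simp
  have "incseq ?y" by (rule incseq_SucI) (rule sqrt_iter_real_Suc)
  then have "convergent ?y"
    using sqrt_iter_real_bounds by (metis incseq_convergent convergentI)
  then have Cy: "Cauchy ?y" by (rule convergent_Cauchy)
  have conv: "convergent (\<lambda>n. ?Y n \<rhd> x)" for x
  proof (rule Cauchy_convergent, rule CauchyI)
    fix e :: real assume e: "e > 0"
    define e' where "e' = e / (norm x + 1)"
    have e': "e' > 0" using e by (simp add: e'_def add_nonneg_pos)
    obtain N where N: "\<And>m n. m \<ge> N \<Longrightarrow> n \<ge> N \<Longrightarrow> norm (?y m - ?y n) < e'"
      using CauchyD[OF Cy e'] by blast
    have *: "norm (?Y m \<rhd> x - ?Y n \<rhd> x) < e" if "n \<ge> N" "m \<ge> n" for m n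
    proof -
      have "norm (?Y m \<rhd> x - ?Y n \<rhd> x) \<le> (?y m - ?y n) * norm x"
        using diff[of n "m - n" x] that by simp
      also have "\<dots> \<le> e' * norm x"
        using N[of m n] that by (intro mult_right_mono) auto
      also have "\<dots> < e' * (norm x + 1)" using e' by simp
      also have "\<dots> = e" unfolding e'_def by (simp add: add_nonneg_eq_0_iff)
      finally show ?thesis .
    qed
    show "\<exists>M. \<forall>m\<ge>M. \<forall>n\<ge>M. norm (?Y m \<rhd> x - ?Y n \<rhd> x) < e"
      using * by (metis nle_le norm_minus_commute)
  qed
  obtain L where L: "\<And>x. (\<lambda>n. ?Y n \<rhd> x) \<longlonglongrightarrow> L \<rhd> x" and nL: "\<And>x. norm (L \<rhd> x) \<le> norm x"
    using strong_limit_exists[of ?Y, OF conv nY] by blast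
  have saY: "(?Y n)\<^sup>\<star> = ?Y n" for n
    by (induction n) (simp_all add: star_simps sa)
  have saL: "L\<^sup>\<star> = L"
  proof (rule star_eqI)
    fix x y
    have "(\<lambda>n. cinner y (?Y n \<rhd> x)) \<longlonglongrightarrow> cinner y (L \<rhd> x)"
      by (rule bounded_linear.tendsto[OF bounded_linear_cinner_right L])
    from tendsto_cnj[OF this] have 1: "(\<lambda>n. cinner (?Y n \<rhd> x) y) \<longlonglongrightarrow> cinner (L \<rhd> x) y"
      by (simp flip: cinner_commute)
    have "(\<lambda>n. cinner x (?Y n \<rhd> y)) \<longlonglongrightarrow> cinner x (L \<rhd> y)"
      by (rule bounded_linear.tendsto[OF bounded_linear_cinner_right L])
    then have "(\<lambda>n. cinner (?Y n \<rhd> x) y) \<longlonglongrightarrow> cinner x (L \<rhd> y)"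
      by (simp add: cinner_star saY)
    with 1 show "cinner (L \<rhd> x) y = cinner x (L \<rhd> y)" by (rule LIMSEQ_unique)
  qed
  have commL: "C * L = L * C" if C: "C * B = B * C" for C
  proof (rule bop_eqI)
    fix x
    have CY: "C * ?Y n = ?Y n * C" for n
    proof (induction n)
      case (Suc n)
      have "C * (?Y n * ?Y n) = (?Y n * ?Y n) * C" using Suc by (metis mult.assoc)
      then show ?case using C by (simp add: algebra_simps)
    qed simp
    have "(\<lambda>n. C \<rhd> ?Y n \<rhd> x) \<longlonglongrightarrow> C \<rhd> L \<rhd> x"
      by (rule bounded_linear.tendsto[OF bounded_linear_app L])
    moreover have "(\<lambda>n. C \<rhd> ?Y n \<rhd> x) \<longlonglongrightarrow> L \<rhd> C \<rhd> x"
      using L[of "C \<rhd> x"] CY by (simp flip: app_times)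
    ultimately show "(C * L) \<rhd> x = (L * C) \<rhd> x" by (simp add: app_times LIMSEQ_unique)
  qed
  have LL: "L + L = B + L * L"
  proof (rule bop_eqI)
    fix x
    \<comment> \<open>The factors \<open>?Y n\<close> are contractions, so they send the error
      \<open>?Y n \<rhd> x - L \<rhd> x\<close> to a null sequence; the rest is convergence at the
      fixed vector \<open>L \<rhd> x\<close>.\<close>
    have YY: "(\<lambda>n. ?Y n \<rhd> ?Y n \<rhd> x) \<longlonglongrightarrow> L \<rhd> L \<rhd> x"
    proof -
      have z1: "(\<lambda>n. ?Y n \<rhd> x - L \<rhd> x) \<longlonglongrightarrow> 0" using L[of x] LIM_zero by blast
      have "(\<lambda>n. ?Y n \<rhd> (?Y n \<rhd> x - L \<rhd> x)) \<longlonglongrightarrow> 0"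
        by (rule Lim_null_comparison[OF _ tendsto_norm_zero[OF z1]]) (simp add: nY)
      from tendsto_add[OF this L[of "L \<rhd> x"]] show ?thesis by (simp add: app_simps)
    qed
    have "(\<lambda>n. ?Y (Suc n) \<rhd> x) \<longlonglongrightarrow> L \<rhd> x" using L[of x] by (rule LIMSEQ_Suc)
    moreover have "(\<lambda>n. ?Y (Suc n) \<rhd> x) \<longlonglongrightarrow> (1/2) *\<^sub>R (B \<rhd> x + L \<rhd> L \<rhd> x)"
      using tendsto_scaleR[OF tendsto_const tendsto_add[OF tendsto_const YY], of "1/2" "B \<rhd> x"]
      by (simp add: app_simps)
    ultimately have "L \<rhd> x = (1/2) *\<^sub>R (B \<rhd> x + L \<rhd> L \<rhd> x)" by (rule LIMSEQ_unique)
    from arg_cong[OF this, of "scaleR 2"] have "2 *\<^sub>R (L \<rhd> x) = B \<rhd> x + L \<rhd> L \<rhd> x" by simp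
    then show "(L + L) \<rhd> x = (B + L * L) \<rhd> x" by (simp add: app_simps scaleR_2)
  qed
  have "pos (1 - L)"
    unfolding pos_def
  proof (intro conjI allI)
    fix x
    have "Re (cinner x (L \<rhd> x)) \<le> norm x * norm (L \<rhd> x)"
      using complex_Re_le_cmod cauchy_schwarz order_trans by blast
    also have "\<dots> \<le> norm x * norm x" by (intro mult_left_mono nL) simp
    finally show "0 \<le> Re (cinner x ((1 - L) \<rhd> x))"
      by (simp add: app_simps cinner_simps cinner_self power2_eq_square)
  qed (simp add: star_simps saL)
  moreover have "(1 - L) * (1 - L) = 1 - B" using LL by (simp add: algebra_simps)
  moreover have "C * (1 - L) = (1 - L) * C" if "C * B = B * C" for C
    using commL[OF that] by (simp add: algebra_simps)
  ultimately show ?thesis by blast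
qed

text \<open>After division by an upper bound \<open>c\<close>, the operator \<open>1 - A / c\<close>
  is a contraction. The commutation clause is what keeps later constructions inside a von Neumann
  algebra containing \<open>A\<close>.\<close>

lemma sqrt_exists:
  fixes A :: "'a::chilbert_space bop"
  assumes A: "pos A"
  shows "\<exists>S. pos S \<and> S * S = A \<and> (\<forall>C. C * A = A * C \<longrightarrow> C * S = S * C)"
proof -
  obtain c where c: "c > 0" "pos (c *\<^sub>R 1 - A)" using bounded_above A pos_selfadjoint by blast
  define B where "B = 1 - (1/c) *\<^sub>R A"
  have B1: "B = (1/c) *\<^sub>R (c *\<^sub>R 1 - A)" using c by (simp add: B_def algebra_simps)
  have "pos B" unfolding B1 using c by (intro pos_scaleR) auto
  moreover have "pos (1 *\<^sub>R 1 - B)" using pos_scaleR[OF A, of "1/c"] c by (simp add: B_def)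
  ultimately have nB: "norm (B \<rhd> x) \<le> norm x" for x using norm_le_pos[of B 1 x] by simp
  obtain S where S: "pos S" "S * S = 1 - B" "\<And>C. C * B = B * C \<Longrightarrow> C * S = S * C"
    using sqrt_one_minus_exists[OF nB pos_selfadjoint[OF \<open>pos B\<close>]] by blast
  have "pos (sqrt c *\<^sub>R S)" using S(1) c by (intro pos_scaleR) auto
  moreover have "(sqrt c *\<^sub>R S) * (sqrt c *\<^sub>R S) = A" using c S(2) by (simp add: B_def)
  moreover have "C * (sqrt c *\<^sub>R S) = (sqrt c *\<^sub>R S) * C" if "C * A = A * C" for C
    using S(3)[of C] that by (simp add: B_def algebra_simps)
  ultimately show ?thesis by blast
qed

definition proj :: "'a::chilbert_space bop \<Rightarrow> bool" where
  "proj P \<longleftrightarrow> P * P = P \<and> P\<^sup>\<star> = P"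

lemma proj_idem: "proj P \<Longrightarrow> P * P = P" and proj_star: "proj P \<Longrightarrow> P\<^sup>\<star> = P"
  by (simp_all add: proj_def)

lemma proj_zero [simp]: "proj 0" and proj_one [simp]: "proj 1"
  by (simp_all add: proj_def)

lemma proj_compl: "proj P \<Longrightarrow> proj (1 - P)"
  by (auto simp: proj_def star_simps algebra_simps)

lemma closed_csubspace_common_kernel:
  "closed_csubspace {x :: 'a::chilbert_space. \<forall>T\<in>\<T>. T \<rhd> x = 0}"
proof -
  have "closed {x. T \<rhd> x = 0}" for T :: "'a bop"
    by (intro closed_Collect_eq continuous_intros bounded_linear.continuous_on[OF bounded_linear_app])
  then have "closed (\<Inter>T\<in>\<T>. {x. T \<rhd> x = 0})" by blast
  moreover have "(\<Inter>T\<in>\<T>. {x. T \<rhd> x = 0}) = {x. \<forall>T\<in>\<T>. T \<rhd> x = 0}" by blast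
  ultimately show ?thesis by (auto simp: closed_csubspace_def app_simps)
qed

text \<open>Linearity of the nearest-point map is read off from uniqueness of the orthogonal
  decomposition (\<open>uniq\<close>), its bound from Pythagoras.\<close>

lemma projection_onto_exists:
  assumes K: "closed_csubspace K"
  shows "\<exists>P. proj P \<and> (\<forall>x. P \<rhd> x \<in> K) \<and> (\<forall>x\<in>K. P \<rhd> x = x)"
proof -
  note KD = closed_csubspaceD[OF K]
  obtain f where fK: "\<And>x. f x \<in> K" and f: "\<And>x k. k \<in> K \<Longrightarrow> cinner k (x - f x) = 0"
    using orthogonal_projection_exists[OF K] by metis
  have uniq: "f x = p" if "p \<in> K" "\<And>k. k \<in> K \<Longrightarrow> cinner k (x - p) = 0" for x p
  proof -
    have "p - f x \<in> K" using that(1) fK KD by blast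
    then have "cinner (p - f x) (x - f x) = 0" "cinner (p - f x) (x - p) = 0"
      using f that(2) by blast+
    then have "cinner (p - f x) ((x - f x) - (x - p)) = 0" by (simp only: cinner_simps) simp
    then show ?thesis by (simp add: cinner_eq_zero_iff)
  qed
  have pyth: "norm (f x) \<le> norm x" for x
  proof -
    have "(norm (f x + (x - f x)))\<^sup>2 = (norm (f x))\<^sup>2 + (norm (x - f x))\<^sup>2"
      using f[OF fK, of x x] by (simp only: norm_add_sq) simp
    then have "(norm (f x))\<^sup>2 \<le> (norm x)\<^sup>2" by simp
    then show ?thesis by simp
  qed
  have bf: "bounded_clinear_op f"
    unfolding bounded_clinear_op_def
  proof (intro conjI allI exI[of _ 1])
    fix x y c
    show "f (x + y) = f x + f y"
    proof (rule uniq)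
      fix k assume k: "k \<in> K"
      have "x + y - (f x + f y) = (x - f x) + (y - f y)" by simp
      then show "cinner k (x + y - (f x + f y)) = 0" using f[OF k, of x] f[OF k, of y]
        by (simp only: cinner_add_right add_0_right)
    qed (intro KD(3) fK)
    show "f (c *\<^sub>C x) = c *\<^sub>C f x"
    proof (rule uniq)
      fix k assume k: "k \<in> K"
      have "c *\<^sub>C x - c *\<^sub>C f x = c *\<^sub>C (x - f x)" by (simp add: scaleC_diff_right)
      then show "cinner k (c *\<^sub>C x - c *\<^sub>C f x) = 0" using f[OF k, of x]
        by (simp only: cinner_scaleC_right mult_zero_right)
    qed (intro KD(4) fK)
    show "norm (f x) \<le> norm x * 1" using pyth by simp
  qed
  define P where "P = Bop f"
  have P: "P \<rhd> x = f x" for x by (simp add: P_def Bop_inverse bf)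
  have fid: "f x = x" if "x \<in> K" for x using that by (intro uniq) auto
  have "P * P = P" by (rule bop_eqI) (simp add: app_times P fid fK)
  moreover have "P\<^sup>\<star> = P"
  proof (rule star_eqI)
    fix x y
    have "cinner (f x) y = cinner (f x) (f y)" using f[OF fK, of x y] by (simp add: cinner_simps)
    moreover have "cinner x (f y) = cinner (f x) (f y)"
      using f[OF fK, of y x] by (subst (1 2) cinner_commute) (simp add: cinner_simps)
    ultimately show "cinner (P \<rhd> x) y = cinner x (P \<rhd> y)" by (simp add: P)
  qed
  ultimately show ?thesis using fK fid P by (auto simp: proj_def)
qed

text \<open>The projection onto the closed span of \<open>X\<close>, described as the common kernel of all operators
  that vanish on \<open>X\<close>.\<close>

lemma span_projection_exists:
  "\<exists>P. proj P \<and> (\<forall>x\<in>X. P \<rhd> x = x) \<and> (\<forall>T. (\<forall>x\<in>X. T \<rhd> x = 0) \<longrightarrow> T * P = 0)"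
proof -
  define K where "K = {x. \<forall>T\<in>{T. \<forall>x\<in>X. T \<rhd> x = 0}. T \<rhd> x = 0}"
  have "closed_csubspace K" unfolding K_def by (rule closed_csubspace_common_kernel)
  from projection_onto_exists[OF this] obtain P where
    P: "proj P" "\<And>x. P \<rhd> x \<in> K" "\<And>x. x \<in> K \<Longrightarrow> P \<rhd> x = x" by blast
  have "T * P = 0" if "\<forall>x\<in>X. T \<rhd> x = 0" for T
    by (rule bop_eqI) (use P(2) that in \<open>auto simp: K_def app_times\<close>)
  moreover have "X \<subseteq> K" by (auto simp: K_def)
  ultimately show ?thesis using P by blast
qed

text \<open>Invariance of the range under \<open>C\<close> gives \<open>C * P = P * C * P\<close>;
  invariance under \<open>C\<^sup>\<star>\<close>, after taking adjoints, gives
  \<open>P * C = P * C * P\<close>.\<close>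

lemma proj_commute_if_invariant:
  assumes "proj P" "(1 - P) * C * P = 0" "(1 - P) * C\<^sup>\<star> * P = 0"
  shows "C * P = P * C"
proof -
  have "C * P = P * C * P" using assms(2) by (simp add: algebra_simps)
  moreover have "C\<^sup>\<star> * P = P * C\<^sup>\<star> * P" using assms(3) by (simp add: algebra_simps)
  then have "(C\<^sup>\<star> * P)\<^sup>\<star> = (P * C\<^sup>\<star> * P)\<^sup>\<star>" by (rule arg_cong)
  then have "P * C = P * C * P" using proj_star[OF assms(1)] proj_idem[OF assms(1)] by (simp add: star_times mult.assoc)
  ultimately show ?thesis by simp
qed

text \<open>Equivalently, \<open>C\<close> commutes with both \<open>T\<close> and
  \<open>T\<^sup>\<star>\<close>. Operators that commute with all such \<open>C\<close> lie in every
  von Neumann algebra containing \<open>T\<close>.\<close>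

definition star_commute :: "'a::chilbert_space bop \<Rightarrow> 'a bop \<Rightarrow> bool" where
  "star_commute T C \<longleftrightarrow> C * T = T * C \<and> C\<^sup>\<star> * T = T * C\<^sup>\<star>"

text \<open>Whatever annihilates \<open>S\<close> annihilates its range projection. Applied to
  \<open>(1 - P) * C\<close>, this gives invariance of the closed range under \<open>C\<close>,
  hence commutation.\<close>

lemma range_projection_exists:
  fixes S :: "'a::chilbert_space bop"
  shows "\<exists>P. proj P \<and> P * S = S \<and> (\<forall>T. T * S = 0 \<longrightarrow> T * P = 0) \<and> (\<forall>C. star_commute S C \<longrightarrow> C * P = P * C)"
proof -
  obtain P where P: "proj P" "\<And>x. P \<rhd> S \<rhd> x = S \<rhd> x"
    "\<And>T. \<forall>x\<in>range (app S). T \<rhd> x = 0 \<Longrightarrow> T * P = 0"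
    using span_projection_exists[of "range (app S)"] by auto
  have ann: "T * P = 0" if "T * S = 0" for T
    using P(3)[of T] that by (metis app_times app_zero rangeE)
  have PS: "P * S = S" by (rule bop_eqI) (simp add: app_times P(2))
  have inv: "(1 - P) * C * P = 0" if "C * S = S * C" for C
  proof (rule ann)
    have "(1 - P) * C * S = ((1 - P) * S) * C" using that by (simp add: mult.assoc)
    then show "(1 - P) * C * S = 0" using PS by (simp add: left_diff_distrib)
  qed
  have "C * P = P * C" if "star_commute S C" for C
    using that inv by (intro proj_commute_if_invariant P(1)) (auto simp: star_commute_def)
  with P(1) PS ann show ?thesis by blast
qed

lemma pos_mult_proj:
  assumes "pos A" "proj P" "P * A = A * P"
  shows "pos (P * A)"
proof -
  have "P\<^sup>\<star> * A * P = P * (P * A)" by (simp only: proj_star[OF assms(2)] mult.assoc assms(3)[symmetric])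
  also have "\<dots> = P * A" using assms(2) by (simp add: proj_idem flip: mult.assoc)
  finally show ?thesis using pos_conj[OF assms(1), of P] by simp
qed

text \<open>With \<open>N = sqrt (S * S)\<close>, the absolute value of \<open>S\<close>, take the
  range projection \<open>P\<close> of \<open>N + S\<close>. From
  \<open>(N - S) * (N + S) = 0\<close> it follows that \<open>S = N\<close> on \<open>P\<close>, and
  \<open>P * (N + S) = N + S\<close> gives \<open>S = - N\<close> on the complement.\<close>

lemma spectral_projection_exists:
  assumes S: "S\<^sup>\<star> = S"
  shows "\<exists>P. proj P \<and> pos (P * S) \<and> pos (- ((1 - P) * S)) \<and> (\<forall>C. star_commute S C \<longrightarrow> C * P = P * C)"
proof -
  obtain N where N: "pos N" "N * N = S * S" "\<And>C. C * (S * S) = (S * S) * C \<Longrightarrow> C * N = N * C"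
    using sqrt_exists[of "S * S"] pos_star_times[of S] unfolding S by blast
  have comN: "C * N = N * C" if "C * S = S * C" for C
    using that by (intro N(3)) (metis mult.assoc)
  obtain P where P: "proj P" "P * (N + S) = N + S" "\<And>T. T * (N + S) = 0 \<Longrightarrow> T * P = 0"
    "\<And>C. star_commute (N + S) C \<Longrightarrow> C * P = P * C"
    using range_projection_exists[of "N + S"] by blast
  have com: "C * P = P * C" if "star_commute S C" for C
    using that comN by (intro P(4)) (auto simp: star_commute_def algebra_simps)
  have SN: "S * N = N * S" by (rule comN) simp
  have PS: "S * P = P * S" using S by (intro com) (auto simp: star_commute_def)
  have PN: "N * P = P * N"
    using comN[of N] pos_selfadjoint[OF N(1)] SN S by (intro com) (auto simp: star_commute_def)
  have "(N - S) * (N + S) = 0" using N(2) SN by (simp add: algebra_simps)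
  then have "(N - S) * P = 0" by (rule P(3))
  then have 1: "P * S = P * N" using PS PN by (simp add: algebra_simps)
  have 2: "- ((1 - P) * S) = (1 - P) * N" using P(2) by (simp add: algebra_simps)
  have "pos (P * S)" unfolding 1 by (rule pos_mult_proj[OF N(1) P(1)]) (simp add: PN)
  moreover have "pos (- ((1 - P) * S))" unfolding 2
    by (rule pos_mult_proj[OF N(1) proj_compl[OF P(1)]]) (simp add: PN algebra_simps)
  ultimately show ?thesis using P(1) com by blast
qed

text \<open>Dyadic expansion: a positive \<open>T \<le> c\<close> is a norm-convergent series \<open>\<Sum>n. c / 2 ^ (n+1) *\<^sub>R P\<^sub>n\<close> of
  spectral projections, so the commutator of \<open>C\<close> with \<open>T\<close> is that with arbitrarily small remainders.\<close>

lemma commute_if_commute_spectral_projections: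
  assumes T: "T\<^sup>\<star> = T"
    and C: "\<And>P. proj P \<Longrightarrow> (\<And>D. star_commute T D \<Longrightarrow> D * P = P * D) \<Longrightarrow> C * P = P * C"
  shows "C * T = T * C"
proof -
  obtain a where a: "a > 0" "pos (a *\<^sub>R 1 - T)" "pos (a *\<^sub>R 1 + T)" using bounded_above[OF T] by blast
  define c where "c = a + a"
  have c: "c > 0" using a by (simp add: c_def)
  \<comment> \<open>\<open>R\<close> is the remainder after \<open>n\<close> digits of the expansion
    of a positive translate of \<open>T\<close>; its commutator with \<open>C\<close> is still that
    of \<open>T\<close>.\<close>
  have step: "\<exists>R. pos R \<and> pos ((c / 2 ^ n) *\<^sub>R 1 - R) \<and> (\<forall>D. star_commute T D \<longrightarrow> star_commute R D)
      \<and> C * T - T * C = C * R - R * C" for n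
  proof (induction n)
    case 0
    have "(c / 2 ^ 0) *\<^sub>R 1 - (a *\<^sub>R 1 + T) = a *\<^sub>R 1 - T"
      by (simp only: c_def scaleR_left_distrib power_0 div_by_1) simp
    then have "pos (a *\<^sub>R 1 + T)" "pos ((c / 2 ^ 0) *\<^sub>R 1 - (a *\<^sub>R 1 + T))"
      using a by (simp_all only:)
    moreover have "star_commute (a *\<^sub>R 1 + T) D" if "star_commute T D" for D
      using that by (auto simp: star_commute_def algebra_simps)
    ultimately show ?case by (intro exI[of _ "a *\<^sub>R 1 + T"]) (auto simp: algebra_simps)
  next
    case (Suc n)
    define b where "b = c / 2 ^ Suc n"
    have b: "b > 0" "c / 2 ^ n = b + b" using c by (auto simp: b_def)
    from Suc obtain R where R: "pos R" "pos ((b + b) *\<^sub>R 1 - R)"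
      "\<And>D. star_commute T D \<Longrightarrow> star_commute R D" "C * T - T * C = C * R - R * C"
      unfolding b by blast
    note saR = pos_selfadjoint[OF R(1)]
    \<comment> \<open>The next digit is the projection where the remainder exceeds the midpoint
      \<open>b\<close> of its range; subtracting \<open>b\<close> there leaves a remainder between
      \<open>0\<close> and \<open>b\<close>.\<close>
    define S where "S = R - b *\<^sub>R 1"
    have "S\<^sup>\<star> = S" by (simp add: S_def star_simps saR)
    then obtain P where P: "proj P" "pos (P * S)" "pos (- ((1 - P) * S))"
      "\<And>C. star_commute S C \<Longrightarrow> C * P = P * C" using spectral_projection_exists by blast
    have com: "D * P = P * D" if "star_commute R D" for D
      using that by (intro P(4)) (auto simp: S_def star_commute_def algebra_simps)
    have RP: "R * P = P * R" using saR by (intro com) (auto simp: star_commute_def)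
    define R' where "R' = R - b *\<^sub>R P"
    have "R' = P * S + (1 - P) * R" by (simp add: R'_def S_def algebra_simps)
    moreover have "pos ((1 - P) * R)"
      using RP by (intro pos_mult_proj R(1) proj_compl P(1)) (simp add: algebra_simps)
    ultimately have "pos R'" using P(2) pos_add by simp
    moreover have "b *\<^sub>R 1 - R' = - ((1 - P) * S) + P * ((b + b) *\<^sub>R 1 - R)"
      by (simp only: R'_def S_def scaleR_left_distrib) (simp add: algebra_simps)
    moreover have "pos (P * ((b + b) *\<^sub>R 1 - R))"
      using RP by (intro pos_mult_proj R(2) P(1)) (simp add: algebra_simps)
    ultimately have "pos R'" "pos (b *\<^sub>R 1 - R')" using P(3) pos_add by (simp_all only:)
    moreover have "star_commute R' D" if "star_commute T D" for D
    proof -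
      have D: "star_commute R D" using R(3) that by blast
      moreover have "star_commute R (D\<^sup>\<star>)" using D by (auto simp: star_commute_def)
      ultimately have "D * P = P * D" "D\<^sup>\<star> * P = P * D\<^sup>\<star>" using com by blast+
      with D show ?thesis by (auto simp: R'_def star_commute_def algebra_simps)
    qed
    moreover have "C * P = P * C" by (intro C P(1) com R(3))
    then have "C * T - T * C = C * R' - R' * C" by (simp add: R(4) R'_def algebra_simps)
    ultimately show ?case unfolding b_def by blast
  qed
  obtain K where K: "K > 0" "\<And>x. norm (C \<rhd> x) \<le> K * norm x" using app_bounded by blast
  have "(C * T - T * C) \<rhd> x = 0" for x
  proof -
    have bd: "norm ((C * T - T * C) \<rhd> x) \<le> (2 * K * c * norm x) * (1/2) ^ n" for n
    proof -
      obtain R where R: "pos R" "pos ((c / 2 ^ n) *\<^sub>R 1 - R)" "C * T - T * C = C * R - R * C"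
        using step by blast
      have nR: "norm (R \<rhd> y) \<le> c / 2 ^ n * norm y" for y using norm_le_pos[OF R(1,2)] c by simp
      have "norm (C \<rhd> R \<rhd> x) \<le> K * (c / 2 ^ n * norm x)"
        using K(2)[of "R \<rhd> x"] nR[of x] K(1) by (meson mult_left_mono order_trans less_imp_le)
      moreover have "norm (R \<rhd> C \<rhd> x) \<le> c / 2 ^ n * (K * norm x)"
        using nR[of "C \<rhd> x"] K(2)[of x] c by (meson mult_left_mono order_trans less_imp_le divide_pos_pos zero_less_power zero_less_numeral)
      ultimately have "norm (C \<rhd> R \<rhd> x - R \<rhd> C \<rhd> x) \<le> K * (c / 2 ^ n * norm x) + c / 2 ^ n * (K * norm x)"
        by (rule norm_triangle_le_diff[OF add_mono])
      also have "\<dots> = (2 * K * c * norm x) * (1/2) ^ n" by (simp add: power_divide)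
      finally show ?thesis by (simp add: R(3) app_simps)
    qed
    have "(\<lambda>n. (2 * K * c * norm x) * (1/2::real) ^ n) \<longlonglongrightarrow> (2 * K * c * norm x) * 0"
      by (intro tendsto_intros LIMSEQ_power_zero) simp
    then have "norm ((C * T - T * C) \<rhd> x) \<le> (2 * K * c * norm x) * 0"
      by (rule LIMSEQ_le_const) (use bd in blast)
    then show ?thesis by simp
  qed
  then have "C * T - T * C = 0" by (intro bop_eqI) simp
  then show ?thesis by simp
qed

subsection \<open>Orthogonal sums of partial isometries\<close>

lemma norm_sum_orthogonal:
  fixes f :: "'i \<Rightarrow> 'a::complex_inner"
  assumes "finite F" "\<And>i j. i \<in> F \<Longrightarrow> j \<in> F \<Longrightarrow> i \<noteq> j \<Longrightarrow> cinner (f i) (f j) = 0"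
  shows "(norm (sum f F))\<^sup>2 = (\<Sum>i\<in>F. (norm (f i))\<^sup>2)"
  using assms
proof (induction F rule: finite_induct)
  case (insert a F)
  have "cinner (f a) (sum f F) = (\<Sum>i\<in>F. cinner (f a) (f i))"
    by (rule linear_sum[OF bounded_linear.linear[OF bounded_linear_cinner_right]])
  also have "\<dots> = 0" using insert by (intro sum.neutral) auto
  finally show ?case using insert by (simp add: norm_add_sq)
qed simp

text \<open>For orthogonal terms the norm of a tail is controlled by sums of squares: once a finite
  set comes within \<open>(e/2)\<^sup>2\<close> of their supremum, every larger finite sum stays
  within \<open>e/2\<close>.\<close>

lemma orthogonal_summable:
  fixes f :: "'i \<Rightarrow> 'a::chilbert_space"
  assumes orth: "\<And>i j. i \<in> I \<Longrightarrow> j \<in> I \<Longrightarrow> i \<noteq> j \<Longrightarrow> cinner (f i) (f j) = 0"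
    and bd: "\<And>F. finite F \<Longrightarrow> F \<subseteq> I \<Longrightarrow> (\<Sum>i\<in>F. (norm (f i))\<^sup>2) \<le> B"
  shows "f summable_on I" and "(norm (infsum f I))\<^sup>2 \<le> B"
proof -
  let ?s = "\<lambda>F. \<Sum>i\<in>F. (norm (f i))\<^sup>2"
  have ns: "(norm (sum f F))\<^sup>2 = ?s F" if "finite F" "F \<subseteq> I" for F
    using that orth by (intro norm_sum_orthogonal) auto
  define S where "S = (SUP F\<in>{F. finite F \<and> F \<subseteq> I}. ?s F)"
  have bdd: "bdd_above (?s ` {F. finite F \<and> F \<subseteq> I})" using bd by (auto intro!: bdd_aboveI2)
  have "cauchy_filter (filtermap (sum f) (finite_subsets_at_top I))"
    unfolding cauchy_filter_metric_filtermap
  proof (intro allI impI)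
    fix e :: real assume e: "e > 0"
    have "S - (e/2)\<^sup>2 < (SUP F\<in>{F. finite F \<and> F \<subseteq> I}. ?s F)" using e by (simp add: S_def)
    then obtain F0 where F0: "finite F0" "F0 \<subseteq> I" "S - (e/2)\<^sup>2 < ?s F0"
      using less_cSUP_iff[OF _ bdd] by auto
    have near: "dist (sum f Y) (sum f F0) < e/2" if Y: "finite Y" "F0 \<subseteq> Y" "Y \<subseteq> I" for Y
    proof -
      have "sum f Y - sum f F0 = sum f (Y - F0)" using Y by (simp add: sum_diff)
      then have "(norm (sum f Y - sum f F0))\<^sup>2 = ?s (Y - F0)" using Y ns[of "Y - F0"] by auto
      also have "\<dots> = ?s Y - ?s F0" using Y by (simp add: sum_diff)
      also have "\<dots> < (e/2)\<^sup>2" using F0(3) cSUP_upper[OF _ bdd, of Y] Y unfolding S_def by auto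
      finally have "norm (sum f Y - sum f F0) < e/2" by (rule power2_less_imp_less) (use e in simp)
      then show ?thesis by (simp add: dist_norm)
    qed
    show "\<exists>P. eventually P (finite_subsets_at_top I) \<and> (\<forall>x y. P x \<and> P y \<longrightarrow> dist (sum f x) (sum f y) < e)"
    proof (intro exI[of _ "\<lambda>Y. finite Y \<and> F0 \<subseteq> Y \<and> Y \<subseteq> I"] conjI allI impI)
      show "eventually (\<lambda>Y. finite Y \<and> F0 \<subseteq> Y \<and> Y \<subseteq> I) (finite_subsets_at_top I)"
        unfolding eventually_finite_subsets_at_top using F0 by blast
      fix X Y assume "(finite X \<and> F0 \<subseteq> X \<and> X \<subseteq> I) \<and> (finite Y \<and> F0 \<subseteq> Y \<and> Y \<subseteq> I)"
      then show "dist (sum f X) (sum f Y) < e" using near[of X] near[of Y] dist_triangle_half_l by blast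
    qed
  qed
  moreover have "complete (UNIV::'a set)"
    by (meson Cauchy_convergent UNIV_I complete_def convergent_def)
  ultimately obtain x where x: "(sum f \<longlongrightarrow> x) (finite_subsets_at_top I)"
    using cauchy_filter_complete_converges[of "filtermap (sum f) (finite_subsets_at_top I)" UNIV]
    by (auto simp: filtermap_bot_iff filterlim_def)
  then have hs: "(f has_sum x) I" by (simp add: has_sum_def)
  then show "f summable_on I" by (auto simp: summable_on_def)
  have "((\<lambda>F. (norm (sum f F))\<^sup>2) \<longlongrightarrow> (norm x)\<^sup>2) (finite_subsets_at_top I)"
    by (intro tendsto_intros x)
  then have "(norm x)\<^sup>2 \<le> B"
    by (rule tendsto_upperbound)
       (auto simp: eventually_finite_subsets_at_top ns bd intro!: exI[of _ "{}"])
  then show "(norm (infsum f I))\<^sup>2 \<le> B" using hs infsumI by blast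
qed

text \<open>Products are normalised to the right, where a relation \<open>A * B = C\<close> matches
  only at the end of a word; this form makes it match in the middle.\<close>

lemma times_assoc_rule: "A * B = C \<Longrightarrow> A * (B * X) = C * (X :: 'a::semigroup_mult)"
  by (metis mult.assoc)

definition pisom :: "'a::chilbert_space bop \<Rightarrow> bool" where
  "pisom V \<longleftrightarrow> V * V\<^sup>\<star> * V = V"

lemma pisom_simps:
  assumes "pisom V"
  shows "V * (V\<^sup>\<star> * V) = V" "V\<^sup>\<star> * (V * V\<^sup>\<star>) = V\<^sup>\<star>"
    "V * (V\<^sup>\<star> * (V * X)) = V * X" "V\<^sup>\<star> * (V * (V\<^sup>\<star> * X)) = V\<^sup>\<star> * X"
proof -
  show 1: "V * (V\<^sup>\<star> * V) = V" using assms by (simp add: pisom_def mult.assoc)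
  from arg_cong[OF this, of star] show 2: "V\<^sup>\<star> * (V * V\<^sup>\<star>) = V\<^sup>\<star>" by (simp add: star_times mult.assoc)
  show "V * (V\<^sup>\<star> * (V * X)) = V * X" using arg_cong[OF 1, of "\<lambda>A. A * X"] by (simp add: mult.assoc)
  show "V\<^sup>\<star> * (V * (V\<^sup>\<star> * X)) = V\<^sup>\<star> * X" using arg_cong[OF 2, of "\<lambda>A. A * X"] by (simp add: mult.assoc)
qed

lemma pisom_star: "pisom V \<Longrightarrow> pisom (V\<^sup>\<star>)"
  by (simp add: pisom_def pisom_simps mult.assoc)

lemma proj_initial: "pisom V \<Longrightarrow> proj (V\<^sup>\<star> * V)" and proj_final: "pisom V \<Longrightarrow> proj (V * V\<^sup>\<star>)"
  by (simp_all add: proj_def star_times pisom_simps mult.assoc)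

lemma pisom_proj: "proj P \<Longrightarrow> pisom P"
  by (simp add: proj_def pisom_def)

text \<open>The defect \<open>V - V * V\<^sup>\<star> * V\<close> vanishes because its product with
  its own adjoint does.\<close>

lemma pisom_if_initial:
  assumes "proj (V\<^sup>\<star> * V)"
  shows "pisom V"
proof -
  let ?P = "V\<^sup>\<star> * V" and ?X = "V - V * (V\<^sup>\<star> * V)"
  have PP: "V\<^sup>\<star> * (V * (V\<^sup>\<star> * V)) = V\<^sup>\<star> * V" using proj_idem[OF assms] by (simp add: mult.assoc)
  then have "?X\<^sup>\<star> * ?X = 0" by (simp add: star_simps algebra_simps)
  then have "?X = 0" by (simp only: star_times_self_eq_zero)
  then show ?thesis by (simp add: pisom_def mult.assoc)
qed

text \<open>The two products vanish exactly when the initial, respectively the final, projections of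
  \<open>T i\<close> and \<open>T j\<close> are orthogonal.\<close>

definition ortho_family :: "'i set \<Rightarrow> ('i \<Rightarrow> 'a::chilbert_space bop) \<Rightarrow> bool" where
  "ortho_family I T \<longleftrightarrow> (\<forall>i\<in>I. pisom (T i)) \<and>
     (\<forall>i\<in>I. \<forall>j\<in>I. i \<noteq> j \<longrightarrow> T i * (T j)\<^sup>\<star> = 0 \<and> (T i)\<^sup>\<star> * T j = 0)"

text \<open>The sum is taken pointwise, that is, in the strong topology. \<open>Bop\<close> has a
  meaning here only when the pointwise sum is a bounded operator, which \<open>ortho_family\<close>
  guarantees.\<close>

definition osum :: "'i set \<Rightarrow> ('i \<Rightarrow> 'a::chilbert_space bop) \<Rightarrow> 'a bop" where
  "osum I T = Bop (\<lambda>x. infsum (\<lambda>i. T i \<rhd> x) I)"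

lemma ortho_familyD:
  assumes "ortho_family I T"
  shows "i \<in> I \<Longrightarrow> pisom (T i)" "i \<in> I \<Longrightarrow> j \<in> I \<Longrightarrow> i \<noteq> j \<Longrightarrow> T i * (T j)\<^sup>\<star> = 0"
    "i \<in> I \<Longrightarrow> j \<in> I \<Longrightarrow> i \<noteq> j \<Longrightarrow> (T i)\<^sup>\<star> * T j = 0"
  using assms by (auto simp: ortho_family_def)

lemma ortho_family_star: "ortho_family I T \<Longrightarrow> ortho_family I (\<lambda>i. (T i)\<^sup>\<star>)"
  by (auto simp: ortho_family_def pisom_star)

text \<open>\<open>T i \<rhd> x\<close> has the norm of \<open>P i \<rhd> x\<close>, where the
  initial projections \<open>P i\<close> are orthogonal. The sum \<open>y\<close> of the latter
  satisfies that \<open>cinner x y\<close> is the squared norm of \<open>y\<close>, so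
  Cauchy-Schwarz bounds \<open>y\<close> by \<open>x\<close>.\<close>

lemma ortho_family_bessel:
  assumes T: "ortho_family I T" and F: "finite F" "F \<subseteq> I"
  shows "(\<Sum>i\<in>F. (norm (T i \<rhd> x))\<^sup>2) \<le> (norm x)\<^sup>2"
proof -
  define P where "P i = (T i)\<^sup>\<star> * T i" for i
  have nP: "cinner x (P i \<rhd> x) = of_real ((norm (T i \<rhd> x))\<^sup>2)" for i
    by (simp add: P_def app_times cinner_self flip: cinner_star)
  have PP: "(P i)\<^sup>\<star> * P i = P i" if "i \<in> I" for i
    using proj_initial[OF ortho_familyD(1)[OF T that]] by (simp add: P_def proj_def)
  have nP': "(norm (P i \<rhd> x))\<^sup>2 = (norm (T i \<rhd> x))\<^sup>2" if "i \<in> I" for i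
  proof -
    have "(norm (P i \<rhd> x))\<^sup>2 = Re (cinner x (((P i)\<^sup>\<star> * P i) \<rhd> x))"
      by (simp add: norm_sq_cinner cinner_star app_times)
    then show ?thesis using PP[OF that] nP by simp
  qed
  have "cinner (P i \<rhd> x) (P j \<rhd> x) = 0" if "i \<in> I" "j \<in> I" "i \<noteq> j" for i j
  proof -
    have "(P i)\<^sup>\<star> * P j = 0" using ortho_familyD(2)[OF T that]
      by (simp add: P_def star_times mult.assoc times_assoc_rule)
    then show ?thesis by (simp add: cinner_star flip: app_times)
  qed
  then have ns: "(norm (\<Sum>i\<in>F. P i \<rhd> x))\<^sup>2 = (\<Sum>i\<in>F. (norm (T i \<rhd> x))\<^sup>2)" (is "(norm ?y)\<^sup>2 = ?s")
  proof -
    assume *: "\<And>i j. i \<in> I \<Longrightarrow> j \<in> I \<Longrightarrow> i \<noteq> j \<Longrightarrow> cinner (P i \<rhd> x) (P j \<rhd> x) = 0"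
    have "(norm (\<Sum>i\<in>F. P i \<rhd> x))\<^sup>2 = (\<Sum>i\<in>F. (norm (P i \<rhd> x))\<^sup>2)"
      by (rule norm_sum_orthogonal[OF F(1)]) (use * F(2) in blast)
    also have "\<dots> = ?s" using F(2) nP' by (intro sum.cong) auto
    finally show ?thesis .
  qed
  have "cinner x ?y = (\<Sum>i\<in>F. cinner x (P i \<rhd> x))"
    by (rule linear_sum[OF bounded_linear.linear[OF bounded_linear_cinner_right]])
  then have "cinner x ?y = of_real ?s" using nP by simp
  then have "?s \<le> norm x * norm ?y"
    using cauchy_schwarz[of x ?y] by (simp del: of_real_sum)
  then have "norm ?y * norm ?y \<le> norm x * norm ?y" using ns by (simp add: power2_eq_square)
  then have "norm ?y \<le> norm x" by (metis mult_le_cancel_right norm_ge_zero order_le_less)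
  then show ?thesis using ns by (metis norm_ge_zero power_mono)
qed

lemma osum_has_sum:
  assumes T: "ortho_family I T"
  shows "((\<lambda>i. T i \<rhd> x) has_sum (osum I T \<rhd> x)) I"
proof -
  have orth: "cinner (T i \<rhd> x) (T j \<rhd> x) = 0" if "i \<in> I" "j \<in> I" "i \<noteq> j" for i j x
    using ortho_familyD(3)[OF T that] by (simp add: cinner_star flip: app_times)
  have sm: "(\<lambda>i. T i \<rhd> x) summable_on I" for x
    by (rule orthogonal_summable(1)[OF orth ortho_family_bessel[OF T]])
  have nb: "norm (infsum (\<lambda>i. T i \<rhd> x) I) \<le> norm x" for x
    using orthogonal_summable(2)[OF orth ortho_family_bessel[OF T], of I x] by simp
  have "bounded_clinear_op (\<lambda>x. infsum (\<lambda>i. T i \<rhd> x) I)"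
    unfolding bounded_clinear_op_def
  proof (intro conjI allI exI[of _ 1])
    fix x y c
    show "infsum (\<lambda>i. T i \<rhd> (x + y)) I = infsum (\<lambda>i. T i \<rhd> x) I + infsum (\<lambda>i. T i \<rhd> y) I"
      by (simp add: app_add_right infsum_add sm)
    show "infsum (\<lambda>i. T i \<rhd> (c *\<^sub>C x)) I = c *\<^sub>C infsum (\<lambda>i. T i \<rhd> x) I"
      unfolding app_scaleC_right
      by (rule infsumI) (rule has_sum_bounded_linear[OF bounded_linear_scaleC has_sum_infsum[OF sm]])
    show "norm (infsum (\<lambda>i. T i \<rhd> x) I) \<le> norm x * 1" using nb by simp
  qed
  then have "osum I T \<rhd> x = infsum (\<lambda>i. T i \<rhd> x) I" by (simp add: osum_def Bop_inverse)
  then show ?thesis using has_sum_infsum[OF sm] by simp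
qed

lemma osum_eqI:
  assumes "ortho_family I T" "\<And>x. ((\<lambda>i. T i \<rhd> x) has_sum (A \<rhd> x)) I"
  shows "osum I T = A"
  by (rule bop_eqI) (use has_sum_unique[OF osum_has_sum[OF assms(1)] assms(2)] in blast)

lemma has_sum_single:
  fixes f :: "'i \<Rightarrow> 'a::{t2_space, topological_comm_monoid_add}"
  assumes "j \<in> I" "\<And>i. i \<in> I \<Longrightarrow> i \<noteq> j \<Longrightarrow> f i = 0"
  shows "(f has_sum f j) I"
proof -
  have "(f has_sum f j) {j}" by (rule has_sum_finiteI) auto
  then show ?thesis using assms by (subst has_sum_cong_neutral[where T = "{j}" and g = f]) auto
qed

lemma osum_times_single:
  assumes T: "ortho_family I T" and j: "j \<in> I" and "\<And>i. i \<in> I \<Longrightarrow> i \<noteq> j \<Longrightarrow> T i * B = 0"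
  shows "osum I T * B = T j * B"
proof (rule bop_eqI)
  fix x
  have "((\<lambda>i. T i \<rhd> B \<rhd> x) has_sum (T j \<rhd> B \<rhd> x)) I"
    by (rule has_sum_single[OF j]) (metis assms(3) app_times app_zero)
  then show "(osum I T * B) \<rhd> x = (T j * B) \<rhd> x"
    using osum_has_sum[OF T, of "B \<rhd> x"] has_sum_unique by (auto simp: app_times)
qed

lemma osum_times_zero:
  assumes T: "ortho_family I T" and "\<And>i. i \<in> I \<Longrightarrow> T i * B = 0"
  shows "osum I T * B = 0"
proof (rule bop_eqI)
  fix x
  have "((\<lambda>i. T i \<rhd> B \<rhd> x) has_sum 0) I"
    by (rule has_sum_0) (metis assms(2) app_times app_zero)
  then show "(osum I T * B) \<rhd> x = 0 \<rhd> x"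
    using osum_has_sum[OF T, of "B \<rhd> x"] has_sum_unique by (auto simp: app_times)
qed

lemma osum_star:
  assumes T: "ortho_family I T"
  shows "(osum I T)\<^sup>\<star> = osum I (\<lambda>i. (T i)\<^sup>\<star>)"
proof (rule star_eqI)
  fix x y
  have 1: "((\<lambda>i. cinner x ((T i)\<^sup>\<star> \<rhd> y)) has_sum cinner x (osum I (\<lambda>i. (T i)\<^sup>\<star>) \<rhd> y)) I"
    by (rule has_sum_bounded_linear[OF bounded_linear_cinner_right osum_has_sum[OF ortho_family_star[OF T]]])
  have "((\<lambda>i. cinner y (T i \<rhd> x)) has_sum cinner y (osum I T \<rhd> x)) I"
    by (rule has_sum_bounded_linear[OF bounded_linear_cinner_right osum_has_sum[OF T]])
  then have "((\<lambda>i. cnj (cinner y (T i \<rhd> x))) has_sum cnj (cinner y (osum I T \<rhd> x))) I"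
    by (simp only: has_sum_cnj_iff)
  then have "((\<lambda>i. cinner x ((T i)\<^sup>\<star> \<rhd> y)) has_sum cinner (osum I T \<rhd> x) y) I"
    by (simp add: cinner_star flip: cinner_commute)
  with 1 show "cinner (osum I T \<rhd> x) y = cinner x (osum I (\<lambda>i. (T i)\<^sup>\<star>) \<rhd> y)"
    by (meson has_sum_unique)
qed

lemma times_osum_zero:
  assumes T: "ortho_family I T" and B: "\<And>i. i \<in> I \<Longrightarrow> B * T i = 0"
  shows "B * osum I T = 0"
proof -
  have "(B * osum I T)\<^sup>\<star> = osum I (\<lambda>i. (T i)\<^sup>\<star>) * B\<^sup>\<star>" by (simp add: star_times osum_star[OF T])
  also have "\<dots> = 0"
    by (rule osum_times_zero[OF ortho_family_star[OF T]]) (metis B star_times star_zero)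
  finally show ?thesis by (metis star_star star_zero)
qed

lemma times_osum_single:
  assumes T: "ortho_family I T" and j: "j \<in> I" and B: "\<And>i. i \<in> I \<Longrightarrow> i \<noteq> j \<Longrightarrow> B * T i = 0"
  shows "B * osum I T = B * T j"
proof -
  have "(B * osum I T)\<^sup>\<star> = osum I (\<lambda>i. (T i)\<^sup>\<star>) * B\<^sup>\<star>" by (simp add: star_times osum_star[OF T])
  also have "\<dots> = (T j)\<^sup>\<star> * B\<^sup>\<star>"
    by (rule osum_times_single[OF ortho_family_star[OF T] j]) (metis B star_times star_zero)
  finally show ?thesis by (metis star_star star_times)
qed

text \<open>By the bicommutant property, this is why orthogonal sums of elements of a von Neumann
  algebra stay in it.\<close>

lemma osum_commute:
  assumes T: "ortho_family I T" and C: "\<And>i. i \<in> I \<Longrightarrow> C * T i = T i * C"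
  shows "C * osum I T = osum I T * C"
proof (rule bop_eqI)
  fix x
  have "((\<lambda>i. C \<rhd> T i \<rhd> x) has_sum (C \<rhd> osum I T \<rhd> x)) I"
    by (rule has_sum_bounded_linear[OF bounded_linear_app osum_has_sum[OF T]])
  moreover have "((\<lambda>i. C \<rhd> T i \<rhd> x) has_sum (osum I T \<rhd> C \<rhd> x)) I"
    using osum_has_sum[OF T, of "C \<rhd> x"] C by (subst has_sum_cong[where g = "\<lambda>i. T i \<rhd> C \<rhd> x"]) (auto simp flip: app_times)
  ultimately show "(C * osum I T) \<rhd> x = (osum I T * C) \<rhd> x"
    using has_sum_unique by (auto simp: app_times)
qed

lemma osum_times_osum:
  assumes S: "ortho_family I S" and T: "ortho_family I T" and ST: "ortho_family I (\<lambda>i. S i * T i)"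
    and 0: "\<And>i j. i \<in> I \<Longrightarrow> j \<in> I \<Longrightarrow> i \<noteq> j \<Longrightarrow> S i * T j = 0"
  shows "osum I S * osum I T = osum I (\<lambda>i. S i * T i)"
proof (rule osum_eqI[OF ST, symmetric])
  fix x
  have "osum I S * T j = S j * T j" if "j \<in> I" for j
    by (rule osum_times_single[OF S that]) (use 0 that in blast)
  then have "osum I S \<rhd> T j \<rhd> x = (S j * T j) \<rhd> x" if "j \<in> I" for j
    using that by (metis app_times)
  moreover have "((\<lambda>i. osum I S \<rhd> T i \<rhd> x) has_sum (osum I S \<rhd> osum I T \<rhd> x)) I"
    by (rule has_sum_bounded_linear[OF bounded_linear_app osum_has_sum[OF T]])
  ultimately show "((\<lambda>i. (S i * T i) \<rhd> x) has_sum ((osum I S * osum I T) \<rhd> x)) I"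
    by (subst has_sum_cong[where g = "\<lambda>i. osum I S \<rhd> T i \<rhd> x"]) (auto simp: app_times)
qed

lemma ortho_family_initial:
  assumes T: "ortho_family I T"
  shows "ortho_family I (\<lambda>i. (T i)\<^sup>\<star> * T i)"
  using ortho_familyD[OF T] unfolding ortho_family_def
  by (auto simp: pisom_proj proj_initial star_times mult.assoc times_assoc_rule)

lemma osum_initial:
  assumes T: "ortho_family I T"
  shows "(osum I T)\<^sup>\<star> * osum I T = osum I (\<lambda>i. (T i)\<^sup>\<star> * T i)"
  unfolding osum_star[OF T]
  by (intro osum_times_osum ortho_family_star ortho_family_initial T) (use ortho_familyD(3)[OF T] in auto)

lemma osum_final:
  assumes T: "ortho_family I T"
  shows "osum I T * (osum I T)\<^sup>\<star> = osum I (\<lambda>i. T i * (T i)\<^sup>\<star>)"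
  using osum_initial[OF ortho_family_star[OF T]] by (simp add: osum_star[OF T] osum_star[OF ortho_family_star[OF T]])

lemma osum_proj:
  assumes T: "ortho_family I T" and P: "\<And>i. i \<in> I \<Longrightarrow> proj (T i)"
  shows "proj (osum I T)"
proof -
  have *: "osum I (\<lambda>i. (T i)\<^sup>\<star>) = osum I T" "osum I (\<lambda>i. (T i)\<^sup>\<star> * T i) = osum I T"
    using P by (auto simp: osum_def proj_def intro!: arg_cong[of _ _ Bop] ext infsum_cong)
  then show ?thesis using osum_initial[OF T] osum_star[OF T] by (simp add: proj_def)
qed

lemma osum_pisom:
  assumes T: "ortho_family I T"
  shows "pisom (osum I T)"
proof (rule pisom_if_initial)
  show "proj ((osum I T)\<^sup>\<star> * osum I T)"
    unfolding osum_initial[OF T]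
    by (rule osum_proj[OF ortho_family_initial[OF T]]) (use ortho_familyD(1)[OF T] proj_initial in blast)
qed

lemma ortho_family_projI:
  assumes "\<And>i. i \<in> I \<Longrightarrow> proj (P i)" "\<And>i j. i \<in> I \<Longrightarrow> j \<in> I \<Longrightarrow> i \<noteq> j \<Longrightarrow> P i * P j = 0"
  shows "ortho_family I P"
  using assms by (auto simp: ortho_family_def pisom_proj proj_star)

subsection \<open>Partial isometries in a von Neumann algebra\<close>

text \<open>The lower bound makes the range closed. Its projection \<open>Q\<close> satisfies
  \<open>Q * K = K\<close>, by adjoints \<open>K * Q = K\<close>, and injectivity of
  \<open>K\<close> forces \<open>Q = 1\<close>, so \<open>K\<close> is onto.\<close>

lemma bounded_below_selfadjoint_invertible:
  fixes K :: "'a::chilbert_space bop"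
  assumes sa: "K\<^sup>\<star> = K" and d: "d > 0" and below: "\<And>x. d * norm x \<le> norm (K \<rhd> x)"
  shows "\<exists>L. L * K = 1 \<and> K * L = 1"
proof -
  have inj: "x = y" if "K \<rhd> x = K \<rhd> y" for x y
  proof -
    have "d * norm (x - y) \<le> 0" using below[of "x - y"] that by (simp add: app_simps)
    then show ?thesis using d by (simp add: mult_le_0_iff)
  qed
  have "closed (range (app K))"
    unfolding closed_sequential_limits
  proof (intro allI impI, elim conjE)
    fix y l assume y: "\<forall>n::nat. y n \<in> range (app K)" and l: "y \<longlonglongrightarrow> l"
    from y have "\<forall>n. \<exists>x. y n = K \<rhd> x" by blast
    then obtain x where x: "\<And>n. y n = K \<rhd> x n" by metis
    have "Cauchy x"
    proof (rule CauchyI)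
      fix e :: real assume e: "e > 0"
      obtain N where N: "\<And>m n. m \<ge> N \<Longrightarrow> n \<ge> N \<Longrightarrow> norm (y m - y n) < d * e"
        using CauchyD[OF LIMSEQ_imp_Cauchy[OF l], of "d * e"] d e by auto
      have "norm (x m - x n) < e" if "m \<ge> N" "n \<ge> N" for m n
      proof -
        have "d * norm (x m - x n) \<le> norm (y m - y n)"
          using below[of "x m - x n"] by (simp add: x app_simps)
        also have "\<dots> < d * e" by (rule N[OF that])
        finally show ?thesis using d by simp
      qed
      then show "\<exists>M. \<forall>m\<ge>M. \<forall>n\<ge>M. norm (x m - x n) < e" by blast
    qed
    then obtain z where "x \<longlonglongrightarrow> z" using Cauchy_convergent convergent_def by blast
    then have "(\<lambda>n. K \<rhd> x n) \<longlonglongrightarrow> K \<rhd> z" by (rule bounded_linear.tendsto[OF bounded_linear_app])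
    then have "y \<longlonglongrightarrow> K \<rhd> z" by (simp add: x[abs_def])
    then show "l \<in> range (app K)" using LIMSEQ_unique[OF l] by blast
  qed
  then have "closed_csubspace (range (app K))"
    unfolding closed_csubspace_def
    by (auto simp flip: app_add_right app_scaleC_right intro: range_eqI[of _ _ 0])
  from projection_onto_exists[OF this] obtain Q where
    Q: "proj Q" "\<And>x. Q \<rhd> x \<in> range (app K)" "\<And>y. Q \<rhd> K \<rhd> y = K \<rhd> y" by auto
  have "Q * K = K" by (rule bop_eqI) (simp add: app_times Q)
  from arg_cong[OF this, of star] have "K * Q = K" by (simp add: star_times sa proj_star Q)
  then have "K \<rhd> (Q \<rhd> x) = K \<rhd> x" for x by (metis app_times)
  then have "Q \<rhd> x = x" for x using inj by blast
  then have "\<exists>y. K \<rhd> y = x" for x using Q(2)[of x] by (metis rangeE)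
  then obtain f where f: "\<And>x. K \<rhd> f x = x" by metis
  have "bounded_clinear_op f"
    unfolding bounded_clinear_op_def
  proof (intro conjI allI exI[of _ "1 / d"])
    fix x y c
    show "f (x + y) = f x + f y" by (rule inj) (simp add: f app_simps)
    show "f (c *\<^sub>C x) = c *\<^sub>C f x" by (rule inj) (simp add: f app_simps)
    show "norm (f x) \<le> norm x * (1 / d)" using below[of "f x"] d by (simp add: f field_simps)
  qed
  then have L: "Bop f \<rhd> x = f x" for x by (simp add: Bop_inverse)
  have "K * Bop f = 1" by (rule bop_eqI) (simp add: app_times L f)
  moreover have "Bop f * K = 1" by (rule bop_eqI) (simp add: app_times L inj f)
  ultimately show ?thesis by blast
qed

text \<open>A substitute for the polar decomposition: on a spectral projection \<open>P\<close> of \<open>T\<^sup>\<star> * T\<close> that avoids a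
  neighbourhood of \<open>0\<close> the positive part of \<open>T\<close> is invertible, and \<open>T\<close> times its inverse is isometric
  there.\<close>

lemma partial_isometry_below:
  fixes T :: "'a::chilbert_space bop"
  assumes "T \<noteq> 0"
  shows "\<exists>V. pisom V \<and> V \<noteq> 0 \<and> (\<forall>A. proj A \<longrightarrow> A * T = T \<longrightarrow> A * V = V) \<and>
    (\<forall>A. proj A \<longrightarrow> T * A = T \<longrightarrow> V * A = V) \<and> (\<forall>C. star_commute T C \<longrightarrow> C * V = V * C)"
proof -
  define A where "A = T\<^sup>\<star> * T"
  have pA: "pos A" unfolding A_def by (rule pos_star_times)
  have saA: "A\<^sup>\<star> = A" by (rule pos_selfadjoint[OF pA])
  obtain x where x: "T \<rhd> x \<noteq> 0" using assms bop_eqI by (metis app_zero)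
  then have x0: "x \<noteq> 0" by auto
  \<comment> \<open>Half the value of the quadratic form of \<open>A\<close> at the unit vector
    along \<open>x\<close>: then \<open>S\<close> is still positive at \<open>x\<close>, so
    \<open>P\<close> cannot vanish.\<close>
  define e where "e = (norm (T \<rhd> x) / norm x)\<^sup>2 / 2"
  have e: "e > 0" using x x0 by (simp add: e_def)
  have Ax: "Re (cinner x (A \<rhd> x)) > e * (norm x)\<^sup>2"
  proof -
    have "Re (cinner x (A \<rhd> x)) = (norm (T \<rhd> x))\<^sup>2"
      by (simp add: A_def app_times norm_sq_cinner cinner_star)
    then show ?thesis using x x0 by (simp add: e_def power_divide)
  qed
  define S where "S = A - e *\<^sub>R 1"
  have "S\<^sup>\<star> = S" by (simp add: S_def star_simps saA)
  then obtain P where P: "proj P" "pos (P * S)" "pos (- ((1 - P) * S))"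
    "\<And>C. star_commute S C \<Longrightarrow> C * P = P * C" using spectral_projection_exists by blast
  have comP: "C * P = P * C" if "star_commute A C" for C
    using that by (intro P(4)) (auto simp: S_def star_commute_def algebra_simps)
  have AP: "A * P = P * A" by (rule comP) (simp add: star_commute_def saA)
  have P0: "P \<noteq> 0"
  proof
    assume "P = 0"
    then have "Re (cinner x (S \<rhd> x)) \<le> 0" using P(3) by (auto simp: pos_def app_simps cinner_simps)
    then show False using Ax by (simp add: S_def app_simps cinner_simps cinner_self)
  qed
  \<comment> \<open>\<open>A\<close> on \<open>P\<close>, filled up with \<open>e\<close> on the
    complement. This is at least \<open>e\<close> everywhere, so its root \<open>K\<close> has an
    inverse \<open>L\<close>, and \<open>T * L\<close> is isometric on \<open>P\<close>.\<close>
  define D where "D = P * A + e *\<^sub>R (1 - P)"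
  have D: "D = P * S + e *\<^sub>R 1" by (simp add: D_def S_def algebra_simps)
  have "pos D" unfolding D using P(2) e by (intro pos_add pos_scaleR pos_one) auto
  then obtain K where K: "pos K" "K * K = D" "\<And>C. C * D = D * C \<Longrightarrow> C * K = K * C"
    using sqrt_exists by blast
  have saK: "K\<^sup>\<star> = K" by (rule pos_selfadjoint[OF K(1)])
  have "sqrt e * norm y \<le> norm (K \<rhd> y)" for y
  proof -
    have "(norm (K \<rhd> y))\<^sup>2 = Re (cinner y (D \<rhd> y))"
      by (simp add: norm_sq_cinner cinner_star saK app_times flip: K(2))
    also have "\<dots> \<ge> e * (norm y)\<^sup>2"
      using P(2) by (simp add: D pos_def app_simps cinner_simps cinner_self)
    finally have "(sqrt e * norm y)\<^sup>2 \<le> (norm (K \<rhd> y))\<^sup>2" using e by (simp add: power_mult_distrib)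
    then show ?thesis by (rule power2_le_imp_le) simp
  qed
  then obtain L where L: "L * K = 1" "K * L = 1"
    using bounded_below_selfadjoint_invertible[OF saK, of "sqrt e"] e by auto
  have saL: "L\<^sup>\<star> = L"
  proof -
    have 1: "K * L\<^sup>\<star> = 1" using arg_cong[OF L(1), of star] by (simp add: star_times saK)
    have "L\<^sup>\<star> = L * (K * L\<^sup>\<star>)" by (simp add: L flip: mult.assoc)
    then show ?thesis using 1 by simp
  qed
  have comL: "C * L = L * C" if "C * K = K * C" for C
  proof -
    have "L * (C * K) * L = L * (K * C) * L" using that by simp
    then have "L * C * (K * L) = (L * K) * C * L" by (simp add: mult.assoc)
    then show ?thesis using L by simp
  qed
  have com: "C * (L * P) = (L * P) * C" if "star_commute A C" for C
  proof -
    have 1: "C * P = P * C" by (rule comP[OF that])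
    have 2: "C * A = A * C" using that by (simp add: star_commute_def)
    have "C * (P * A) = (P * A) * C" using 1 2 by (metis mult.assoc)
    then have "C * D = D * C" using 1 by (simp add: D_def algebra_simps)
    then have 3: "C * L = L * C" by (intro comL K(3))
    show ?thesis using 1 3 by (metis mult.assoc)
  qed
  have LP: "L * P = P * L"
  proof (intro comL[symmetric] K(3))
    have "P * D = P * A" "D * P = P * A"
      using P(1) AP proj_idem[OF P(1)] by (simp_all add: D_def algebra_simps times_assoc_rule)
    then show "P * D = D * P" by simp
  qed
  define V where "V = T * (L * P)"
  have "V\<^sup>\<star> * V = P"
  proof -
    have AP': "A * P = D * P" using AP proj_idem[OF P(1)] by (simp add: D_def algebra_simps times_assoc_rule)
    have "V\<^sup>\<star> * V = P * L * (A * P) * L"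
      by (simp add: V_def star_times saL proj_star[OF P(1)] A_def mult.assoc LP)
    also have "\<dots> = P * (L * K) * K * (P * L)" by (simp add: AP' mult.assoc flip: K(2))
    also have "\<dots> = P * (K * L) * P" by (simp add: L mult.assoc times_assoc_rule[OF L(2)] flip: LP)
    finally show ?thesis by (simp add: L proj_idem[OF P(1)])
  qed
  then have "pisom V" "V \<noteq> 0" using pisom_if_initial P(1) P0 by auto
  moreover have "B * V = V" if "B * T = T" for B
    using that by (simp add: V_def flip: mult.assoc)
  moreover have "V * B = V" if B: "proj B" "T * B = T" for B
  proof -
    have BT: "B * T\<^sup>\<star> = T\<^sup>\<star>" using arg_cong[OF B(2), of star] by (simp add: star_times proj_star[OF B(1)])
    have "B * A = A" "A * B = A" using BT B(2) by (simp_all add: A_def mult.assoc times_assoc_rule)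
    then have "star_commute A B" using proj_star[OF B(1)] by (simp add: star_commute_def)
    have "V * B = T * (L * P * B)" by (simp add: V_def mult.assoc)
    also have "\<dots> = (T * B) * (L * P)" unfolding com[OF \<open>star_commute A B\<close>, symmetric] by (simp add: mult.assoc)
    finally show ?thesis by (simp add: B(2) V_def)
  qed
  moreover have "C * V = V * C" if "star_commute T C" for C
  proof -
    have C: "C * T = T * C" "C\<^sup>\<star> * T = T * C\<^sup>\<star>" using that by (auto simp: star_commute_def)
    have C': "T\<^sup>\<star> * C\<^sup>\<star> = C\<^sup>\<star> * T\<^sup>\<star>" "T\<^sup>\<star> * C = C * T\<^sup>\<star>"
      using arg_cong[OF C(1), of star] arg_cong[OF C(2), of star] by (simp_all add: star_times)
    have "star_commute A C" unfolding star_commute_def A_def using C C' by (metis mult.assoc)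
    have "C * V = T * (C * (L * P))" by (simp add: V_def C(1) flip: mult.assoc)
    also have "\<dots> = V * C" unfolding com[OF \<open>star_commute A C\<close>] by (simp add: V_def mult.assoc)
    finally show ?thesis .
  qed
  ultimately show ?thesis by blast
qed

text \<open>Zorn's lemma, to be used with orthogonality as \<open>r\<close>. Only pairs of distinct
  members are compared, since a nonzero operator is never orthogonal to itself.\<close>

lemma maximal_clique_exists:
  assumes sym: "\<And>x y. r x y \<Longrightarrow> r y x"
  shows "\<exists>C\<subseteq>S. (\<forall>x\<in>C. \<forall>y\<in>C. x \<noteq> y \<longrightarrow> r x y) \<and> (\<forall>x\<in>S. (\<forall>y\<in>C. y \<noteq> x \<longrightarrow> r x y) \<longrightarrow> x \<in> C)"
proof -
  define \<A> where "\<A> = {C. C \<subseteq> S \<and> (\<forall>x\<in>C. \<forall>y\<in>C. x \<noteq> y \<longrightarrow> r x y)}"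
  have "\<Union>\<C> \<in> \<A>" if "subset.chain \<A> \<C>" for \<C>
  proof -
    have "r x y" if "x \<in> X" "X \<in> \<C>" "y \<in> Y" "Y \<in> \<C>" "x \<noteq> y" for x y X Y
    proof -
      have "X \<subseteq> Y \<or> Y \<subseteq> X" using \<open>subset.chain \<A> \<C>\<close> that unfolding subset_chain_def by blast
      then have "(x \<in> Y \<and> y \<in> Y) \<or> (x \<in> X \<and> y \<in> X)" using that by blast
      moreover have "X \<in> \<A>" "Y \<in> \<A>" using \<open>subset.chain \<A> \<C>\<close> that unfolding subset_chain_def by blast+
      ultimately show ?thesis using that(5) unfolding \<A>_def by blast
    qed
    moreover have "\<Union>\<C> \<subseteq> S" using that unfolding \<A>_def subset_chain_def by blast
    ultimately show ?thesis unfolding \<A>_def by blast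
  qed
  then obtain C where C: "C \<in> \<A>" "\<And>D. D \<in> \<A> \<Longrightarrow> C \<subseteq> D \<Longrightarrow> D = C"
    using subset_Zorn'[of \<A>] by blast
  have "x \<in> C" if "x \<in> S" "\<forall>y\<in>C. y \<noteq> x \<longrightarrow> r x y" for x
  proof -
    have "insert x C \<in> \<A>" using C(1) that sym by (auto simp: \<A>_def)
    then show ?thesis using C(2) by blast
  qed
  then show ?thesis using C(1) by (auto simp: \<A>_def)
qed

section \<open>Order and equivalence of projections in a von Neumann algebra\<close>

definition comm :: "'a::chilbert_space bop set \<Rightarrow> 'a bop \<Rightarrow> bool" where
  "comm M C \<longleftrightarrow> (\<forall>A\<in>M. C * A = A * C)"

text \<open>Both products are recorded so that the relation rewrites on either side; for projections
  each one gives the other by adjoints, as in \<open>pleI\<close>.\<close>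

definition ple :: "'a::chilbert_space bop \<Rightarrow> 'a bop \<Rightarrow> bool" (infix \<open>\<unlhd>\<close> 50) where
  "p \<unlhd> q \<longleftrightarrow> q * p = p \<and> p * q = p"

lemma ple_refl: "proj p \<Longrightarrow> p \<unlhd> p" by (simp add: ple_def proj_idem)

lemma ple_trans: "p \<unlhd> q \<Longrightarrow> q \<unlhd> r \<Longrightarrow> p \<unlhd> r"
  unfolding ple_def by (metis mult.assoc)

lemma pleI: "proj p \<Longrightarrow> proj q \<Longrightarrow> q * p = p \<Longrightarrow> p \<unlhd> q"
  unfolding ple_def by (metis proj_star star_times)

lemma proj_diff: "proj p \<Longrightarrow> proj q \<Longrightarrow> p \<unlhd> q \<Longrightarrow> proj (q - p)"
  by (simp add: proj_def ple_def star_simps algebra_simps)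

lemma ple_diff: "proj p \<Longrightarrow> proj q \<Longrightarrow> p \<unlhd> q \<Longrightarrow> q - p \<unlhd> q"
  by (simp add: proj_def ple_def algebra_simps)

lemma ple_add_left: "proj p \<Longrightarrow> proj q \<Longrightarrow> p * q = 0 \<Longrightarrow> q * p = 0 \<Longrightarrow> p \<unlhd> p + q"
  by (simp add: ple_def proj_def algebra_simps)

lemma proj_add: "proj p \<Longrightarrow> proj q \<Longrightarrow> p * q = 0 \<Longrightarrow> q * p = 0 \<Longrightarrow> proj (p + q)"
  by (simp add: proj_def algebra_simps star_simps)

lemma proj_orth_sym: "proj p \<Longrightarrow> proj q \<Longrightarrow> p * q = 0 \<Longrightarrow> q * p = 0"
  by (metis proj_star star_times star_zero)

lemma ple_orth: "p \<unlhd> p' \<Longrightarrow> q \<unlhd> q' \<Longrightarrow> p' * q' = 0 \<Longrightarrow> p * q = 0"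
  unfolding ple_def by (metis mult.assoc mult_zero_left mult_zero_right)

lemma ple_diff_iff:
  "proj p \<Longrightarrow> proj q \<Longrightarrow> proj r \<Longrightarrow> q \<unlhd> r \<Longrightarrow> p \<unlhd> r - q \<longleftrightarrow> p \<unlhd> r \<and> q * p = 0"
proof
  assume "proj p" "proj q" "proj r" "q \<unlhd> r" "p \<unlhd> r - q"
  then have a: "q * r = q" "q * q = q" "p \<unlhd> r" using ple_trans[OF _ ple_diff] by (auto simp: ple_def proj_def)
  have "q * p = q * ((r - q) * p)" using \<open>p \<unlhd> r - q\<close> by (simp add: ple_def)
  also have "\<dots> = 0" using a by (simp add: algebra_simps flip: mult.assoc)
  finally show "p \<unlhd> r \<and> q * p = 0" using a by simp
next
  assume "proj p" "proj q" "proj r" "q \<unlhd> r" "p \<unlhd> r \<and> q * p = 0"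
  then show "p \<unlhd> r - q" using proj_orth_sym[of q p] by (simp add: ple_def algebra_simps)
qed

text \<open>Sums, products, scalar multiples and infinite orthogonal sums of elements of
  \<open>M\<close> are all obtained from \<open>bicommutant\<close>.\<close>

locale von_neumann =
  fixes M :: "'a::chilbert_space bop set"
  assumes star_closed: "A \<in> M \<Longrightarrow> A\<^sup>\<star> \<in> M"
    and bicommutant: "(\<And>C. comm M C \<Longrightarrow> C * S = S * C) \<Longrightarrow> S \<in> M"
begin

lemma commD: "comm M C \<Longrightarrow> A \<in> M \<Longrightarrow> C * A = A * C"
  by (simp add: comm_def)

lemma comm_star: "comm M C \<Longrightarrow> comm M (C\<^sup>\<star>)"
  unfolding comm_def by (metis star_closed star_star star_times)

lemma star_commute_if_comm: "comm M C \<Longrightarrow> A \<in> M \<Longrightarrow> star_commute A C"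
  by (simp add: star_commute_def commD comm_star)

text \<open>The passage from the commutation clauses of spectral projections and partial isometries
  to membership in \<open>M\<close>.\<close>

lemma in_M_if_star_commute: "A \<in> M \<Longrightarrow> (\<And>C. star_commute A C \<Longrightarrow> C * B = B * C) \<Longrightarrow> B \<in> M"
  by (rule bicommutant) (simp add: star_commute_if_comm)

lemma M_zero: "0 \<in> M" and M_one: "1 \<in> M"
  by (rule bicommutant, simp)+

lemma M_plus: "A \<in> M \<Longrightarrow> B \<in> M \<Longrightarrow> A + B \<in> M"
  by (rule bicommutant) (metis commD distrib_left distrib_right)

lemma M_diff: "A \<in> M \<Longrightarrow> B \<in> M \<Longrightarrow> A - B \<in> M"
  by (rule bicommutant) (metis commD left_diff_distrib right_diff_distrib)

lemma M_scaleR: "A \<in> M \<Longrightarrow> r *\<^sub>R A \<in> M"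
  by (rule bicommutant) (metis commD mult_scaleR_left mult_scaleR_right)

lemma M_times: "A \<in> M \<Longrightarrow> B \<in> M \<Longrightarrow> A * B \<in> M"
  by (rule bicommutant) (metis commD mult.assoc)

lemma M_scaleC: "A \<in> M \<Longrightarrow> c *\<^sub>C A \<in> M"
  by (rule bicommutant) (metis commD scaleC_times_left scaleC_times_right)

lemma M_osum: "ortho_family I T \<Longrightarrow> (\<And>i. i \<in> I \<Longrightarrow> T i \<in> M) \<Longrightarrow> osum I T \<in> M"
  by (intro bicommutant osum_commute) (auto intro: commD)

lemmas M_intros = M_zero M_one M_plus M_diff M_scaleR M_times M_scaleC star_closed

definition pr :: "'a bop \<Rightarrow> bool" where "pr p \<longleftrightarrow> p \<in> M \<and> proj p"

definition eqv :: "'a bop \<Rightarrow> 'a bop \<Rightarrow> bool" (infix \<open>\<sim>\<close> 50) where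
  "p \<sim> q \<longleftrightarrow> (\<exists>V\<in>M. pisom V \<and> V\<^sup>\<star> * V = p \<and> V * V\<^sup>\<star> = q)"

definition sub :: "'a bop \<Rightarrow> 'a bop \<Rightarrow> bool" (infix \<open>\<preceq>\<close> 50) where
  "p \<preceq> q \<longleftrightarrow> (\<exists>r. p \<sim> r \<and> r \<unlhd> q)"

definition central :: "'a bop \<Rightarrow> bool" where
  "central z \<longleftrightarrow> pr z \<and> comm M z"

lemma prD: "pr p \<Longrightarrow> p \<in> M" "pr p \<Longrightarrow> proj p" by (simp_all add: pr_def)

lemma eqv_pr: "p \<sim> q \<Longrightarrow> pr p" "p \<sim> q \<Longrightarrow> pr q"
  by (auto simp: eqv_def pr_def proj_initial proj_final M_intros)

lemma sub_pr: "p \<preceq> q \<Longrightarrow> pr p"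
  using eqv_pr by (auto simp: sub_def)

lemma eqv_refl: "pr p \<Longrightarrow> p \<sim> p"
  unfolding eqv_def by (rule bexI[of _ p]) (auto simp: pr_def proj_def pisom_def)

lemma eqv_sym: "p \<sim> q \<Longrightarrow> q \<sim> p"
  unfolding eqv_def by (metis pisom_star star_closed star_star)

lemma pr_zero: "pr 0" and pr_one: "pr 1" by (simp_all add: pr_def M_intros)

lemma pr_diff: "pr p \<Longrightarrow> pr q \<Longrightarrow> p \<unlhd> q \<Longrightarrow> pr (q - p)"
  by (simp add: pr_def proj_diff M_intros)

lemma pr_add: "pr p \<Longrightarrow> pr q \<Longrightarrow> p * q = 0 \<Longrightarrow> pr (p + q)"
  by (simp add: pr_def proj_add proj_orth_sym M_intros)

lemma pr_compl: "pr p \<Longrightarrow> pr (1 - p)"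
  by (simp add: pr_def proj_compl M_intros)

lemma pr_mult: "pr p \<Longrightarrow> pr q \<Longrightarrow> p * q = q * p \<Longrightarrow> pr (p * q)"
  unfolding pr_def proj_def by (auto simp: M_intros star_times) (metis mult.assoc)

text \<open>If \<open>V\<close> implements \<open>p \<sim> q\<close>, then \<open>V * p'\<close> and
  \<open>V - V * p'\<close> implement the two equivalences.\<close>

lemma eqv_restrict:
  assumes "p \<sim> q" "pr p'" "p' \<unlhd> p"
  shows "\<exists>q'. p' \<sim> q' \<and> q' \<unlhd> q \<and> p - p' \<sim> q - q'"
proof -
  obtain V where V: "V \<in> M" "pisom V" "V\<^sup>\<star> * V = p" "V * V\<^sup>\<star> = q" using assms(1) by (auto simp: eqv_def)
  note ps = pisom_simps[OF V(2)]
  have p: "proj p'" "p' \<in> M" "p * p' = p'" "p' * p = p'" using assms by (auto simp: pr_def ple_def)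
  note pp = proj_idem[OF p(1)] proj_star[OF p(1)] times_assoc_rule[OF proj_idem[OF p(1)]]
    p(3,4) times_assoc_rule[OF p(3)] times_assoc_rule[OF p(4)]
    times_assoc_rule[OF V(3)] V(3)
  have i: "(V * p')\<^sup>\<star> * (V * p') = p'"
    using pp by (simp add: star_times mult.assoc)
  then have "p' \<sim> (V * p') * (V * p')\<^sup>\<star>"
    unfolding eqv_def using V p by (intro bexI[of _ "V * p'"]) (auto simp: M_intros pisom_if_initial)
  moreover have q: "(V * p') * (V * p')\<^sup>\<star> = V * (p' * V\<^sup>\<star>)"
    using pp by (simp add: star_times mult.assoc)
  moreover have "V * (p' * V\<^sup>\<star>) \<unlhd> q"
    unfolding ple_def V(4)[symmetric] using ps pp by (simp add: mult.assoc)
  moreover have "p - p' \<sim> q - V * (p' * V\<^sup>\<star>)"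
  proof -
    have "proj (p - p')" using assms(2,3) eqv_pr[OF assms(1)] by (intro proj_diff) (auto simp: pr_def)
    moreover have "(V - V * p')\<^sup>\<star> * (V - V * p') = p - p'"
      using pp by (simp add: star_simps mult.assoc algebra_simps)
    moreover have "(V - V * p') * (V - V * p')\<^sup>\<star> = q - V * (p' * V\<^sup>\<star>)"
      using pp V(4) by (simp add: star_simps mult.assoc algebra_simps)
    ultimately show ?thesis
      unfolding eqv_def using V p by (intro bexI[of _ "V - V * p'"]) (auto simp: M_intros pisom_if_initial)
  qed
  ultimately show ?thesis by metis
qed

lemma eqv_trans:
  assumes "p \<sim> q" "q \<sim> r"
  shows "p \<sim> r"
proof -
  obtain V W where V: "V \<in> M" "pisom V" "V\<^sup>\<star> * V = p" "V * V\<^sup>\<star> = q"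
    and W: "W \<in> M" "pisom W" "W\<^sup>\<star> * W = q" "W * W\<^sup>\<star> = r" using assms by (auto simp: eqv_def)
  have qV: "q * V = V" "V\<^sup>\<star> * q = V\<^sup>\<star>" using pisom_simps[OF V(2)] by (simp_all add: V(4)[symmetric] mult.assoc)
  have qW: "W * q = W" using pisom_simps[OF W(2)] by (simp add: W(3)[symmetric])
  have i: "(W * V)\<^sup>\<star> * (W * V) = p"
    by (simp add: star_times mult.assoc times_assoc_rule[OF W(3)] qV V(3))
  have "(W * V) * (W * V)\<^sup>\<star> = r"
    by (simp add: star_times mult.assoc times_assoc_rule[OF V(4)] times_assoc_rule[OF qW] W(4))
  with i show ?thesis unfolding eqv_def using V W eqv_pr[OF assms(1)]
    by (intro bexI[of _ "W * V"]) (auto simp: M_intros pisom_if_initial pr_def)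
qed

lemma eqv_add:
  assumes "p \<sim> q" "p' \<sim> q'" "p * p' = 0" "q * q' = 0"
  shows "p + p' \<sim> q + q'"
proof -
  obtain V W where V: "V \<in> M" "pisom V" "V\<^sup>\<star> * V = p" "V * V\<^sup>\<star> = q"
    and W: "W \<in> M" "pisom W" "W\<^sup>\<star> * W = p'" "W * W\<^sup>\<star> = q'" using assms by (auto simp: eqv_def)
  have "V * W\<^sup>\<star> = (V * p) * (p' * W\<^sup>\<star>)"
    using pisom_simps[OF V(2)] pisom_simps[OF W(2)] by (simp add: V(3)[symmetric] W(3)[symmetric] mult.assoc)
  also have "\<dots> = 0" using assms(3) by (simp add: mult.assoc times_assoc_rule)
  finally have 1: "V * W\<^sup>\<star> = 0" .
  then have 2: "W * V\<^sup>\<star> = 0" by (metis star_star star_times star_zero)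
  have "V\<^sup>\<star> * W = (V\<^sup>\<star> * q) * (q' * W)"
    using pisom_simps[OF V(2)] pisom_simps[OF W(2)] by (simp add: V(4)[symmetric] W(4)[symmetric] mult.assoc)
  also have "\<dots> = 0" using assms(4) by (simp add: mult.assoc times_assoc_rule)
  finally have 3: "V\<^sup>\<star> * W = 0" .
  then have 4: "W\<^sup>\<star> * V = 0" by (metis star_star star_times star_zero)
  have i: "(V + W)\<^sup>\<star> * (V + W) = p + p'" using V W 3 4 by (simp add: star_simps algebra_simps)
  have "(V + W) * (V + W)\<^sup>\<star> = q + q'" using V W 1 2 by (simp add: star_simps algebra_simps)
  moreover have "pr (p + p')" using assms eqv_pr by (intro pr_add) auto
  ultimately show ?thesis unfolding eqv_def using V W i
    by (intro bexI[of _ "V + W"]) (auto simp: M_intros pisom_if_initial pr_def)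
qed

lemma eqv_zero: "0 \<sim> p \<Longrightarrow> p = 0"
  unfolding eqv_def by (metis mult_zero_left star_times_self_eq_zero)

lemma eqv_zero': "p \<sim> 0 \<Longrightarrow> p = 0" using eqv_sym eqv_zero by blast

lemma eqv_central:
  assumes "p \<sim> q" "central z"
  shows "z * p \<sim> z * q"
proof -
  obtain V where V: "V \<in> M" "pisom V" "V\<^sup>\<star> * V = p" "V * V\<^sup>\<star> = q" using assms(1) by (auto simp: eqv_def)
  have z: "z \<in> M" "z * z = z" "z\<^sup>\<star> = z" using assms(2) by (auto simp: central_def pr_def proj_def)
  have zc: "A \<in> M \<Longrightarrow> A * z = z * A" for A using assms(2) by (simp add: central_def commD)
  have zV: "V\<^sup>\<star> * z = z * V\<^sup>\<star>" "V * z = z * V" using zc V star_closed by auto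
  have i: "(z * V)\<^sup>\<star> * (z * V) = z * p"
    using z zV V(3) by (simp add: star_times mult.assoc times_assoc_rule[OF z(2)] times_assoc_rule[OF zV(1)])
  have f: "(z * V) * (z * V)\<^sup>\<star> = z * q"
  proof -
    have "(z * V) * (z * V)\<^sup>\<star> = z * (V * (V\<^sup>\<star> * z))" using z by (simp add: star_times mult.assoc)
    also have "\<dots> = z * (V * z * V\<^sup>\<star>)" by (simp only: zV(1) mult.assoc)
    also have "\<dots> = z * q" unfolding zV(2) by (simp add: mult.assoc times_assoc_rule[OF z(2)] V(4))
    finally show ?thesis .
  qed
  have "pr (z * p)" using assms eqv_pr[OF assms(1)] zc by (intro pr_mult) (auto simp: central_def pr_def)
  then show ?thesis unfolding eqv_def using V z i f
    by (intro bexI[of _ "z * V"]) (auto simp: M_intros pisom_if_initial pr_def)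
qed

lemma sub_trans_eqv: "p \<sim> q \<Longrightarrow> q \<preceq> r \<Longrightarrow> p \<preceq> r"
  unfolding sub_def using eqv_trans by blast

lemma sub_trans_ple: "p \<preceq> q \<Longrightarrow> q \<unlhd> r \<Longrightarrow> p \<preceq> r"
  unfolding sub_def using ple_trans by blast

lemma sub_eqv_trans: "p \<preceq> q \<Longrightarrow> q \<sim> r \<Longrightarrow> p \<preceq> r"
  unfolding sub_def using eqv_restrict eqv_trans eqv_pr by meson

lemma ple_sub: "pr p \<Longrightarrow> p \<unlhd> q \<Longrightarrow> p \<preceq> q"
  unfolding sub_def using eqv_refl by blast

lemma sub_trans: "p \<preceq> q \<Longrightarrow> q \<preceq> r \<Longrightarrow> p \<preceq> r"
  by (metis sub_def sub_eqv_trans sub_trans_ple)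

text \<open>The partial isometry extracted from \<open>q * T * p\<close> inherits its left and right
  supports. This is the source of new equivalences in the exhaustion arguments.\<close>

lemma nonzero_equivalent_subprojections:
  assumes "T \<in> M" "q * T * p \<noteq> 0" "pr p" "pr q"
  shows "\<exists>V\<in>M. pisom V \<and> V \<noteq> 0 \<and> V\<^sup>\<star> * V \<unlhd> p \<and> V * V\<^sup>\<star> \<unlhd> q"
proof -
  have pq: "proj p" "proj q" "p \<in> M" "q \<in> M" using assms by (auto simp: pr_def)
  obtain V where V: "pisom V" "V \<noteq> 0"
    "\<And>A. proj A \<Longrightarrow> A * (q * T * p) = q * T * p \<Longrightarrow> A * V = V"
    "\<And>A. proj A \<Longrightarrow> (q * T * p) * A = q * T * p \<Longrightarrow> V * A = V"
    "\<And>C. star_commute (q * T * p) C \<Longrightarrow> C * V = V * C"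
    using partial_isometry_below[OF assms(2)] by blast
  have "V \<in> M"
    by (rule in_M_if_star_commute[of "q * T * p"]) (simp_all add: M_times pq assms(1) V(5))
  moreover have "V * p = V" using pq by (intro V(4)) (simp_all add: mult.assoc proj_idem)
  then have "V\<^sup>\<star> * V \<unlhd> p"
    using pq by (intro pleI proj_initial V(1)) (metis mult.assoc proj_star star_times)+
  moreover have "q * V = V" using pq by (intro V(3)) (simp_all add: proj_idem flip: mult.assoc)
  then have "V * V\<^sup>\<star> \<unlhd> q"
    using pq by (intro pleI proj_final V(1)) (simp_all flip: mult.assoc)
  ultimately show ?thesis using V by blast
qed

end

subsection \<open>Comparison of projections in a finite von Neumann algebra\<close>

lemma ortho_family_pisomI:
  assumes "\<And>i. i \<in> I \<Longrightarrow> pisom (V i)"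
    and "\<And>i j. i \<in> I \<Longrightarrow> j \<in> I \<Longrightarrow> i \<noteq> j \<Longrightarrow> ((V i)\<^sup>\<star> * V i) * ((V j)\<^sup>\<star> * V j) = 0"
    and "\<And>i j. i \<in> I \<Longrightarrow> j \<in> I \<Longrightarrow> i \<noteq> j \<Longrightarrow> (V i * (V i)\<^sup>\<star>) * (V j * (V j)\<^sup>\<star>) = 0"
  shows "ortho_family I V"
  unfolding ortho_family_def
proof (intro conjI ballI impI)
  fix i j assume ij: "i \<in> I" "j \<in> I" "i \<noteq> j"
  note ps = pisom_simps[OF assms(1)[OF ij(1)]] pisom_simps[OF assms(1)[OF ij(2)]]
  have "V i * (V j)\<^sup>\<star> = V i * ((V i)\<^sup>\<star> * V i * ((V j)\<^sup>\<star> * V j)) * (V j)\<^sup>\<star>"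
    by (simp add: mult.assoc ps)
  then show "V i * (V j)\<^sup>\<star> = 0" using assms(2)[OF ij] by simp
  have "(V i)\<^sup>\<star> * V j = (V i)\<^sup>\<star> * (V i * (V i)\<^sup>\<star> * (V j * (V j)\<^sup>\<star>)) * V j"
    by (simp add: mult.assoc ps)
  then show "(V i)\<^sup>\<star> * V j = 0" using assms(3)[OF ij] by simp
qed (rule assms(1))

lemma osum_projs:
  assumes "\<And>i. i \<in> I \<Longrightarrow> proj (P i)" "\<And>i j. i \<in> I \<Longrightarrow> j \<in> I \<Longrightarrow> i \<noteq> j \<Longrightarrow> P i * P j = 0"
  shows "proj (osum I P)" "i \<in> I \<Longrightarrow> P i \<unlhd> osum I P"
    "proj q \<Longrightarrow> (\<And>i. i \<in> I \<Longrightarrow> P i \<unlhd> q) \<Longrightarrow> osum I P \<unlhd> q"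
proof -
  note fam = ortho_family_projI[OF assms]
  show p: "proj (osum I P)" by (rule osum_proj[OF fam assms(1)])
  show "P i \<unlhd> osum I P" if "i \<in> I"
    using osum_times_single[OF fam that, where B = "P i"] that assms p
    by (intro pleI) (auto simp: proj_idem)
  show "osum I P \<unlhd> q" if q: "proj q" "\<And>i. i \<in> I \<Longrightarrow> P i \<unlhd> q"
  proof -
    have "(1 - q) * osum I P = 0"
      by (rule times_osum_zero[OF fam]) (use q(2) in \<open>auto simp: ple_def algebra_simps\<close>)
    then show ?thesis using p q(1) by (intro pleI) (auto simp: algebra_simps)
  qed
qed

lemma osum_add:
  assumes "ortho_family I S" "ortho_family I T" "ortho_family I (\<lambda>i. S i + T i)"
  shows "osum I (\<lambda>i. S i + T i) = osum I S + osum I T"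
  by (rule osum_eqI[OF assms(3)])
     (use has_sum_add[OF osum_has_sum[OF assms(1)] osum_has_sum[OF assms(2)]] in \<open>simp add: app_simps\<close>)

context von_neumann
begin

lemma eqv_osum:
  assumes "\<And>i. i \<in> I \<Longrightarrow> p i \<sim> q i"
    and "\<And>i j. i \<in> I \<Longrightarrow> j \<in> I \<Longrightarrow> i \<noteq> j \<Longrightarrow> p i * p j = 0"
    and "\<And>i j. i \<in> I \<Longrightarrow> j \<in> I \<Longrightarrow> i \<noteq> j \<Longrightarrow> q i * q j = 0"
  shows "osum I p \<sim> osum I q"
proof -
  have "\<forall>i\<in>I. \<exists>V. V \<in> M \<and> pisom V \<and> V\<^sup>\<star> * V = p i \<and> V * V\<^sup>\<star> = q i"
    using assms(1) unfolding eqv_def by blast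
  then obtain V where V: "\<And>i. i \<in> I \<Longrightarrow> V i \<in> M" "\<And>i. i \<in> I \<Longrightarrow> pisom (V i)"
    "\<And>i. i \<in> I \<Longrightarrow> (V i)\<^sup>\<star> * V i = p i" "\<And>i. i \<in> I \<Longrightarrow> V i * (V i)\<^sup>\<star> = q i" by metis
  have fam: "ortho_family I V"
    by (rule ortho_family_pisomI) (use V assms in auto)
  have "osum I (\<lambda>i. (V i)\<^sup>\<star> * V i) = osum I p" "osum I (\<lambda>i. V i * (V i)\<^sup>\<star>) = osum I q"
    using V by (auto simp: osum_def intro!: arg_cong[of _ _ Bop] ext infsum_cong)
  then show ?thesis
    unfolding eqv_def using osum_initial[OF fam] osum_final[OF fam] osum_pisom[OF fam] M_osum[OF fam V(1)]
    by (intro bexI[of _ "osum I V"]) auto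
qed

text \<open>The common form of the exhaustion arguments: \<open>S\<close> describes the admissible
  pieces, and a nonzero admissible piece orthogonal to the sum would contradict maximality.\<close>

lemma maximal_orthogonal_family:
  assumes S: "\<And>V. V \<in> S \<Longrightarrow> V \<in> M \<and> pisom V"
  shows "\<exists>C\<subseteq>S. ortho_family C (\<lambda>V. V) \<and>
    (\<forall>V\<in>S. (V\<^sup>\<star> * V) * ((osum C (\<lambda>V. V))\<^sup>\<star> * osum C (\<lambda>V. V)) = 0 \<longrightarrow>
       (V * V\<^sup>\<star>) * (osum C (\<lambda>V. V) * (osum C (\<lambda>V. V))\<^sup>\<star>) = 0 \<longrightarrow> V = 0)"
proof -
  define r where "r V W \<longleftrightarrow> V * W\<^sup>\<star> = 0 \<and> V\<^sup>\<star> * W = 0" for V W :: "'a bop"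
  have "r V W \<Longrightarrow> r W V" for V W unfolding r_def by (metis star_star star_times star_zero)
  then obtain C where C: "C \<subseteq> S" "\<And>V W. V \<in> C \<Longrightarrow> W \<in> C \<Longrightarrow> V \<noteq> W \<Longrightarrow> r V W"
    "\<And>V. V \<in> S \<Longrightarrow> \<forall>W\<in>C. W \<noteq> V \<longrightarrow> r V W \<Longrightarrow> V \<in> C"
    using maximal_clique_exists[of r S] by metis
  have fam: "ortho_family C (\<lambda>V. V)"
    using C(1,2) S unfolding ortho_family_def r_def by blast
  define T where "T = osum C (\<lambda>V. V)"
  have TW: "T * (W\<^sup>\<star> * W) = W" if "W \<in> C" for W
  proof -
    have "T * (W\<^sup>\<star> * W) = W * (W\<^sup>\<star> * W)" unfolding T_def
      by (rule osum_times_single[OF fam that]) (use C(2) that r_def in \<open>simp flip: mult.assoc\<close>)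
    then show ?thesis using S C(1) that pisom_simps(1) by fastforce
  qed
  have WT: "(W * W\<^sup>\<star>) * T = W" if "W \<in> C" for W
  proof -
    have "(W * W\<^sup>\<star>) * T = (W * W\<^sup>\<star>) * W" unfolding T_def
      by (rule times_osum_single[OF fam that]) (use C(2) that r_def in \<open>auto simp: mult.assoc\<close>)
    then show ?thesis using S C(1) that pisom_simps(1) by (fastforce simp: mult.assoc)
  qed
  have "V = 0" if V: "V \<in> S" "(V\<^sup>\<star> * V) * (T\<^sup>\<star> * T) = 0" "(V * V\<^sup>\<star>) * (T * T\<^sup>\<star>) = 0" for V
  proof -
    have pV: "pisom V" and pT: "pisom T" using S V(1) osum_pisom[OF fam] by (auto simp: T_def)
    note ps = pisom_simps[OF pV] pisom_simps[OF pT]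
    have "V * T\<^sup>\<star> = V * ((V\<^sup>\<star> * V) * (T\<^sup>\<star> * T)) * T\<^sup>\<star>" by (simp add: ps mult.assoc)
    then have VT: "V * T\<^sup>\<star> = 0" using V(2) by simp
    have "V\<^sup>\<star> * T = V\<^sup>\<star> * ((V * V\<^sup>\<star>) * (T * T\<^sup>\<star>)) * T" by (simp add: ps mult.assoc)
    then have VT': "V\<^sup>\<star> * T = 0" using V(3) by simp
    have "r V W" if "W \<in> C" for W
    proof -
      have pW: "pisom W" using that C(1) S by blast
      have "W\<^sup>\<star> = T\<^sup>\<star> * (W * W\<^sup>\<star>)" using arg_cong[OF WT[OF that], of star] by (simp add: star_times)
      then have "V * W\<^sup>\<star> = (V * T\<^sup>\<star>) * (W * W\<^sup>\<star>)" by (metis mult.assoc)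
      moreover have "V\<^sup>\<star> * W = (V\<^sup>\<star> * T) * (W\<^sup>\<star> * W)" using TW[OF that] by (metis mult.assoc)
      ultimately show ?thesis using VT VT' by (simp add: r_def)
    qed
    \<comment> \<open>As a member of \<open>C\<close>, \<open>V\<close> is a piece of
      \<open>T\<close>; being orthogonal to \<open>T\<close> as well, it is orthogonal to
      itself.\<close>
    then have "V \<in> C" using C(3) V(1) by blast
    then have "V\<^sup>\<star> * V = 0" using TW VT' by (metis mult.assoc mult_zero_left)
    then show ?thesis by (simp add: star_times_self_eq_zero)
  qed
  then show ?thesis using C(1) fam unfolding T_def by blast
qed

text \<open>Take a maximal orthogonal family of partial isometries from \<open>p\<close> to
  \<open>q\<close>. If the leftover corner were nonzero, it would contain another one.\<close>

lemma maximal_equivalent_subprojections: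
  assumes p: "pr p" and q: "pr q"
  shows "\<exists>p' q'. p' \<sim> q' \<and> p' \<unlhd> p \<and> q' \<unlhd> q \<and> (\<forall>T\<in>M. (q - q') * T * (p - p') = 0)"
proof -
  define S where "S = {V \<in> M. pisom V \<and> V\<^sup>\<star> * V \<unlhd> p \<and> V * V\<^sup>\<star> \<unlhd> q}"
  obtain C where C: "C \<subseteq> S" "ortho_family C (\<lambda>V. V)" and
    max: "\<And>V. V \<in> S \<Longrightarrow> (V\<^sup>\<star> * V) * ((osum C (\<lambda>V. V))\<^sup>\<star> * osum C (\<lambda>V. V)) = 0 \<Longrightarrow>
       (V * V\<^sup>\<star>) * (osum C (\<lambda>V. V) * (osum C (\<lambda>V. V))\<^sup>\<star>) = 0 \<Longrightarrow> V = 0"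
    using maximal_orthogonal_family[of S] unfolding S_def by blast
  define W where "W = osum C (\<lambda>V. V)"
  define p' q' where "p' = W\<^sup>\<star> * W" and "q' = W * W\<^sup>\<star>"
  have W: "W \<in> M" "pisom W"
    unfolding W_def using C by (auto intro!: M_osum osum_pisom simp: S_def)
  then have eq: "p' \<sim> q'" unfolding eqv_def p'_def q'_def by blast
  have pp: "proj p" "proj q" using p q by (auto simp: pr_def)
  have le: "p' \<unlhd> p" "q' \<unlhd> q"
  proof -
    have "W * (1 - p) = 0" unfolding W_def
    proof (rule osum_times_zero[OF C(2)])
      fix V assume "V \<in> C"
      then have "pisom V" "(V\<^sup>\<star> * V) * p = V\<^sup>\<star> * V" using C(1) by (auto simp: S_def ple_def)
      then have "V * p = V" using pisom_simps(1)[of V] by (metis mult.assoc)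
      then show "V * (1 - p) = 0" by (simp add: algebra_simps)
    qed
    then show "p' \<unlhd> p" unfolding p'_def using W pp
      by (simp add: ple_def algebra_simps) (metis (no_types) W(2) proj_initial proj_star star_times mult.assoc pp(1))
    have "(1 - q) * W = 0" unfolding W_def
    proof (rule times_osum_zero[OF C(2)])
      fix V assume "V \<in> C"
      then have "pisom V" "q * (V * V\<^sup>\<star>) = V * V\<^sup>\<star>" using C(1) by (auto simp: S_def ple_def)
      then have "q * V = V" using pisom_def by (metis mult.assoc)
      then show "(1 - q) * V = 0" by (simp add: algebra_simps)
    qed
    then show "q' \<unlhd> q" unfolding q'_def
      by (intro pleI proj_final W pp) (simp add: algebra_simps flip: mult.assoc)
  qed
  have "(q - q') * T * (p - p') = 0" if T: "T \<in> M" for T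
  proof (rule ccontr)
    assume "(q - q') * T * (p - p') \<noteq> 0"
    moreover have pr: "pr (p - p')" "pr (q - q')" using p q eqv_pr[OF eq] le by (auto intro: pr_diff)
    ultimately obtain V where V: "V \<in> M" "pisom V" "V \<noteq> 0" "V\<^sup>\<star> * V \<unlhd> p - p'" "V * V\<^sup>\<star> \<unlhd> q - q'"
      using nonzero_equivalent_subprojections[OF T] by blast
    have "pr (V\<^sup>\<star> * V)" "pr (V * V\<^sup>\<star>)" using V by (auto simp: pr_def proj_initial proj_final M_intros)
    then have "V\<^sup>\<star> * V \<unlhd> p \<and> p' * (V\<^sup>\<star> * V) = 0" "V * V\<^sup>\<star> \<unlhd> q \<and> q' * (V * V\<^sup>\<star>) = 0"
      using V(4,5) p q le eqv_pr[OF eq] ple_diff_iff unfolding pr_def by blast+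
    then have "V \<in> S" "(V\<^sup>\<star> * V) * p' = 0" "(V * V\<^sup>\<star>) * q' = 0"
      using V eqv_pr[OF eq] proj_orth_sym proj_initial proj_final unfolding S_def pr_def by blast+
    then show False using max V(3) unfolding p'_def q'_def W_def by blast
  qed
  then show ?thesis using eq le by blast
qed

text \<open>\<open>z\<close> projects onto the closed span of the vectors
  \<open>T \<rhd> e \<rhd> x\<close> with \<open>T \<in> M\<close>. This set is stable under
  \<open>M\<close> and under its commutant, so \<open>z\<close> commutes with \<open>M\<close> and
  belongs to it.\<close>

lemma central_support:
  assumes e: "pr e"
  shows "\<exists>z. central z \<and> e \<unlhd> z \<and> (\<forall>g. (\<forall>T\<in>M. g * T * e = 0) \<longrightarrow> g * z = 0)"
proof -
  define X where "X = {T \<rhd> e \<rhd> x |T x. T \<in> M}"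
  obtain z where z: "proj z" "\<And>x. x \<in> X \<Longrightarrow> z \<rhd> x = x" "\<And>T. \<forall>x\<in>X. T \<rhd> x = 0 \<Longrightarrow> T * z = 0"
    using span_projection_exists[of X] by blast
  have inv: "(1 - z) * C * z = 0" if "\<And>x. x \<in> X \<Longrightarrow> C \<rhd> x \<in> X" for C
    by (rule z(3)) (use that z(2) in \<open>auto simp: app_simps\<close>)
  have "A * z = z * A" if "A \<in> M" for A
  proof (rule proj_commute_if_invariant[OF z(1)])
    have "A \<rhd> x \<in> X" if "A \<in> M" "x \<in> X" for A x
    proof -
      from that(2) obtain T y where T: "T \<in> M" "x = T \<rhd> e \<rhd> y" unfolding X_def by blast
      then have "A \<rhd> x = (A * T) \<rhd> e \<rhd> y" by (simp add: app_times)
      then show ?thesis using M_times[OF that(1) T(1)] unfolding X_def by blast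
    qed
    then show "(1 - z) * A * z = 0" "(1 - z) * A\<^sup>\<star> * z = 0" using inv that star_closed by blast+
  qed
  then have "comm M z" by (simp add: comm_def)
  moreover have "z \<in> M"
  proof (rule bicommutant)
    have "C \<rhd> x \<in> X" if "comm M C" "x \<in> X" for C x
    proof -
      from that(2) obtain T y where T: "T \<in> M" "x = T \<rhd> e \<rhd> y" unfolding X_def by blast
      have "C \<rhd> x = T \<rhd> e \<rhd> C \<rhd> y"
        using commD[OF that(1) T(1)] commD[OF that(1) prD(1)[OF e]] unfolding T(2) by (metis app_times)
      then show ?thesis using T(1) unfolding X_def by blast
    qed
    then show "C * z = z * C" if "comm M C" for C
      using inv that comm_star by (intro proj_commute_if_invariant[OF z(1)]) blast+
  qed
  moreover have "e \<unlhd> z"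
  proof (intro pleI z(1) prD(2)[OF e] bop_eqI)
    fix x have "1 \<rhd> e \<rhd> x \<in> X" using M_one unfolding X_def by blast
    then show "(z * e) \<rhd> x = e \<rhd> x" using z(2) by (simp add: app_times)
  qed
  moreover have "g * z = 0" if "\<forall>T\<in>M. g * T * e = 0" for g
  proof (rule z(3), rule ballI)
    fix x assume "x \<in> X"
    then obtain T y where "T \<in> M" "x = T \<rhd> e \<rhd> y" unfolding X_def by blast
    then show "g \<rhd> x = 0" using that by (metis app_times app_zero)
  qed
  ultimately show ?thesis using z(1) unfolding central_def pr_def by blast
qed

lemma centralD:
  assumes "central z"
  shows "pr z" "z \<in> M" "proj z" "z * z = z" "A \<in> M \<Longrightarrow> z * A = A * z"
  using assms by (auto simp: central_def pr_def proj_idem commD)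

lemma central_compl: "central z \<Longrightarrow> central (1 - z)"
  unfolding central_def by (auto simp: pr_compl comm_def algebra_simps)

lemma central_mult:
  assumes "central y" "central z"
  shows "central (y * z)"
  unfolding central_def
proof
  show "pr (y * z)"
    by (intro pr_mult centralD(1) assms centralD(5)[OF assms(1) centralD(2)[OF assms(2)]])
  show "comm M (y * z)"
    unfolding comm_def
  proof
    fix A assume A: "A \<in> M"
    have "y * (z * A) = y * A * z" by (simp add: centralD(5)[OF assms(2) A] mult.assoc)
    then show "y * z * A = A * (y * z)" by (simp add: centralD(5)[OF assms(1) A] mult.assoc)
  qed
qed

lemma pr_central_mult: "central z \<Longrightarrow> pr p \<Longrightarrow> pr (z * p)"
  by (rule pr_mult) (auto simp: pr_def dest: centralD)

lemma ple_central_mult: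
  assumes "central z" "pr p"
  shows "z * p \<unlhd> p" "z * p \<unlhd> z"
proof -
  have "z * p = p * z" using centralD(5)[OF assms(1)] assms(2) by (auto simp: pr_def)
  then show "z * p \<unlhd> p" "z * p \<unlhd> z"
    using pr_central_mult[OF assms] assms centralD[OF assms(1)]
    by (auto intro!: pleI simp: pr_def mult.assoc proj_idem times_assoc_rule[OF proj_idem])
qed

lemma ple_central_mono:
  assumes "central z" "p \<unlhd> q" "pr p" "pr q"
  shows "z * p \<unlhd> z * q"
proof (intro pleI prD(2)[OF pr_central_mult[OF assms(1)]] assms)
  have "z * q = q * z" using centralD(5)[OF assms(1)] assms(4) by (auto simp: pr_def)
  then have "(z * q) * (z * p) = q * (z * z) * p" by (simp add: mult.assoc)
  also have "\<dots> = z * q * p" using \<open>z * q = q * z\<close> by (simp add: centralD[OF assms(1)])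
  also have "\<dots> = z * p" using assms(2) by (simp add: ple_def mult.assoc)
  finally show "(z * q) * (z * p) = z * p" .
qed

lemma sub_central_mono: "central z \<Longrightarrow> p \<preceq> q \<Longrightarrow> pr q \<Longrightarrow> z * p \<preceq> z * q"
  unfolding sub_def using eqv_central ple_central_mono eqv_pr by blast

text \<open>Match \<open>p\<close> and \<open>q\<close> maximally and let \<open>z\<close> be the
  central support of the leftover \<open>p - p'\<close>. It annihilates \<open>q - q'\<close>, so
  \<open>q\<close> is used up over \<open>z\<close>, and \<open>p\<close> is used up over
  \<open>1 - z\<close>.\<close>

lemma central_comparison:
  assumes p: "pr p" and q: "pr q"
  shows "\<exists>z. central z \<and> z * q \<preceq> z * p \<and> (1 - z) * p \<preceq> (1 - z) * q"
proof -
  obtain p' q' where pq: "p' \<sim> q'" "p' \<unlhd> p" "q' \<unlhd> q" "\<And>T. T \<in> M \<Longrightarrow> (q - q') * T * (p - p') = 0"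
    using maximal_equivalent_subprojections[OF p q] by blast
  note pr' = eqv_pr[OF pq(1)]
  obtain z where z: "central z" "p - p' \<unlhd> z" "(q - q') * z = 0"
    using central_support[OF pr_diff[OF pr'(1) p pq(2)]] pq(4) by blast
  note zD = centralD[OF z(1)]
  have "z * (q - q') = 0" using zD(5)[of "q - q'"] z(3) q pr' by (simp add: pr_def M_intros)
  then have zq: "z * q = z * q'" by (simp add: algebra_simps)
  have zp: "(1 - z) * p = (1 - z) * p'" using z(2) by (simp add: ple_def algebra_simps)
  have "z * q' \<sim> z * p'" using eqv_central[OF eqv_sym[OF pq(1)] z(1)] .
  moreover have "z * p' \<unlhd> z * p" by (rule ple_central_mono[OF z(1) pq(2) pr'(1) p])
  ultimately have 1: "z * q \<preceq> z * p" unfolding zq sub_def by blast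
  have "(1 - z) * p' \<sim> (1 - z) * q'" by (rule eqv_central[OF pq(1) central_compl[OF z(1)]])
  moreover have "(1 - z) * q' \<unlhd> (1 - z) * q"
    by (rule ple_central_mono[OF central_compl[OF z(1)] pq(3) pr'(2) q])
  ultimately have "(1 - z) * p \<preceq> (1 - z) * q" unfolding zp sub_def by blast
  with 1 z(1) show ?thesis by blast
qed

end

section \<open>Finite algebras: cancellation and uniqueness of halves\<close>

locale finite_von_neumann = von_neumann +
  assumes finite_isometry: "V \<in> M \<Longrightarrow> V\<^sup>\<star> * V = 1 \<Longrightarrow> V * V\<^sup>\<star> = 1"
begin

text \<open>The shift along an infinite orthogonal sequence of equivalent projections would be a
  non-unitary isometry.\<close>

lemma orthogonal_sequence_zero:
  assumes eq: "\<And>n::nat. p n \<sim> p (Suc n)" and orth: "\<And>m n. m \<noteq> n \<Longrightarrow> p m * p n = 0"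
  shows "p 0 = 0"
proof -
  have pr: "pr (p n)" for n using eqv_pr[OF eq] by blast
  then have proj: "proj (p n)" for n by (simp add: pr_def)
  have "\<forall>n. \<exists>V. V \<in> M \<and> pisom V \<and> V\<^sup>\<star> * V = p n \<and> V * V\<^sup>\<star> = p (Suc n)"
    using eq unfolding eqv_def by blast
  then obtain V where V: "\<And>n. V n \<in> M" "\<And>n. pisom (V n)" "\<And>n. (V n)\<^sup>\<star> * V n = p n"
    "\<And>n. V n * (V n)\<^sup>\<star> = p (Suc n)" by metis
  have fam: "ortho_family UNIV V" by (rule ortho_family_pisomI) (use V orth in auto)
  define T where "T = osum UNIV V"
  define E where "E = osum UNIV p"
  define E' where "E' = osum UNIV (\<lambda>n. p (Suc n))"
  have T: "T \<in> M" "pisom T" "T\<^sup>\<star> * T = E" "T * T\<^sup>\<star> = E'"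
    unfolding T_def E_def E'_def
    using M_osum[OF fam] osum_pisom[OF fam] osum_initial[OF fam] osum_final[OF fam] V by auto
  have E: "proj E" "\<And>n. p n \<unlhd> E" unfolding E_def by (rule osum_projs; use proj orth in simp)+
  have EM: "E \<in> M" using T by (metis M_times star_closed)
  have "(1 - E) * T = 0" unfolding T_def
  proof (rule times_osum_zero[OF fam])
    fix n
    have "E * (p (Suc n) * V n) = p (Suc n) * V n" using E(2)[of "Suc n"] unfolding ple_def by (metis mult.assoc)
    moreover have "p (Suc n) * V n = V n" using V(2,4) by (metis pisom_def)
    ultimately show "(1 - E) * V n = 0" by (simp add: algebra_simps)
  qed
  then have ET: "E * T = T" by (simp add: algebra_simps)
  have ET': "T\<^sup>\<star> * E = T\<^sup>\<star>" using arg_cong[OF ET, of star] by (simp add: star_times proj_star[OF E(1)])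
  have TE: "T * E = T" using T(3) pisom_simps(1)[OF T(2)] by simp
  have TE': "E * T\<^sup>\<star> = T\<^sup>\<star>" using arg_cong[OF TE, of star] by (simp add: star_times proj_star[OF E(1)])
  \<comment> \<open>The shift on \<open>E\<close> and the identity off \<open>E\<close>. Its
    unitarity gives \<open>E' = E\<close>, although \<open>p 0\<close> lies under \<open>E\<close>
    and is orthogonal to \<open>E'\<close>.\<close>
  define W where "W = T + (1 - E)"
  have "W\<^sup>\<star> * W = 1" unfolding W_def
    using T(3) ET ET' TE TE' by (simp add: star_simps proj_star[OF E(1)] proj_idem[OF E(1)] algebra_simps)
  then have "W * W\<^sup>\<star> = 1" using T(1) EM by (intro finite_isometry) (auto simp: W_def M_intros)
  then have "E' = E" unfolding W_def
    using T(4) ET ET' TE TE' by (simp add: star_simps proj_star[OF E(1)] proj_idem[OF E(1)] algebra_simps)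
  moreover have "p 0 * E' = 0" unfolding E'_def
    by (rule times_osum_zero[OF ortho_family_projI]) (use proj orth in auto)
  moreover have "p 0 * E = p 0" using E(2) by (simp add: ple_def)
  ultimately show ?thesis by simp
qed

text \<open>Let \<open>W\<close> carry \<open>F - A\<close> to \<open>F - B\<close>. By
  \<open>orth\<close>, every image of \<open>B\<close> under powers of \<open>W\<close> stays below
  \<open>F - A\<close>, where \<open>W\<close> is isometric, and \<open>B\<close> is orthogonal to
  the range of \<open>W\<close>. The projections \<open>b n\<close> onto these images are thus
  orthogonal and equivalent, which finiteness allows only for \<open>B = 0\<close>.\<close>

lemma cancellation_step:
  assumes F: "pr F" and AB: "pr A" "pr B" "A \<unlhd> F" "B \<unlhd> F"
    and eq: "F - A \<sim> F - B" and orth: "\<And>T. T \<in> M \<Longrightarrow> A * T * B = 0"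
  shows "B = 0"
proof -
  obtain W where W: "W \<in> M" "pisom W" "W\<^sup>\<star> * W = F - A" "W * W\<^sup>\<star> = F - B"
    using eq unfolding eqv_def by blast
  have B: "B * B = B" "B\<^sup>\<star> = B" "B \<in> M" "F * B = B" "B * F = B"
    using AB unfolding pr_def proj_def ple_def by auto
  define X where "X n = W ^ n" for n
  have XM: "X n \<in> M" for n unfolding X_def by (induction n) (auto simp: M_intros W)
  define b where "b n = X n * B * (X n)\<^sup>\<star>" for n
  have FW: "F * W = W"
  proof -
    have "F * (F - B) = F - B" using F B(4) by (simp add: pr_def proj_idem algebra_simps)
    moreover have "W = (F - B) * W" using W(2,4) pisom_def by metis
    ultimately show ?thesis by (metis mult.assoc)
  qed
  have FXB: "F * (X n * B) = X n * B" for n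
    by (cases n) (simp_all add: X_def B(4) mult.assoc times_assoc_rule[OF FW])
  have AX: "A * (X n * B) = 0" for n using orth[OF XM[of n]] by (simp add: mult.assoc)
  have WX: "W\<^sup>\<star> * (W * (X n * B)) = X n * B" for n
    by (simp add: times_assoc_rule[OF W(3)] left_diff_distrib FXB AX)
  have XX: "B * ((X n)\<^sup>\<star> * (X n * B)) = B" for n
  proof (induction n)
    case (Suc n)
    have "B * ((X (Suc n))\<^sup>\<star> * (X (Suc n) * B)) = B * ((X n)\<^sup>\<star> * (W\<^sup>\<star> * (W * (X n * B))))"
      by (simp add: X_def star_times mult.assoc)
    then show ?case using WX Suc by simp
  qed (simp add: X_def B)
  have BX: "B * (X (Suc n) * B) = 0" for n
  proof -
    have "B * W = B * ((F - B) * W)" using W(2,4) pisom_def by metis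
    also have "\<dots> = 0" using B by (simp add: algebra_simps flip: mult.assoc)
    finally have "B * W = 0" .
    from times_assoc_rule[OF this] show ?thesis by (simp add: X_def mult.assoc)
  qed
  have XmXn: "B * ((X m)\<^sup>\<star> * (X (m + Suc k) * B)) = 0" for m k
  proof (induction m)
    case (Suc m)
    have "B * ((X (Suc m))\<^sup>\<star> * (X (Suc m + Suc k) * B)) = B * ((X m)\<^sup>\<star> * (W\<^sup>\<star> * (W * (X (m + Suc k) * B))))"
      by (simp add: X_def star_times mult.assoc)
    then show ?case unfolding WX using Suc by simp
  next
    case 0
    then show ?case using BX[of k] by (simp add: X_def)
  qed
  have "b m * b n = 0" if "m < n" for m n
  proof -
    have "n = m + Suc (n - m - 1)" using that by simp
    then have "B * ((X m)\<^sup>\<star> * (X n * B)) = 0" using XmXn by metis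
    then show ?thesis by (simp add: b_def mult.assoc) (metis mult.assoc mult_zero_left mult_zero_right)
  qed
  moreover have bs: "(b n)\<^sup>\<star> = b n" for n by (simp add: b_def star_times B mult.assoc)
  ultimately have bb: "b m * b n = 0" if "m \<noteq> n" for m n
    using that by (metis linorder_neqE_nat star_times star_zero)
  have "b n \<sim> b (Suc n)" for n
  proof -
    let ?V = "X (Suc n) * B * (X n)\<^sup>\<star>"
    have i: "?V\<^sup>\<star> * ?V = b n"
      using XX[of "Suc n"] by (simp add: b_def star_times B mult.assoc) (metis mult.assoc)
    have f: "?V * ?V\<^sup>\<star> = b (Suc n)"
      using XX[of n] by (simp add: b_def star_times B mult.assoc) (metis mult.assoc)
    have "b n * b n = b n" using XX[of n] by (simp add: b_def mult.assoc) (metis mult.assoc)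
    then have "proj (b n)" using bs by (simp add: proj_def)
    then show ?thesis unfolding eqv_def using i f XM B(3)
      by (intro bexI[of _ ?V]) (auto simp: pisom_if_initial M_times star_closed)
  qed
  from orthogonal_sequence_zero[of b, OF this bb] show ?thesis by (simp add: b_def X_def)
qed

text \<open>After maximal matching of the complements, the leftovers \<open>A\<close> and
  \<open>B\<close> have \<open>F - A = P + p \<sim> Q + q = F - B\<close> and no nonzero corner
  between them, so \<open>cancellation_step\<close> removes both.\<close>

lemma cancellation:
  assumes F: "pr F" and eq: "P \<sim> Q" and le: "P \<unlhd> F" "Q \<unlhd> F"
  shows "F - P \<sim> F - Q"
proof -
  note pr = eqv_pr[OF eq]
  obtain p q where pq: "p \<sim> q" "p \<unlhd> F - P" "q \<unlhd> F - Q"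
    "\<And>T. T \<in> M \<Longrightarrow> (F - Q - q) * T * (F - P - p) = 0"
    using maximal_equivalent_subprojections[OF pr_diff[OF pr(1) F le(1)] pr_diff[OF pr(2) F le(2)]] by blast
  note pr' = eqv_pr[OF pq(1)]
  define A B where "A = F - P - p" and "B = F - Q - q"
  have p0: "P * p = 0" "Q * q = 0"
    using pq(2,3) F pr pr' le ple_diff_iff unfolding pr_def by blast+
  have prAB: "pr A" "pr B" unfolding A_def B_def
    by (intro pr_diff[OF _ _ pq(2)] pr_diff[OF _ _ pq(3)] pr_diff[OF _ F le(1)] pr_diff[OF _ F le(2)] pr pr')+
  have leAB: "A \<unlhd> F" "B \<unlhd> F"
  proof -
    have "A \<unlhd> F - P" "B \<unlhd> F - Q" unfolding A_def B_def
      using pq pr pr' F le by (auto intro!: ple_diff proj_diff simp: pr_def)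
    moreover have "F - P \<unlhd> F" "F - Q \<unlhd> F" using pr F le by (auto intro!: ple_diff simp: pr_def)
    ultimately show "A \<unlhd> F" "B \<unlhd> F" using ple_trans by blast+
  qed
  have "F - A = P + p" "F - B = Q + q" by (simp_all add: A_def B_def)
  then have eq': "F - A \<sim> F - B" using eqv_add[OF eq pq(1) p0] by (simp only:)
  have orth: "B * T * A = 0" if "T \<in> M" for T using pq(4) that by (simp add: A_def B_def)
  have orth': "A * T * B = 0" if "T \<in> M" for T
    using arg_cong[OF orth[OF star_closed[OF that]], of star] prAB
    by (simp add: star_times pr_def proj_star mult.assoc)
  have "B = 0" by (rule cancellation_step[OF F prAB leAB eq' orth'])
  moreover have "A = 0" by (rule cancellation_step[OF F prAB(2,1) leAB(2,1) eqv_sym[OF eq'] orth])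
  ultimately show ?thesis using pq(1) by (simp add: A_def B_def)
qed

text \<open>Without a trace: match \<open>p1\<close> with \<open>q1\<close> maximally, leaving
  \<open>a\<close> and \<open>b\<close>. Copying these into the other halves and cancelling yields
  \<open>a + a2 \<sim> b + b2\<close>; but nothing in \<open>M\<close> connects \<open>a\<close> to
  \<open>b\<close>, nor therefore to the copy \<open>b2\<close> of \<open>b\<close>, so
  \<open>a\<close> and then \<open>b\<close> vanish.\<close>

lemma halves_equivalent:
  assumes p: "p1 \<sim> p2" "p1 * p2 = 0" and q: "q1 \<sim> q2" "q1 * q2 = 0" and eq: "p1 + p2 \<sim> q1 + q2"
  shows "p1 \<sim> q1"
proof -
  note prp = eqv_pr[OF p(1)] and prq = eqv_pr[OF q(1)]
  obtain p' q' where pq: "p' \<sim> q'" "p' \<unlhd> p1" "q' \<unlhd> q1" "\<And>T. T \<in> M \<Longrightarrow> (q1 - q') * T * (p1 - p') = 0"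
    using maximal_equivalent_subprojections[OF prp(1) prq(1)] by blast
  note pr' = eqv_pr[OF pq(1)]
  define a b where "a = p1 - p'" and "b = q1 - q'"
  have ab: "pr a" "pr b" "a \<unlhd> p1" "b \<unlhd> q1" unfolding a_def b_def
    using pq pr' prp prq by (auto intro!: pr_diff ple_diff simp: pr_def proj_diff M_diff)
  obtain a2 where a2: "a \<sim> a2" "a2 \<unlhd> p2" "p1 - a \<sim> p2 - a2" using eqv_restrict[OF p(1) ab(1,3)] by blast
  obtain b2 where b2: "b \<sim> b2" "b2 \<unlhd> q2" "q1 - b \<sim> q2 - b2" using eqv_restrict[OF q(1) ab(2,4)] by blast
  have a0: "a * a2 = 0" by (rule ple_orth[OF ab(3) a2(2) p(2)])
  have b0: "b * b2 = 0" by (rule ple_orth[OF ab(4) b2(2) q(2)])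
  have 1: "p1 - a \<sim> q1 - b" using pq(1) by (simp add: a_def b_def)
  then have 2: "p2 - a2 \<sim> q2 - b2" using eqv_trans eqv_sym a2(3) b2(3) by blast
  have le: "p1 - a \<unlhd> p1" "p2 - a2 \<unlhd> p2" "q1 - b \<unlhd> q1" "q2 - b2 \<unlhd> q2"
    using ab a2 b2 prp prq eqv_pr[OF a2(1)] eqv_pr[OF b2(1)] by (auto intro!: ple_diff simp: pr_def)
  have "(p1 - a) + (p2 - a2) \<sim> (q1 - b) + (q2 - b2)"
    by (rule eqv_add[OF 1 2 ple_orth[OF le(1,2) p(2)] ple_orth[OF le(3,4) q(2)]])
  then have 3: "(p1 + p2) - (a + a2) \<sim> (q1 + q2) - (b + b2)" by (simp add: algebra_simps)
  have pra: "pr (a + a2)" and prb: "pr (b + b2)"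
    using a0 b0 eqv_pr[OF a2(1)] eqv_pr[OF b2(1)] by (auto intro: pr_add)
  have orth: "x * y = 0 \<Longrightarrow> pr x \<Longrightarrow> pr y \<Longrightarrow> y * x = 0" for x y
    using proj_orth_sym by (auto simp: pr_def)
  have add_le: "x + x' \<unlhd> y + y'"
    if "x \<unlhd> y" "x' \<unlhd> y'" "y * y' = 0" "pr y" "pr y'" "pr x" "pr x'" for x x' y y'
  proof -
    have "y * x' = 0" "y' * x = 0" "x * y' = 0" "x' * y = 0"
      using ple_orth[OF ple_refl that(2,3)] ple_orth[OF ple_refl that(1) orth[OF that(3-5)]]
        ple_orth[OF that(1) ple_refl that(3)] ple_orth[OF that(2) ple_refl orth[OF that(3-5)]] that
      by (auto simp: pr_def)
    then show ?thesis using that by (simp add: ple_def algebra_simps)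
  qed
  have lea: "a + a2 \<unlhd> p1 + p2" by (rule add_le[OF ab(3) a2(2) p(2) prp ab(1) eqv_pr(2)[OF a2(1)]])
  have leb: "b + b2 \<unlhd> q1 + q2" by (rule add_le[OF ab(4) b2(2) q(2) prq ab(2) eqv_pr(2)[OF b2(1)]])
  obtain x where x: "a + a2 \<sim> x" "x \<unlhd> q1 + q2" "(p1 + p2) - (a + a2) \<sim> (q1 + q2) - x"
    using eqv_restrict[OF eq pra lea] by blast
  have prQ: "pr (q1 + q2)" using eqv_pr[OF eq] by blast
  \<comment> \<open>Cancellation passes from subprojections to complements; applied to the
    complements of \<open>x\<close> and \<open>b + b2\<close>, it gives the equivalence of these
    two.\<close>
  have "(q1 + q2) - ((q1 + q2) - x) \<sim> (q1 + q2) - ((q1 + q2) - (b + b2))"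
    using x eqv_pr[OF x(1)] prQ prb leb
    by (intro cancellation[OF prQ] eqv_trans[OF eqv_sym[OF x(3)] 3]) (auto intro!: ple_diff simp: pr_def)
  moreover have "(q1 + q2) - ((q1 + q2) - y) = y" for y by simp
  ultimately have "x \<sim> b + b2" by (simp only:)
  then have ab2: "a + a2 \<sim> b + b2" by (rule eqv_trans[OF x(1)])
  then obtain V where V: "V \<in> M" "pisom V" "V\<^sup>\<star> * V = a + a2" "V * V\<^sup>\<star> = b + b2"
    unfolding eqv_def by blast
  obtain W where W: "W \<in> M" "pisom W" "W\<^sup>\<star> * W = b" "W * W\<^sup>\<star> = b2" using b2(1) unfolding eqv_def by blast
  have bTa: "b * (T * a) = 0" if "T \<in> M" for T using pq(4)[OF that] by (simp add: a_def b_def mult.assoc)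
  have "b2 * (V * a) = W * (b * (W\<^sup>\<star> * (V * a)))"
    using pisom_simps[OF W(2)] by (simp add: W(4)[symmetric] W(3)[symmetric] mult.assoc)
  also have "\<dots> = 0" using bTa[of "W\<^sup>\<star> * V"] V W by (simp add: mult.assoc M_times star_closed)
  finally have "(b + b2) * (V * a) = 0" using bTa[OF V(1)] by (simp add: algebra_simps)
  moreover have "(b + b2) * (V * a) = V * a"
    using pisom_simps[OF V(2)] by (simp add: V(4)[symmetric] mult.assoc)
  ultimately have "V * a = 0" by simp
  then have "(a + a2) * a = 0" by (simp add: V(3)[symmetric] mult.assoc)
  moreover have "(a + a2) * a = a" using ab(1) orth[OF a0 ab(1) eqv_pr(2)[OF a2(1)]]
    by (simp add: distrib_right pr_def proj_idem)
  ultimately have a: "a = 0" by simp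
  then have "a2 = 0" using a2(1) eqv_zero by blast
  then have "b + b2 = 0" using a ab2 eqv_zero by simp
  moreover have "b * (b + b2) = b" using b0 ab(2) by (simp add: distrib_left pr_def proj_idem)
  ultimately have "b = 0" by simp
  with a show ?thesis using pq(1) by (simp add: a_def b_def)
qed

end

subsection \<open>Halving projections in an algebra of type \<open>II\<^sub>1\<close>\<close>

lemma scaleC_minus_left: "(- c) *\<^sub>C x = - (c *\<^sub>C (x::'a::complex_vector))"
  by (metis add.right_inverse add_eq_0_iff scaleC_add_left scaleC_zero_left)

lemma cartesian_decomposition:
  fixes A :: "'a::chilbert_space bop"
  defines "H \<equiv> (1/2) *\<^sub>R (A + A\<^sup>\<star>)" and "K \<equiv> (- \<i> / 2) *\<^sub>C (A - A\<^sup>\<star>)"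
  shows "H\<^sup>\<star> = H" "K\<^sup>\<star> = K" "A = H + \<i> *\<^sub>C K"
proof -
  show "H\<^sup>\<star> = H" unfolding H_def by (simp add: star_simps add.commute)
  have "(\<i> / 2) *\<^sub>C (A\<^sup>\<star> - A) = (- (\<i> / 2)) *\<^sub>C (A - A\<^sup>\<star>)"
    by (simp only: scaleC_minus_left scaleC_diff_right) simp
  then show "K\<^sup>\<star> = K" unfolding K_def by (simp add: star_simps)
  have "\<i> *\<^sub>C K = (1/2) *\<^sub>R (A - A\<^sup>\<star>)" unfolding K_def scaleC_scaleC scaleR_scaleC by simp
  then have "H + \<i> *\<^sub>C K = (1/2) *\<^sub>R A + (1/2) *\<^sub>R A" by (simp add: H_def algebra_simps)
  then show "A = H + \<i> *\<^sub>C K" by (simp flip: scaleR_left_distrib)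
qed

lemma osum_times_right:
  assumes "ortho_family I P" "ortho_family I (\<lambda>i. P i * B)"
  shows "osum I (\<lambda>i. P i * B) = osum I P * B"
  by (rule osum_eqI[OF assms(2)]) (use osum_has_sum[OF assms(1)] in \<open>simp add: app_times\<close>)

locale type_ii1 = finite_von_neumann +
  assumes no_abelian: "pr e \<Longrightarrow>
    (\<And>A B. A \<in> M \<Longrightarrow> B \<in> M \<Longrightarrow> (e * A * e) * (e * B * e) = (e * B * e) * (e * A * e)) \<Longrightarrow> e = 0"
begin

text \<open>Otherwise every \<open>g \<unlhd> r\<close> has a zero corner
  \<open>(r - g) * T * g\<close>, hence commutes with \<open>r M r\<close>. Applied to spectral
  projections, this makes self-adjoint elements of \<open>r M r\<close> central there, so
  \<open>r\<close> is abelian.\<close>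

lemma orthogonal_equivalent_pair:
  assumes r: "pr r" "r \<noteq> 0"
  shows "\<exists>a b. a \<sim> b \<and> a \<noteq> 0 \<and> a * b = 0 \<and> a \<unlhd> r \<and> b \<unlhd> r"
proof (rule ccontr)
  assume no: "\<not> ?thesis"
  have rr: "r \<in> M" "proj r" "r * r = r" "r\<^sup>\<star> = r" using r by (auto simp: pr_def proj_def)
  have off: "(r - g) * T * g = 0" if g: "pr g" "g \<unlhd> r" and T: "T \<in> M" for g T
  proof (rule ccontr)
    assume "(r - g) * T * g \<noteq> 0"
    moreover have "pr (r - g)" by (rule pr_diff[OF g(1) r(1) g(2)])
    ultimately obtain V where V: "V \<in> M" "pisom V" "V \<noteq> 0" "V\<^sup>\<star> * V \<unlhd> g" "V * V\<^sup>\<star> \<unlhd> r - g"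
      using nonzero_equivalent_subprojections[OF T _ g(1)] by blast
    have "V\<^sup>\<star> * V \<sim> V * V\<^sup>\<star>" using V unfolding eqv_def by blast
    moreover have "V\<^sup>\<star> * V \<noteq> 0" using V(3) by (simp add: star_times_self_eq_zero)
    moreover have "g * (r - g) = 0" using g by (simp add: pr_def proj_idem ple_def algebra_simps)
    then have "(V\<^sup>\<star> * V) * (V * V\<^sup>\<star>) = 0" by (rule ple_orth[OF V(4,5)])
    moreover have "V\<^sup>\<star> * V \<unlhd> r" "V * V\<^sup>\<star> \<unlhd> r"
      using ple_trans[OF V(4) g(2)] ple_trans[OF V(5)] ple_diff[OF _ rr(2) g(2)] g(1) by (auto simp: pr_def)
    ultimately show False using no by blast
  qed
  have sa: "(r * B * r) * (r * A * r) = (r * A * r) * (r * B * r)" if A: "A \<in> M" "A\<^sup>\<star> = A" and B: "B \<in> M" for A B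
  proof (rule commute_if_commute_spectral_projections)
    show "(r * A * r)\<^sup>\<star> = r * A * r" by (simp add: star_times rr A mult.assoc)
    fix P assume P: "proj P" "\<And>D. star_commute (r * A * r) D \<Longrightarrow> D * P = P * D"
    have PM: "P \<in> M" by (rule in_M_if_star_commute[OF _ P(2)]) (simp_all add: M_times rr A)
    have rP: "r * P = P * r"
      by (rule P(2)) (simp add: star_commute_def rr mult.assoc times_assoc_rule[OF rr(3)])
    define g where "g = P * r"
    have g: "pr g" unfolding g_def using r PM P(1) rP by (intro pr_mult) (auto simp: pr_def)
    have gr: "g \<unlhd> r"
      by (rule pleI) (use g in \<open>simp_all add: pr_def rr g_def rP[symmetric] mult.assoc[symmetric]\<close>)
    have 1: "r * B * g = g * B * g" using off[OF g gr B] by (simp add: algebra_simps)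
    have "r * B\<^sup>\<star> * g = g * B\<^sup>\<star> * g" using off[OF g gr star_closed[OF B]] by (simp add: algebra_simps)
    from arg_cong[OF this, of star] have 2: "g * B * r = g * B * g"
      using g by (simp add: star_times rr pr_def proj_star mult.assoc)
    have "r * B * r * P = r * B * g" by (simp add: g_def mult.assoc rP)
    moreover have "P * (r * B * r) = g * B * r" by (simp add: g_def mult.assoc)
    ultimately show "r * B * r * P = P * (r * B * r)" using 1 2 by simp
  qed
  have "(r * A * r) * (r * B * r) = (r * B * r) * (r * A * r)" if A: "A \<in> M" and B: "B \<in> M" for A B
  proof -
    define H K where "H = (1/2) *\<^sub>R (A + A\<^sup>\<star>)" and "K = (- \<i> / 2) *\<^sub>C (A - A\<^sup>\<star>)"
    note HK = cartesian_decomposition[of A, folded H_def K_def]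
    have "H \<in> M" "K \<in> M" unfolding H_def K_def by (intro M_intros A)+
    then have "(r * B * r) * (r * H * r) = (r * H * r) * (r * B * r)" "(r * B * r) * (r * K * r) = (r * K * r) * (r * B * r)"
      using sa HK B by blast+
    moreover have "r * A * r = r * H * r + \<i> *\<^sub>C (r * K * r)"
      by (subst HK(3)) (simp add: algebra_simps scaleC_times_left scaleC_times_right)
    ultimately show ?thesis by (simp add: distrib_left distrib_right scaleC_times_left scaleC_times_right)
  qed
  then show False using no_abelian[OF r(1)] r(2) by blast
qed

text \<open>A maximal orthogonal family of subprojections that split into equivalent halves exhausts
  \<open>p\<close>, since a pair from \<open>orthogonal_equivalent_pair\<close> would extend it;
  first and second halves are then summed separately.\<close>

lemma halving:
  assumes p: "pr p"
  shows "\<exists>a b. a \<sim> b \<and> a * b = 0 \<and> p = a + b"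
proof -
  define S where "S = {e. pr e \<and> e \<unlhd> p \<and> (\<exists>a b. a \<sim> b \<and> a * b = 0 \<and> e = a + b)}"
  have S: "V \<in> M \<and> pisom V" if "V \<in> S" for V using that by (auto simp: S_def pr_def pisom_proj)
  obtain C where C: "C \<subseteq> S" "ortho_family C (\<lambda>V. V)" and
    max: "\<And>V. V \<in> S \<Longrightarrow> (V\<^sup>\<star> * V) * ((osum C (\<lambda>V. V))\<^sup>\<star> * osum C (\<lambda>V. V)) = 0 \<Longrightarrow>
       (V * V\<^sup>\<star>) * (osum C (\<lambda>V. V) * (osum C (\<lambda>V. V))\<^sup>\<star>) = 0 \<Longrightarrow> V = 0"
    using maximal_orthogonal_family[of S, OF S] by blast
  have Cpr: "e \<in> C \<Longrightarrow> pr e" "e \<in> C \<Longrightarrow> e \<unlhd> p" for e using C(1) by (auto simp: S_def)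
  have Corth: "e * e' = 0" if "e \<in> C" "e' \<in> C" "e \<noteq> e'" for e e'
    using ortho_familyD(2)[OF C(2) that] Cpr[OF that(2)] by (simp add: pr_def proj_star)
  define f where "f = osum C (\<lambda>V. V)"
  have f: "proj f" "f \<in> M" unfolding f_def using C Cpr S by (auto intro!: osum_proj M_osum simp: pr_def)
  have fp: "f \<unlhd> p" unfolding f_def
    by (rule osum_projs(3)) (use Cpr Corth p in \<open>auto simp: pr_def\<close>)
  have "p - f = 0"
  proof (rule ccontr)
    assume "p - f \<noteq> 0"
    then obtain a b where ab: "a \<sim> b" "a \<noteq> 0" "a * b = 0" "a \<unlhd> p - f" "b \<unlhd> p - f"
      using orthogonal_equivalent_pair[of "p - f"] pr_diff[OF _ p fp] f by (auto simp: pr_def)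
    note prab = eqv_pr[OF ab(1)]
    have le: "a \<unlhd> p" "b \<unlhd> p" "f * a = 0" "f * b = 0"
      using ab(4,5) ple_diff_iff[OF _ f(1) _ fp] prab p by (auto simp: pr_def)
    have "pr (a + b)" by (rule pr_add[OF prab ab(3)])
    moreover have "a + b \<unlhd> p" using le by (simp add: ple_def algebra_simps)
    ultimately have "a + b \<in> S" using ab unfolding S_def by blast
    moreover have "(a + b) * f = 0"
      using le proj_orth_sym[OF f(1)] prab by (simp add: pr_def distrib_right)
    ultimately have "a + b = 0"
      using max[of "a + b"] \<open>pr (a + b)\<close> f by (simp add: f_def[symmetric] pr_def proj_star proj_idem)
    moreover have "a * (a + b) = a" using ab(3) prab(1) by (simp add: distrib_left pr_def proj_idem)
    ultimately show False using ab(2) by simp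
  qed
  then have pf: "p = f" by simp
  have "\<forall>e\<in>C. \<exists>a b. a \<sim> b \<and> a * b = 0 \<and> e = a + b" using C(1) unfolding S_def by blast
  then obtain a b where ab: "\<And>e. e \<in> C \<Longrightarrow> a e \<sim> b e" "\<And>e. e \<in> C \<Longrightarrow> a e * b e = 0"
    "\<And>e. e \<in> C \<Longrightarrow> e = a e + b e" by metis
  have prj: "proj (a e)" "proj (b e)" if "e \<in> C" for e using eqv_pr[OF ab(1)[OF that]] by (auto simp: pr_def)
  have le: "a e \<unlhd> e" "b e \<unlhd> e" if "e \<in> C" for e
    using ab(2,3)[OF that] prj[OF that] proj_orth_sym[OF prj[OF that]]
    by (metis ple_add_left, metis ple_add_left add.commute)
  have orth: "a e * a e' = 0" "b e * b e' = 0" "a e * b e' = 0" if "e \<in> C" "e' \<in> C" "e \<noteq> e'" for e e'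
    using ple_orth le Corth that by metis+
  have fams: "ortho_family C a" "ortho_family C b"
    by (rule ortho_family_projI; use prj orth in simp)+
  have "osum C a \<sim> osum C b" by (rule eqv_osum) (use ab orth in auto)
  moreover have "osum C a * osum C b = 0"
  proof (rule osum_times_zero[OF fams(1)])
    fix e assume e: "e \<in> C"
    show "a e * osum C b = 0"
      by (rule times_osum_zero[OF fams(2)]) (use e orth ab(2) in metis)
  qed
  moreover have "osum C (\<lambda>e. a e + b e) = f"
    unfolding f_def osum_def by (auto intro!: arg_cong[of _ _ Bop] infsum_cong simp: ab(3)[symmetric])
  moreover have "ortho_family C (\<lambda>e. a e + b e)"
    using C(2) by (simp add: ortho_family_def ab(3)[symmetric])
  ultimately have "f = osum C a + osum C b" "osum C a \<sim> osum C b" "osum C a * osum C b = 0"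
    using osum_add[OF fams] by simp_all
  then show ?thesis using pf by blast
qed

end

text \<open>Normality is the right generality: the results are applied to unitaries of corners as
  well, which are only partial isometries in \<open>M\<close>.\<close>

locale type_ii1_normal = type_ii1 +
  fixes u :: "'a bop"
  assumes u: "u \<in> M" "u\<^sup>\<star> * u = u * u\<^sup>\<star>"
begin

lemma star_u_commute: "proj g \<Longrightarrow> u * g = g * u \<Longrightarrow> u\<^sup>\<star> * g = g * u\<^sup>\<star>"
  by (metis proj_star star_times)

text \<open>If no such \<open>g\<close> existed, \<open>e\<close> would commute with all spectral
  projections of the real and imaginary parts of \<open>u\<close>, cut down to \<open>f\<close>, and
  therefore with \<open>u\<close>.\<close>

lemma commuting_projection_separating:
  assumes e: "pr e" and f: "pr f" "u * f = f * u" and ef: "e \<unlhd> f" and ne: "e * u \<noteq> u * e"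
  shows "\<exists>g. pr g \<and> g \<unlhd> f \<and> u * g = g * u \<and> g * e * (f - g) \<noteq> 0"
proof (rule ccontr)
  assume no: "\<not> ?thesis"
  have fD: "proj f" "f \<in> M" "f * f = f" and eD: "proj e" "e * f = e" "f * e = e"
    using e f ef by (auto simp: pr_def proj_def ple_def)
  have key: "e * T = T * e" if T: "T \<in> M" "T\<^sup>\<star> = T" "T * u = u * T" "T * u\<^sup>\<star> = u\<^sup>\<star> * T" "T * f = f * T" for T
  proof (rule commute_if_commute_spectral_projections[OF T(2)])
    fix P assume P: "proj P" "\<And>D. star_commute T D \<Longrightarrow> D * P = P * D"
    have PM: "P \<in> M" by (rule in_M_if_star_commute[OF T(1) P(2)])
    have Pu: "u * P = P * u" by (rule P(2)) (use T in \<open>simp add: star_commute_def\<close>)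
    have Pf: "f * P = P * f" by (rule P(2)) (use T fD in \<open>simp add: star_commute_def proj_star\<close>)
    define g where "g = P * f"
    have g: "pr g" unfolding g_def using PM P(1) Pf f by (intro pr_mult) (auto simp: pr_def)
    have gf: "g \<unlhd> f"
      by (rule pleI) (use g fD in \<open>simp_all add: pr_def g_def Pf[symmetric] mult.assoc[symmetric]\<close>)
    have "u * g = g * u" unfolding g_def using Pu f(2) by (metis mult.assoc)
    then have "g * e * (f - g) = 0" using no g gf by blast
    moreover have "g * e * (f - g) = g * e - g * e * g" by (simp add: right_diff_distrib mult.assoc eD)
    ultimately have 1: "g * e = g * e * g" by simp
    have "e * g = (g * e)\<^sup>\<star>" using g eD by (simp add: star_times pr_def proj_star)
    also have "\<dots> = (g * e * g)\<^sup>\<star>" by (rule arg_cong[OF 1])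
    also have "\<dots> = g * e * g" using g eD by (simp add: star_times pr_def proj_star mult.assoc)
    finally have 2: "e * g = g * e * g" .
    have "e * P = e * g" using eD Pf by (simp add: g_def mult.assoc[symmetric]) (metis mult.assoc eD(2) Pf)
    moreover have "P * e = g * e" using eD by (simp add: g_def mult.assoc)
    ultimately show "e * P = P * e" using 1 2 by simp
  qed
  define H K where "H = (1/2) *\<^sub>R (u + u\<^sup>\<star>)" and "K = (- \<i> / 2) *\<^sub>C (u - u\<^sup>\<star>)"
  note HK = cartesian_decomposition[of u, folded H_def K_def]
  have sf: "u\<^sup>\<star> * f = f * u\<^sup>\<star>" by (rule star_u_commute[OF fD(1) f(2)])
  have "e * H = H * e"
  proof (rule key[OF _ HK(1)])
    show "H \<in> M" unfolding H_def by (intro M_intros u)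
  qed (use u f(2) sf in \<open>simp_all add: H_def algebra_simps\<close>)
  moreover have "e * K = K * e"
  proof (rule key[OF _ HK(2)])
    show "K \<in> M" unfolding K_def by (intro M_intros u)
  qed (use u f(2) sf in \<open>simp_all add: K_def scaleC_times_left scaleC_times_right algebra_simps\<close>)
  ultimately have "e * u = u * e"
    by (subst (1 2) HK(3)) (simp add: distrib_left distrib_right scaleC_times_left scaleC_times_right)
  then show False using ne by blast
qed

text \<open>If no nonzero \<open>g \<unlhd> f\<close> commuting with \<open>u\<close> embeds in \<open>e\<close>, central comparison makes \<open>e\<close>
  embed, over a suitable central projection, in both parts of a splitting of \<open>f\<close>; a maximal
  orthogonal family of such central projections covers \<open>e\<close>.\<close>

lemma commuting_splitting:
  assumes f: "pr f" "u * f = f * u" and ef: "e \<preceq> f"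
    and no: "\<And>g. pr g \<Longrightarrow> g \<unlhd> f \<Longrightarrow> u * g = g * u \<Longrightarrow> g \<preceq> e \<Longrightarrow> g = 0"
  shows "\<exists>g. pr g \<and> g \<unlhd> f \<and> u * g = g * u \<and> e \<preceq> g \<and> e \<preceq> f - g"
proof -
  have e: "pr e" by (rule sub_pr[OF ef])
  have fD: "f \<in> M" "proj f" and eD: "e \<in> M" "proj e" using f e by (auto simp: pr_def)
  \<comment> \<open>\<open>Q y g\<close> says that, over the central projection \<open>y\<close>,
    the splitting of \<open>f\<close> into \<open>g\<close> and \<open>f - g\<close> already does
    what is wanted.\<close>
  define Q where "Q y g \<longleftrightarrow> pr g \<and> g \<unlhd> f \<and> u * g = g * u \<and> y * e \<preceq> y * g \<and> y * e \<preceq> y * (f - g)" for y g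
  define S where "S = {y. central y \<and> (\<exists>g. Q y g)}"
  have S: "V \<in> M \<and> pisom V" if "V \<in> S" for V using that by (auto simp: S_def centralD pisom_proj)
  obtain C where C: "C \<subseteq> S" "ortho_family C (\<lambda>V. V)" and
    max: "\<And>V. V \<in> S \<Longrightarrow> (V\<^sup>\<star> * V) * ((osum C (\<lambda>V. V))\<^sup>\<star> * osum C (\<lambda>V. V)) = 0 \<Longrightarrow>
       (V * V\<^sup>\<star>) * (osum C (\<lambda>V. V) * (osum C (\<lambda>V. V))\<^sup>\<star>) = 0 \<Longrightarrow> V = 0"
    using maximal_orthogonal_family[of S, OF S] by blast
  have Cc: "central y" if "y \<in> C" for y using C(1) that by (auto simp: S_def)
  have Corth: "y * y' = 0" if "y \<in> C" "y' \<in> C" "y \<noteq> y'" for y y'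
    using ortho_familyD(2)[OF C(2) that] centralD(3)[OF Cc[OF that(2)]] by (simp add: proj_star)
  define y0 where "y0 = osum C (\<lambda>V. V)"
  have y0: "proj y0" "y0 \<in> M" unfolding y0_def using C Cc centralD S by (auto intro!: osum_proj M_osum)
  have "y0 * A = A * y0" if "A \<in> M" for A unfolding y0_def
    by (rule osum_commute[OF C(2), symmetric]) (use Cc centralD(5) that in metis)
  then have y0c: "central y0" using y0 by (simp add: central_def pr_def comm_def)
  have "\<forall>y\<in>C. \<exists>g. Q y g" using C(1) unfolding S_def by blast
  then obtain G where G: "\<And>y. y \<in> C \<Longrightarrow> Q y (G y)" by metis
  have GD: "pr (G y)" "G y \<unlhd> f" "u * G y = G y * u" "y * e \<preceq> y * G y" "y * e \<preceq> y * (f - G y)"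
    if "y \<in> C" for y using G[OF that] unfolding Q_def by auto
  have yG: "pr (y * G y)" "y * G y \<unlhd> G y" "y * G y \<unlhd> y" if "y \<in> C" for y
    using pr_central_mult[OF Cc[OF that] GD(1)[OF that]] ple_central_mult[OF Cc[OF that] GD(1)[OF that]] by auto
  have yGorth: "(y * G y) * (y' * G y') = 0" if "y \<in> C" "y' \<in> C" "y \<noteq> y'" for y y'
    by (rule ple_orth[OF yG(3)[OF that(1)] yG(3)[OF that(2)] Corth[OF that]])
  define g where "g = osum C (\<lambda>y. y * G y)"
  have fam: "ortho_family C (\<lambda>y. y * G y)"
    by (rule ortho_family_projI) (use yG(1) yGorth in \<open>auto simp: pr_def\<close>)
  have g1: "pr g" unfolding pr_def g_def
    using fam yG(1) by (auto intro!: osum_proj M_osum simp: pr_def)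
  have yGg: "y * G y \<unlhd> g" if "y \<in> C" for y
    unfolding g_def by (rule osum_projs(2)[OF _ _ that]) (use yG(1) yGorth in \<open>auto simp: pr_def\<close>)
  have g2: "g \<unlhd> f" unfolding g_def
    by (rule osum_projs(3)) (use yG(1) yGorth fD ple_trans[OF yG(2) GD(2)] in \<open>auto simp: pr_def\<close>)
  have g3: "u * g = g * u" unfolding g_def
  proof (rule osum_commute[OF fam])
    fix y assume y: "y \<in> C"
    show "u * (y * G y) = y * G y * u"
      using centralD(5)[OF Cc[OF y] u(1)] GD(3)[OF y] by (metis mult.assoc)
  qed
  have ye: "ortho_family C (\<lambda>y. y * e)"
  proof (rule ortho_family_projI)
    fix y y' assume y: "y \<in> C" "y' \<in> C" "y \<noteq> y'"
    show "(y * e) * (y' * e) = 0"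
      by (rule ple_orth[OF ple_central_mult(2)[OF Cc[OF y(1)] e] ple_central_mult(2)[OF Cc[OF y(2)] e] Corth[OF y]])
  qed (use pr_central_mult[OF Cc e] in \<open>auto simp: pr_def\<close>)
  have y0e: "osum C (\<lambda>y. y * e) = y0 * e" unfolding y0_def by (rule osum_times_right[OF C(2) ye])
  \<comment> \<open>Gluing of embeddings over the orthogonal central projections \<open>y\<close>:
    each \<open>k y\<close> lies under \<open>y\<close>, so the images are orthogonal and can be
    summed.\<close>
  have embed: "y0 * e \<preceq> h" if h: "pr h" "\<And>y. y \<in> C \<Longrightarrow> k y \<unlhd> h" "\<And>y. y \<in> C \<Longrightarrow> k y \<unlhd> y"
    "\<And>y. y \<in> C \<Longrightarrow> y * e \<preceq> k y" for h k
  proof -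
    have "\<forall>y\<in>C. \<exists>r. y * e \<sim> r \<and> r \<unlhd> k y" using h(4) unfolding sub_def by blast
    then obtain r where r: "\<And>y. y \<in> C \<Longrightarrow> y * e \<sim> r y" "\<And>y. y \<in> C \<Longrightarrow> r y \<unlhd> k y" by metis
    have rorth: "r y * r y' = 0" if "y \<in> C" "y' \<in> C" "y \<noteq> y'" for y y'
      by (rule ple_orth[OF ple_trans[OF r(2)[OF that(1)] h(3)[OF that(1)]]
            ple_trans[OF r(2)[OF that(2)] h(3)[OF that(2)]] Corth[OF that]])
    have "osum C (\<lambda>y. y * e) \<sim> osum C r"
    proof (rule eqv_osum[OF r(1) _ rorth])
      fix y y' assume y: "y \<in> C" "y' \<in> C" "y \<noteq> y'"
      show "(y * e) * (y' * e) = 0"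
        by (rule ple_orth[OF ple_central_mult(2)[OF Cc[OF y(1)] e] ple_central_mult(2)[OF Cc[OF y(2)] e] Corth[OF y]])
    qed
    moreover have "osum C r \<unlhd> h"
      by (rule osum_projs(3))
         (use rorth eqv_pr(2)[OF r(1)] h(1) ple_trans[OF r(2) h(2)] in \<open>auto simp: pr_def\<close>)
    ultimately show ?thesis unfolding sub_def y0e by blast
  qed
  have E1: "y0 * e \<preceq> g"
    by (rule embed[OF g1, of "\<lambda>y. y * G y"]) (use yGg yG GD in auto)
  have prfg: "pr (f - g)" by (rule pr_diff[OF g1 f(1) g2])
  have E2: "y0 * e \<preceq> f - g"
  proof (rule embed[OF prfg, of "\<lambda>y. y * (f - G y)"])
    fix y assume y: "y \<in> C"
    have d: "pr (f - G y)" by (rule pr_diff[OF GD(1)[OF y] f(1) GD(2)[OF y]])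
    note yd = pr_central_mult[OF Cc[OF y] d] ple_central_mult[OF Cc[OF y] d]
    show "y * (f - G y) \<unlhd> y" by (rule yd(3))
    have "g * y = (y * G y) * y" unfolding g_def
    proof (rule osum_times_single[OF fam y])
      fix y' assume y': "y' \<in> C" "y' \<noteq> y"
      have "y' * G y' = (y' * G y') * y'" using yG(3)[OF y'(1)] by (simp add: ple_def)
      then show "(y' * G y') * y = 0" using Corth[OF y'(1) y y'(2)] by (metis mult.assoc mult_zero_right)
    qed
    moreover have "G y * y = y * G y" using centralD(5)[OF Cc[OF y]] prD(1)[OF GD(1)[OF y]] by simp
    moreover have "G y * (f - G y) = 0"
      using GD(1,2)[OF y] by (simp add: ple_def pr_def proj_idem algebra_simps)
    ultimately have "g * (y * (f - G y)) = 0" by (metis mult.assoc mult_zero_right)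
    moreover have "y * (f - G y) \<unlhd> f"
      using ple_trans[OF yd(2) ple_diff] GD(1,2)[OF y] f by (auto simp: pr_def)
    ultimately show "y * (f - G y) \<unlhd> f - g"
      using ple_diff_iff[OF _ _ fD(2) g2] yd(1) g1 by (auto simp: pr_def)
  qed (use GD in auto)
  define w where "w = 1 - y0"
  have wc: "central w" unfolding w_def by (rule central_compl[OF y0c])
  note wD = centralD[OF wc]
  have "w * e = 0"
  proof (rule ccontr)
    assume we0: "w * e \<noteq> 0"
    have pwe: "pr (w * e)" and pwf: "pr (w * f)" using pr_central_mult[OF wc] e f by auto
    have wele: "w * e \<unlhd> e" "w * f \<unlhd> f" using ple_central_mult[OF wc] e f by auto
    have uwf: "u * (w * f) = (w * f) * u" using wD(5)[OF u(1)] f(2) by (metis mult.assoc)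
    obtain E0 where E0: "w * e \<sim> E0" "E0 \<unlhd> w * f"
      using sub_central_mono[OF wc ef f(1)] unfolding sub_def by blast
    note pE0 = eqv_pr(2)[OF E0(1)]
    \<comment> \<open>\<open>E0\<close> is a copy of \<open>w * e\<close> under \<open>f\<close>; if
      it commuted with \<open>u\<close>, the assumption \<open>no\<close> would make it
      zero.\<close>
    have "E0 * u \<noteq> u * E0"
    proof
      assume "E0 * u = u * E0"
      moreover have "E0 \<preceq> e" using sub_trans_eqv[OF eqv_sym[OF E0(1)] ple_sub[OF pwe wele(1)]] .
      ultimately have "E0 = 0" using no[OF pE0 ple_trans[OF E0(2) wele(2)]] by simp
      then show False using E0(1) eqv_zero' we0 by blast
    qed
    from commuting_projection_separating[OF pE0 pwf uwf E0(2) this]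
    obtain h where h: "pr h" "h \<unlhd> w * f" "u * h = h * u" "h * E0 * (w * f - h) \<noteq> 0" by blast
    define h' where "h' = w * f - h"
    have h': "pr h'" unfolding h'_def by (rule pr_diff[OF h(1) pwf h(2)])
    have uh': "u * h' = h' * u" using uwf h(3) by (simp add: h'_def algebra_simps)
    have h'le: "h' \<unlhd> w * f" unfolding h'_def using h pwf by (intro ple_diff) (auto simp: pr_def)
    \<comment> \<open>Where comparison embeds \<open>k\<close> in \<open>e\<close>, the assumption
      \<open>no\<close> annihilates \<open>k\<close>; over the complementary central projection
      \<open>w * e\<close> embeds in \<open>k\<close>.\<close>
    have cut: "\<exists>z. central z \<and> z * k = 0 \<and> (1 - z) * (w * e) \<preceq> (1 - z) * k"
      if k: "pr k" "k \<unlhd> w * f" "u * k = k * u" for k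
    proof -
      obtain z where z: "central z" "z * k \<preceq> z * (w * e)" "(1 - z) * (w * e) \<preceq> (1 - z) * k"
        using central_comparison[OF pwe k(1)] by blast
      have "z * k = 0"
      proof (rule no)
        show "pr (z * k)" by (rule pr_central_mult[OF z(1) k(1)])
        show "z * k \<unlhd> f" using ple_trans[OF ple_central_mult(1)[OF z(1) k(1)] ple_trans[OF k(2) wele(2)]] .
        show "u * (z * k) = z * k * u" using centralD(5)[OF z(1) u(1)] k(3) by (metis mult.assoc)
        show "z * k \<preceq> e"
          using sub_trans_ple[OF z(2) ple_trans[OF ple_central_mult(1)[OF z(1) pwe] wele(1)]] .
      qed
      then show ?thesis using z by blast
    qed
    obtain z where z: "central z" "z * h = 0" "(1 - z) * (w * e) \<preceq> (1 - z) * h" using cut[OF h(1-3)] by blast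
    obtain z' where z': "central z'" "z' * h' = 0" "(1 - z') * (w * e) \<preceq> (1 - z') * h'" using cut[OF h' h'le uh'] by blast
    define c c' where "c = 1 - z" and "c' = 1 - z'"
    have c: "central c" "central c'" unfolding c_def c'_def using z z' central_compl by auto
    \<comment> \<open>The central part over which \<open>w * e\<close> embeds in both
      \<open>h\<close> and \<open>h'\<close>; there \<open>h\<close> splits \<open>f\<close> as
      required.\<close>
    define y where "y = c * c' * w"
    have yc: "central y" unfolding y_def by (intro central_mult c wc)
    have cc': "c * c' = c' * c" using centralD(5)[OF c(1) centralD(2)[OF c(2)]] .
    have wh: "w * h = h" "w * h' = h'"
    proof -
      have "w * f \<unlhd> w" by (rule ple_central_mult(2)[OF wc f(1)])
      then show "w * h = h" "w * h' = h'" using ple_trans[OF h(2)] ple_trans[OF h'le] by (auto simp: ple_def)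
    qed
    have ch: "c * h = h" "c' * h' = h'" using z(2) z'(2) by (simp_all add: c_def c'_def algebra_simps)
    have yh: "y * h = c' * h" and yh': "y * (f - h) = c * h'"
    proof -
      show "y * h = c' * h" using cc' ch wh by (simp add: y_def mult.assoc)
      have "w * (f - h) = h'" using wh by (simp add: h'_def algebra_simps)
      then show "y * (f - h) = c * h'" using ch by (simp add: y_def mult.assoc)
    qed
    have ye1: "y * e = c' * (c * (w * e))" using cc' by (simp add: y_def mult.assoc[symmetric])
    have ye2: "y * e = c * (c' * (w * e))" by (simp add: y_def mult.assoc)
    have "y * e \<preceq> c' * (c * h)" unfolding ye1
      using sub_central_mono[OF c(2) z(3)] pr_central_mult[OF c(1) h(1)] by (simp add: c_def)
    then have "y * e \<preceq> y * h" using yh ch by simp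
    moreover have "y * e \<preceq> c * (c' * h')" unfolding ye2
      using sub_central_mono[OF c(1) z'(3)] pr_central_mult[OF c(2) h'] by (simp add: c'_def)
    then have "y * e \<preceq> y * (f - h)" using yh' ch by simp
    ultimately have "Q y h" unfolding Q_def using h ple_trans[OF h(2) wele(2)] by blast
    then have "y \<in> S" using yc by (auto simp: S_def)
    moreover have "y * y0 = 0"
    proof -
      have "w * y0 = 0" by (simp add: w_def algebra_simps proj_idem[OF y0(1)])
      then show ?thesis by (simp add: y_def mult.assoc)
    qed
    ultimately have y: "y = 0"
      using max[of y] centralD(3,4)[OF yc] y0 by (simp add: y0_def[symmetric] proj_star proj_idem)
    \<comment> \<open>\<open>c\<close> and \<open>w\<close> fix \<open>h\<close>, and the central
      \<open>c'\<close> can be moved to \<open>h'\<close>, which it fixes. The corner thus lives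
      over \<open>y = 0\<close>, against the choice of \<open>h\<close>.\<close>
    have "h * E0 * h' = y * (h * E0 * h')"
    proof -
      have M': "h \<in> M" "h' \<in> M" "E0 \<in> M" using h(1) h' pE0 by (auto simp: pr_def)
      have "y * (h * E0 * h') = c' * (h * E0) * h'" using yh by (simp add: mult.assoc[symmetric])
      also have "\<dots> = h * E0 * (c' * h')" using centralD(5)[OF c(2) M_times[OF M'(1,3)]] by (simp add: mult.assoc)
      finally show ?thesis using ch by simp
    qed
    then show False using h(4) y by (simp add: h'_def)
  qed
  then have "e = y0 * e" by (simp add: w_def algebra_simps)
  then show ?thesis using E1 E2 g1 g2 g3 by metis
qed

lemma small_subprojection:
  assumes f: "pr f" "u * f = f * u" and ef: "e \<preceq> f" and e0: "e \<noteq> 0"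
  shows "\<exists>g. pr g \<and> g \<noteq> 0 \<and> g \<unlhd> f \<and> u * g = g * u \<and> g \<preceq> e"
proof (rule ccontr)
  assume no: "\<not> ?thesis"
  \<comment> \<open>Requiring \<open>e \<preceq> k\<close> lets every stage be split again, while
    the part \<open>k - k'\<close> set aside receives a copy of \<open>e\<close>.\<close>
  define R where "R k \<longleftrightarrow> pr k \<and> k \<unlhd> f \<and> u * k = k * u \<and> e \<preceq> k" for k
  have R0: "R f" unfolding R_def using f ef by (simp add: pr_def ple_refl)
  have split: "\<exists>k'. R k' \<and> k' \<unlhd> k \<and> e \<preceq> k - k'" if k: "R k" for k
  proof -
    have "\<exists>g. pr g \<and> g \<unlhd> k \<and> u * g = g * u \<and> e \<preceq> g \<and> e \<preceq> k - g"
      using k no unfolding R_def by (intro commuting_splitting) (use ple_trans in blast)+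
    then show ?thesis using k ple_trans unfolding R_def by blast
  qed
  obtain k where k: "\<And>n::nat. R (k n)" "\<And>n. k (Suc n) \<unlhd> k n" "\<And>n. e \<preceq> k n - k (Suc n)"
    using dependent_nat_choice[of "\<lambda>n k. R k" "\<lambda>n k k'. k' \<unlhd> k \<and> e \<preceq> k - k'"] R0 split by metis
  have kp: "pr (k n)" for n using k(1) by (simp add: R_def)
  have mono: "k (n + m) \<unlhd> k n" for n m
  proof (induction m)
    case 0
    then show ?case using kp by (simp add: pr_def ple_refl)
  next
    case (Suc m)
    then show ?case using ple_trans[OF k(2)[of "n + m"]] by simp
  qed
  have "\<forall>n. \<exists>r. e \<sim> r \<and> r \<unlhd> k n - k (Suc n)" using k(3) unfolding sub_def by blast
  then obtain r where r: "\<And>n. e \<sim> r n" "\<And>n. r n \<unlhd> k n - k (Suc n)" by metis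
  have lt: "r n * r m = 0" if "n < m" for n m
  proof -
    have "k m \<unlhd> k (Suc n)" using mono[of "Suc n" "m - Suc n"] that by simp
    then have "r m \<unlhd> k (Suc n)"
      using ple_trans[OF r(2)[of m] ple_diff] kp k(2) ple_trans by (metis pr_def)
    moreover have "(k n - k (Suc n)) * k (Suc n) = 0"
      using k(2)[of n] kp[of "Suc n"] by (simp add: ple_def pr_def proj_idem algebra_simps)
    ultimately show ?thesis using ple_orth[OF r(2)] by blast
  qed
  have "r n * r m = 0" if "n \<noteq> m" for n m
    using that lt eqv_pr(2)[OF r(1)] proj_orth_sym by (metis linorder_neqE_nat pr_def)
  moreover have "r n \<sim> r (Suc n)" for n using eqv_trans[OF eqv_sym[OF r(1)] r(1)] .
  ultimately have "r 0 = 0" using orthogonal_sequence_zero by blast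
  then show False using r(1)[of 0] eqv_zero' e0 by metis
qed

lemma exact_subprojection:
  assumes f: "pr f" "u * f = f * u" and ef: "e \<preceq> f"
  shows "\<exists>g. g \<sim> e \<and> g \<unlhd> f \<and> u * g = g * u"
proof -
  have e: "pr e" by (rule sub_pr[OF ef])
  have fD: "f \<in> M" "proj f" and eD: "e \<in> M" "proj e" using f e by (auto simp: pr_def)
  define S where "S = {V \<in> M. pisom V \<and> V\<^sup>\<star> * V \<unlhd> f \<and> u * (V\<^sup>\<star> * V) = V\<^sup>\<star> * V * u \<and> V * V\<^sup>\<star> \<unlhd> e}"
  obtain C where C: "C \<subseteq> S" "ortho_family C (\<lambda>V. V)" and
    max: "\<And>V. V \<in> S \<Longrightarrow> (V\<^sup>\<star> * V) * ((osum C (\<lambda>V. V))\<^sup>\<star> * osum C (\<lambda>V. V)) = 0 \<Longrightarrow>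
       (V * V\<^sup>\<star>) * (osum C (\<lambda>V. V) * (osum C (\<lambda>V. V))\<^sup>\<star>) = 0 \<Longrightarrow> V = 0"
    using maximal_orthogonal_family[of S] unfolding S_def by blast
  define T where "T = osum C (\<lambda>V. V)"
  have T: "T \<in> M" "pisom T" unfolding T_def using C by (auto intro!: M_osum osum_pisom simp: S_def)
  define g e0 where "g = T\<^sup>\<star> * T" and "e0 = T * T\<^sup>\<star>"
  have ge: "g \<sim> e0" unfolding eqv_def g_def e0_def using T by blast
  note prge = eqv_pr[OF ge]
  have CS: "V \<in> M" "pisom V" "V\<^sup>\<star> * V \<unlhd> f" "u * (V\<^sup>\<star> * V) = V\<^sup>\<star> * V * u" "V * V\<^sup>\<star> \<unlhd> e" if "V \<in> C" for V
    using C(1) that by (auto simp: S_def)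
  have gs: "g = osum C (\<lambda>V. V\<^sup>\<star> * V)" unfolding g_def T_def by (rule osum_initial[OF C(2)])
  have es: "e0 = osum C (\<lambda>V. V * V\<^sup>\<star>)" unfolding e0_def T_def by (rule osum_final[OF C(2)])
  have fam: "ortho_family C (\<lambda>V. V\<^sup>\<star> * V)" by (rule ortho_family_initial[OF C(2)])
  have orth1: "(V\<^sup>\<star> * V) * (W\<^sup>\<star> * W) = 0" "(V * V\<^sup>\<star>) * (W * W\<^sup>\<star>) = 0" if "V \<in> C" "W \<in> C" "V \<noteq> W" for V W
    using times_assoc_rule[OF ortho_familyD(2)[OF C(2) that]] times_assoc_rule[OF ortho_familyD(3)[OF C(2) that]]
    by (simp_all add: mult.assoc)
  have gf: "g \<unlhd> f" unfolding gs
    by (rule osum_projs(3)) (use CS(3) orth1(1) proj_initial[OF CS(2)] fD in blast)+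
  have e0e: "e0 \<unlhd> e" unfolding es
    by (rule osum_projs(3)) (use CS(5) orth1(2) proj_final[OF CS(2)] eD in blast)+
  have ug: "u * g = g * u" unfolding gs by (rule osum_commute[OF fam]) (use CS in auto)
  have "e - e0 = 0"
  proof (rule ccontr)
    assume ne: "e - e0 \<noteq> 0"
    obtain e1 where e1: "e \<sim> e1" "e1 \<unlhd> f" using ef unfolding sub_def by blast
    \<comment> \<open>\<open>x\<close> is the copy of \<open>e0\<close> inside the copy
      \<open>e1\<close> of \<open>e\<close> under \<open>f\<close>. As
      \<open>x \<sim> e0 \<sim> g\<close>, cancellation gives \<open>f - x \<sim> f - g\<close>, so
      the rest \<open>e1 - x\<close> finds room under \<open>f - g\<close>.\<close>
    obtain x where x: "e0 \<sim> x" "x \<unlhd> e1" "e - e0 \<sim> e1 - x" using eqv_restrict[OF e1(1) prge(2) e0e] by blast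
    note px = eqv_pr(2)[OF x(1)] and pe1 = eqv_pr(2)[OF e1(1)]
    have "f - x \<sim> f - g" by (rule cancellation[OF f(1) eqv_sym[OF eqv_trans[OF ge x(1)]] ple_trans[OF x(2) e1(2)] gf])
    moreover have "e1 - x \<unlhd> f - x"
    proof -
      have "x * (e1 - x) = 0" using x(2) px by (simp add: ple_def pr_def proj_idem algebra_simps)
      moreover have "e1 - x \<unlhd> f" using ple_trans[OF ple_diff e1(2)] x(2) px pe1 by (auto simp: pr_def)
      ultimately show ?thesis
        using ple_diff_iff[OF _ _ fD(2) ple_trans[OF x(2) e1(2)]] proj_diff x(2) px pe1 by (auto simp: pr_def)
    qed
    ultimately have "e1 - x \<preceq> f - g" using sub_eqv_trans ple_sub pr_diff[OF px pe1 x(2)] by blast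
    then have sub: "e - e0 \<preceq> f - g" by (rule sub_trans_eqv[OF x(3)])
    have pfg: "pr (f - g)" by (rule pr_diff[OF prge(1) f(1) gf])
    have "u * (f - g) = (f - g) * u" using ug f(2) by (simp add: algebra_simps)
    from small_subprojection[OF pfg this sub ne]
    obtain h where h: "pr h" "h \<noteq> 0" "h \<unlhd> f - g" "u * h = h * u" "h \<preceq> e - e0" by blast
    obtain W where W: "W \<in> M" "pisom W" "W\<^sup>\<star> * W = h" "W * W\<^sup>\<star> \<unlhd> e - e0"
      using h(5) unfolding sub_def eqv_def by blast
    have "h \<unlhd> f \<and> g * h = 0"
      using h(1,3) ple_diff_iff[OF _ _ fD(2) gf] prge by (auto simp: pr_def)
    moreover have "W * W\<^sup>\<star> \<unlhd> e \<and> e0 * (W * W\<^sup>\<star>) = 0"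
      using W(4) ple_diff_iff[OF proj_final[OF W(2)] _ eD(2) e0e] prge by (auto simp: pr_def)
    ultimately have "W \<in> S" "h * g = 0" "(W * W\<^sup>\<star>) * e0 = 0"
      using W h prge proj_orth_sym proj_final[OF W(2)] unfolding S_def pr_def by auto
    then have "W = 0" using max W(3) unfolding g_def e0_def T_def by blast
    then show False using W(3) h(2) by simp
  qed
  then show ?thesis using ge gf ug by auto
qed

text \<open>Replace one half \<open>a\<close> of \<open>f\<close> by an equivalent projection that
  commutes with \<open>u\<close>; cancellation makes the complement equivalent to the other
  half.\<close>

lemma commuting_halving:
  assumes f: "pr f" "u * f = f * u"
  shows "\<exists>g. pr g \<and> g \<unlhd> f \<and> u * g = g * u \<and> g \<sim> f - g"
proof -
  obtain a b where ab: "a \<sim> b" "a * b = 0" "f = a + b" using halving[OF f(1)] by blast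
  note prab = eqv_pr[OF ab(1)]
  have af: "a \<unlhd> f" unfolding ab(3)
    using ab(2) prab by (intro ple_add_left) (auto simp: pr_def proj_orth_sym)
  obtain g where g: "g \<sim> a" "g \<unlhd> f" "u * g = g * u"
    using exact_subprojection[OF f ple_sub[OF prab(1) af]] by blast
  have "f - a \<sim> f - g" by (rule cancellation[OF f(1) eqv_sym[OF g(1)] af g(2)])
  then have "b \<sim> f - g" using ab(3) by simp
  then show ?thesis using g eqv_trans[OF g(1) eqv_trans[OF ab(1)]] eqv_pr[OF g(1)] by blast
qed

end

subsection \<open>Products of symmetries\<close>

text \<open>The analogue of \<open>times_assoc_rule\<close> for vanishing words of three factors,
  such as \<open>s * (d * s) = 0\<close>.\<close>

lemma times_zero_assoc_rule: "A * (B * C) = 0 \<Longrightarrow> A * (B * (C * X)) = (0 :: 'a::ring)"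
  by (metis mult.assoc mult_zero_left)

context type_ii1
begin

lemma commuting_half:
  assumes "d \<in> M" "d\<^sup>\<star> * d = d * d\<^sup>\<star>" "pr f" "d * f = f * d"
  shows "\<exists>g. pr g \<and> g \<unlhd> f \<and> d * g = g * d \<and> g \<sim> f - g"
proof -
  interpret type_ii1_normal M d by unfold_locales (fact assms)+
  show ?thesis by (rule commuting_halving[OF assms(3,4)])
qed

text \<open>A unitary of the corner \<open>q M q\<close>, extended by zero to the whole space;
  \<open>symmetry_on\<close> is read in the same way.\<close>

definition unitary_on :: "'a bop \<Rightarrow> 'a bop \<Rightarrow> bool" where
  "unitary_on q d \<longleftrightarrow> d \<in> M \<and> d\<^sup>\<star> * d = q \<and> d * d\<^sup>\<star> = q"

definition symmetry_on :: "'a bop \<Rightarrow> 'a bop \<Rightarrow> bool" where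
  "symmetry_on q s \<longleftrightarrow> s \<in> M \<and> s\<^sup>\<star> = s \<and> s * s = q"

lemma unitary_onD:
  assumes "pr q" "unitary_on q d"
  shows "d \<in> M" "d\<^sup>\<star> * d = q" "d * d\<^sup>\<star> = q" "q * d = d" "d * q = d" "q * d\<^sup>\<star> = d\<^sup>\<star>" "d\<^sup>\<star> * q = d\<^sup>\<star>"
proof -
  show d: "d \<in> M" "d\<^sup>\<star> * d = q" "d * d\<^sup>\<star> = q" using assms(2) by (auto simp: unitary_on_def)
  have "pisom d" by (rule pisom_if_initial) (use d assms(1) in \<open>simp add: pr_def\<close>)
  note ps = pisom_simps[OF this]
  show "d * q = d" "q * d\<^sup>\<star> = d\<^sup>\<star>" using ps(1,2) by (simp_all add: d(2)[symmetric] mult.assoc)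
  show "q * d = d" "d\<^sup>\<star> * q = d\<^sup>\<star>" using ps(1,2) by (simp_all add: d(3)[symmetric] mult.assoc)
qed

lemma symmetry_onD:
  assumes "pr q" "symmetry_on q s"
  shows "s \<in> M" "s\<^sup>\<star> = s" "s * s = q" "q * s = s" "s * q = s" "pisom s"
proof -
  show s: "s \<in> M" "s\<^sup>\<star> = s" "s * s = q" using assms(2) by (auto simp: symmetry_on_def)
  show "q * s = s" "s * q = s" using unitary_onD(4,5)[OF assms(1), of s] s by (simp_all add: unitary_on_def)
  show "pisom s" by (rule pisom_if_initial) (use s assms(1) in \<open>simp add: pr_def\<close>)
qed

text \<open>With respect to \<open>q = g + h\<close> and the matrix units given by \<open>s : g \<rightarrow> h\<close>, a unitary
  \<open>diag (a, b)\<close> equals \<open>diag (a b, 1) * diag (b\<^sup>\<star>, b)\<close>, and \<open>diag (b\<^sup>\<star>, b)\<close> is the product of an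
  antidiagonal symmetry with the flip \<open>s + s\<^sup>\<star>\<close>.\<close>

lemma unitary_on_decomposition:
  assumes q: "pr q" and d: "unitary_on q d"
  shows "\<exists>g c e f. pr g \<and> g \<unlhd> q \<and> g \<sim> q - g \<and> unitary_on g c \<and> symmetry_on q e \<and> symmetry_on q f \<and>
    d = (c + (q - g)) * e * f"
proof -
  note dq = unitary_onD[OF q d]
  obtain g where g: "pr g" "g \<unlhd> q" "d * g = g * d" "g \<sim> q - g"
    using commuting_half[of d q] dq q by auto
  obtain s where s: "s \<in> M" "pisom s" "s\<^sup>\<star> * s = g" "s * s\<^sup>\<star> = q - g" using g(4) unfolding eqv_def by blast
  define h where "h = q - g"
  have qg: "q = g + h" by (simp add: h_def)
  have gD: "g \<in> M" "g * g = g" "g\<^sup>\<star> = g" using g(1) by (auto simp: pr_def proj_def)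
  have h: "pr h" unfolding h_def by (rule pr_diff[OF g(1) q g(2)])
  then have hD: "h \<in> M" "h * h = h" "h\<^sup>\<star> = h" by (auto simp: pr_def proj_def)
  have gh: "g * h = 0" "h * g = 0" using g(1,2) by (simp_all add: h_def ple_def pr_def proj_idem algebra_simps)
  have s4: "s * s\<^sup>\<star> = h" using s(4) by (simp add: h_def)
  have sg: "s * g = s" "g * s\<^sup>\<star> = s\<^sup>\<star>" using pisom_simps[OF s(2)] by (simp_all add: s(3)[symmetric] mult.assoc)
  have hs: "h * s = s" "s\<^sup>\<star> * h = s\<^sup>\<star>" using pisom_simps[OF s(2)] by (simp_all add: s4[symmetric] mult.assoc)
  have gs: "g * s = 0" using gh(1) hs(1) by (metis mult.assoc mult_zero_left)
  have sh: "s * h = 0" using gh(1) sg(1) by (metis mult.assoc mult_zero_right)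
  have gs': "s\<^sup>\<star> * g = 0" using gs gD by (metis star_times star_zero)
  have sh': "h * s\<^sup>\<star> = 0" using sh hD by (metis star_times star_zero)
  have ss: "s * s = 0" using sg(1) gs by (metis mult.assoc mult_zero_right)
  have ss': "s\<^sup>\<star> * s\<^sup>\<star> = 0" using ss by (metis star_times star_zero)
  have dh: "d * h = h * d" using g(3) dq by (simp add: h_def algebra_simps)
  have dg': "d\<^sup>\<star> * g = g * d\<^sup>\<star>" using g(3) gD(3) by (metis star_times)
  have dh': "d\<^sup>\<star> * h = h * d\<^sup>\<star>" using dh hD(3) by (metis star_times)
  \<comment> \<open>\<open>s\<close> maps into \<open>h\<close>, \<open>d\<close> preserves
    \<open>h\<close>, and \<open>s\<close> vanishes on \<open>h\<close>.\<close>
  have sds: "s * (d * s) = 0"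
  proof -
    have "s * (d * s) = s * (d * g) * s" using sg(1) g(3) by (metis mult.assoc)
    then show ?thesis by (simp add: mult.assoc gs)
  qed
  have sds': "s * (d\<^sup>\<star> * s) = 0"
  proof -
    have "s * (d\<^sup>\<star> * s) = s * (d\<^sup>\<star> * g) * s" using sg(1) dg' by (metis mult.assoc)
    then show ?thesis by (simp add: mult.assoc gs)
  qed
  have sds'': "s\<^sup>\<star> * (d\<^sup>\<star> * s\<^sup>\<star>) = 0" "s\<^sup>\<star> * (d * s\<^sup>\<star>) = 0"
    using arg_cong[OF sds, of star] arg_cong[OF sds', of star] by (simp_all add: star_times mult.assoc)
  have dd: "d * d\<^sup>\<star> = g + h" "d\<^sup>\<star> * d = g + h" using dq qg by simp_all
  note rules = gD hD gh s(3) s4 sg hs gs sh gs' sh' ss ss' dh dg' dh' g(3) dd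
  note rules2 = rules(2,5)[THEN times_assoc_rule] rules(7-)[THEN times_assoc_rule]
    sds sds' sds'' sds[THEN times_zero_assoc_rule] sds'[THEN times_zero_assoc_rule] sds''[THEN times_zero_assoc_rule]
  note R = rules rules2 mult.assoc distrib_left distrib_right star_times star_add
  \<comment> \<open>In matrix units \<open>d * s\<close> is \<open>b\<close> in the lower left
    corner, so \<open>e\<close> is antidiagonal with entries \<open>b\<close> and its adjoint;
    \<open>c\<close> is \<open>a\<close> times \<open>s\<^sup>\<star> * d * s\<close>, the copy of
    \<open>b\<close> on \<open>g\<close>.\<close>
  define f e c where "f = s + s\<^sup>\<star>" and "e = d * s + (d * s)\<^sup>\<star>" and "c = d * (s\<^sup>\<star> * (d * s))"
  have "symmetry_on q f"
    unfolding symmetry_on_def f_def qg using s(1) by (simp add: M_intros R add.commute)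
  moreover have "symmetry_on q e"
    unfolding symmetry_on_def e_def qg using s(1) dq(1) by (simp add: M_intros R add.commute)
  moreover have "unitary_on g c"
    unfolding unitary_on_def c_def using s(1) dq(1) by (simp add: M_intros R)
  moreover have "d = (c + h) * e * f"
  proof -
    have "(c + h) * e * f = d * g + h * d" unfolding c_def e_def f_def by (simp add: R)
    also have "\<dots> = d * q" by (simp add: qg distrib_left dh)
    finally show ?thesis using dq by simp
  qed
  ultimately show ?thesis using g unfolding h_def by blast
qed

text \<open>\<open>R n\<close> is what the first \<open>n\<close> blocks leave over; it is halved by
  a projection commuting with \<open>U\<close> into \<open>R (Suc n)\<close> and the next block
  \<open>Q n\<close>.\<close>

lemma halving_sequence:
  assumes U: "U \<in> M" "U\<^sup>\<star> * U = U * U\<^sup>\<star>"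
  shows "\<exists>Q::nat \<Rightarrow> 'a bop. (\<forall>n. pr (Q n) \<and> U * Q n = Q n * U) \<and> (\<forall>m n. m \<noteq> n \<longrightarrow> Q m * Q n = 0) \<and>
    osum UNIV Q = 1 \<and> (\<forall>n g. g \<unlhd> Q n \<longrightarrow> g \<sim> Q n - g \<longrightarrow> g \<sim> Q (Suc n))"
proof -
  have "\<exists>R. \<forall>n::nat. (pr (R n) \<and> U * R n = R n * U \<and> (n = 0 \<longrightarrow> R n = 1)) \<and>
     (R (Suc n) \<unlhd> R n \<and> R (Suc n) \<sim> R n - R (Suc n))"
  proof (rule dependent_nat_choice)
    show "\<exists>x. pr x \<and> U * x = x * U \<and> ((0::nat) = 0 \<longrightarrow> x = 1)" using pr_one by auto
    fix r n assume "pr r \<and> U * r = r * U \<and> ((n::nat) = 0 \<longrightarrow> r = 1)"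
    then show "\<exists>y. (pr y \<and> U * y = y * U \<and> (Suc n = 0 \<longrightarrow> y = 1)) \<and> y \<unlhd> r \<and> y \<sim> r - y"
      using commuting_half[OF U, of r] by blast
  qed
  then obtain R where R: "\<And>n. pr (R n)" "\<And>n. U * R n = R n * U" "R 0 = 1"
    "\<And>n. R (Suc n) \<unlhd> R n" "\<And>n. R (Suc n) \<sim> R n - R (Suc n)" by metis
  define Q where "Q n = R n - R (Suc n)" for n
  have Q: "pr (Q n)" for n unfolding Q_def by (rule pr_diff[OF R(1) R(1) R(4)])
  have RQ: "R (Suc n) \<sim> Q n" for n using R(5) by (simp add: Q_def)
  have UQ: "U * Q n = Q n * U" for n using R(2) by (simp add: Q_def algebra_simps)
  have QR: "Q n \<unlhd> R n" for n
    unfolding Q_def using R(1,4) by (intro ple_diff) (auto simp: pr_def)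
  have QR0: "Q n * R (Suc n) = 0" for n
    using R(4)[of n] R(1)[of "Suc n"] by (simp add: Q_def ple_def pr_def proj_idem algebra_simps)
  have mono: "R (n + m) \<unlhd> R n" for n m
  proof (induction m)
    case 0
    then show ?case using R(1) by (simp add: pr_def ple_refl)
  next
    case (Suc m)
    then show ?case using ple_trans[OF R(4)[of "n + m"]] by simp
  qed
  have lt: "Q n * Q m = 0" if "n < m" for n m
  proof -
    have "R m \<unlhd> R (Suc n)" using mono[of "Suc n" "m - Suc n"] that by simp
    then show ?thesis
      using ple_orth[OF ple_refl ple_trans[OF QR] QR0] Q by (auto simp: pr_def)
  qed
  have orth: "Q m * Q n = 0" if "m \<noteq> n" for m n
    using that lt Q proj_orth_sym by (metis linorder_neqE_nat pr_def)
  define E where "E = osum UNIV Q"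
  have fam: "ortho_family UNIV Q" by (rule ortho_family_projI) (use Q orth in \<open>auto simp: pr_def\<close>)
  have E: "pr E" unfolding E_def pr_def using Q by (auto intro!: M_osum[OF fam] osum_proj[OF fam] simp: pr_def)
  have QE: "Q n \<unlhd> E" for n unfolding E_def by (rule osum_projs(2)) (use Q orth in \<open>auto simp: pr_def\<close>)
  define r where "r = 1 - E"
  have r: "pr r" unfolding r_def by (rule pr_compl[OF E])
  have Qr: "Q n * r = 0" for n using QE[of n] by (simp add: r_def ple_def algebra_simps)
  have rR: "r \<unlhd> R n" for n
  proof (induction n)
    case 0
    then show ?case by (simp add: R(3) ple_def)
  next
    case (Suc n)
    have "R (Suc n) = R n - Q n" by (simp add: Q_def)
    then show ?case using ple_diff_iff[of r "Q n" "R n"] Suc Qr QR r Q R(1) by (auto simp: pr_def)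
  qed
  \<comment> \<open>The uncovered part \<open>r\<close> lies under \<open>R (Suc n)\<close>, which
    is equivalent to \<open>Q n\<close>; so each of the orthogonal blocks contains a copy of
    \<open>r\<close>.\<close>
  have "\<exists>x. r \<sim> x \<and> x \<unlhd> Q n" for n using eqv_restrict[OF RQ r rR] by blast
  then obtain x where x: "\<And>n. r \<sim> x n" "\<And>n. x n \<unlhd> Q n" by metis
  have "x 0 = 0"
  proof (rule orthogonal_sequence_zero)
    show "x n \<sim> x (Suc n)" for n by (rule eqv_trans[OF eqv_sym[OF x(1)] x(1)])
    show "x m * x n = 0" if "m \<noteq> n" for m n by (rule ple_orth[OF x(2) x(2) orth[OF that]])
  qed
  then have "r = 0" using x(1)[of 0] eqv_zero' by simp
  then have "osum UNIV Q = 1" by (simp add: r_def E_def)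
  \<comment> \<open>\<open>Q n\<close> is equivalent to \<open>R (Suc n)\<close>, whose halves are
    \<open>Q (Suc n)\<close> and \<open>R (Suc (Suc n))\<close>; halves of equivalent projections
    are equivalent.\<close>
  moreover have "g \<sim> Q (Suc n)" if g: "g \<unlhd> Q n" "g \<sim> Q n - g" for g n
  proof (rule halves_equivalent[OF g(2) _ eqv_sym[OF RQ] QR0])
    show "g * (Q n - g) = 0" using g eqv_pr(1)[OF g(2)] by (simp add: ple_def pr_def proj_idem algebra_simps)
    have "Q n \<sim> R (Suc n)" by (rule eqv_sym[OF RQ])
    then show "g + (Q n - g) \<sim> Q (Suc n) + R (Suc (Suc n))" by (simp add: Q_def)
  qed
  ultimately show ?thesis using Q UQ orth by blast
qed

lemma symmetry_osum:
  assumes B: "\<And>n::nat. pr (B n)" and orth: "\<And>m n. m \<noteq> n \<Longrightarrow> B m * B n = 0" and one: "osum UNIV B = 1"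
    and S: "\<And>n. symmetry_on (B n) (S n)"
  shows "symmetry_on 1 (osum UNIV S)" "osum UNIV S * B n = S n"
proof -
  note SD = symmetry_onD[OF B S]
  have 0: "S i * B j = 0" if "i \<noteq> j" for i j using SD(5)[of i] orth[OF that] by (metis mult.assoc mult_zero_right)
  have SS: "S i * S j = 0" if "i \<noteq> j" for i j using SD(4)[of j] 0[OF that] by (metis mult.assoc mult_zero_left)
  have fam: "ortho_family UNIV S" unfolding ortho_family_def using SD SS by simp
  have "(osum UNIV S)\<^sup>\<star> = osum UNIV S" using osum_star[OF fam] SD(2) by simp
  moreover have "(osum UNIV S)\<^sup>\<star> * osum UNIV S = 1" using osum_initial[OF fam] SD(2,3) one by simp
  ultimately show "symmetry_on 1 (osum UNIV S)"
    unfolding symmetry_on_def using M_osum[OF fam SD(1)] by simp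
  show "osum UNIV S * B n = S n"
    using osum_times_single[OF fam, of n "B n"] 0 SD(5) by simp
qed

lemma symmetry_osum_product:
  assumes B: "\<And>n::nat. pr (B n)" "\<And>m n. m \<noteq> n \<Longrightarrow> B m * B n = 0" "osum UNIV B = 1"
    and S: "\<And>n. symmetry_on (B n) (S n)" and T: "\<And>n. symmetry_on (B n) (T n)"
  shows "osum UNIV S * osum UNIV T * B n = S n * T n"
proof -
  have "osum UNIV S * (osum UNIV T * B n) = osum UNIV S * (B n * T n)"
    by (simp add: symmetry_osum(2)[OF B T] symmetry_onD(4)[OF B(1) T])
  also have "\<dots> = S n * T n" by (simp add: symmetry_osum(2)[OF B S] flip: mult.assoc)
  finally show ?thesis by (simp add: mult.assoc)
qed

text \<open>\<open>diag (c, t c\<^sup>\<star> t\<^sup>\<star>)\<close> is again a product of two symmetries.\<close>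

lemma push_unitary:
  assumes q: "pr q" "pr q'" "q * q' = 0" and g: "pr g" "g \<unlhd> q" and c: "unitary_on g c"
    and t: "t \<in> M" "t\<^sup>\<star> * t = g" "t * t\<^sup>\<star> = q'"
  shows "\<exists>a b. symmetry_on (q + q') a \<and> symmetry_on (q + q') b \<and>
    a * b * q = c + (q - g) \<and> a * b * q' = (t * c * t\<^sup>\<star>)\<^sup>\<star>"
proof -
  note cD = unitary_onD[OF g(1) c]
  have pt: "pisom t" by (rule pisom_if_initial) (use t g in \<open>simp add: pr_def\<close>)
  define h where "h = q - g"
  have qg: "q = g + h" by (simp add: h_def)
  have gD: "g * g = g" "g\<^sup>\<star> = g" using g(1) by (auto simp: pr_def proj_def)
  have "pr h" unfolding h_def by (rule pr_diff[OF g(1) q(1) g(2)])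
  then have hD: "h * h = h" "h\<^sup>\<star> = h" by (auto simp: pr_def proj_def)
  have gh: "g * h = 0" "h * g = 0" using g(1,2) by (simp_all add: h_def ple_def pr_def proj_idem algebra_simps)
  have q'D: "q' * q' = q'" "q'\<^sup>\<star> = q'" using q(2) by (auto simp: pr_def proj_def)
  have gq: "g * q' = 0" using q(3) g(2) by (metis mult.assoc mult_zero_right ple_def)
  then have hq: "h * q' = 0" using q(3) by (simp add: h_def algebra_simps)
  have gq': "q' * g = 0" and hq': "q' * h = 0"
    using gq hq gD q'D hD by (metis star_times star_zero)+
  have tg: "t * g = t" "g * t\<^sup>\<star> = t\<^sup>\<star>" using pisom_simps[OF pt] by (simp_all add: t(2)[symmetric] mult.assoc)
  have qt: "q' * t = t" "t\<^sup>\<star> * q' = t\<^sup>\<star>" using pisom_simps[OF pt] by (simp_all add: t(3)[symmetric] mult.assoc)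
  have z: "g * t = 0" "h * t = 0" "t * q' = 0" "t * h = 0" "t * t = 0"
    using gq hq qt tg gh gq' by (metis mult.assoc mult_zero_left mult_zero_right)+
  have z': "t\<^sup>\<star> * g = 0" "t\<^sup>\<star> * h = 0" "q' * t\<^sup>\<star> = 0" "h * t\<^sup>\<star> = 0" "t\<^sup>\<star> * t\<^sup>\<star> = 0"
    using z[THEN arg_cong, of star] by (simp_all add: star_times gD hD q'D)
  have ct: "c * t = 0" "c\<^sup>\<star> * t = 0" "t\<^sup>\<star> * c = 0" "t\<^sup>\<star> * c\<^sup>\<star> = 0" "c * h = 0" "c\<^sup>\<star> * h = 0" "h * c = 0"
    "h * c\<^sup>\<star> = 0" "c * q' = 0" "c\<^sup>\<star> * q' = 0" "q' * c = 0" "q' * c\<^sup>\<star> = 0"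
    using cD z z' gh gq gq' by (metis mult.assoc mult_zero_left mult_zero_right)+
  note rules = gD(1) hD(1) gh q'D(1) gq hq gq' hq' tg qt z z' ct t(2,3) cD(2-7)
  note R = rules rules[THEN times_assoc_rule] gD(2) hD(2) q'D(2) mult.assoc distrib_left distrib_right star_times star_add
  \<comment> \<open>\<open>b\<close> exchanges \<open>g\<close> with \<open>q'\<close> and fixes
    \<open>h\<close>; \<open>a\<close> is that exchange twisted by \<open>c\<close>. Their product
    is \<open>c\<close> on \<open>g\<close>, \<open>t * c\<^sup>\<star> * t\<^sup>\<star>\<close> on
    \<open>q'\<close> and the identity on \<open>h\<close>.\<close>
  define a b where "a = c * t\<^sup>\<star> + t * c\<^sup>\<star> + h" and "b = t + t\<^sup>\<star> + h"
  have M: "h \<in> M" "t \<in> M" "c \<in> M" using \<open>pr h\<close> t(1) cD(1) by (auto simp: pr_def)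
  have "symmetry_on (q + q') a"
    unfolding symmetry_on_def a_def qg using M by (simp add: M_intros R ac_simps)
  moreover have "symmetry_on (q + q') b"
    unfolding symmetry_on_def b_def qg using M by (simp add: M_intros R ac_simps)
  moreover have "a * b * q = c + h" unfolding a_def b_def qg by (simp add: R)
  moreover have "a * b * q' = (t * c * t\<^sup>\<star>)\<^sup>\<star>" unfolding a_def b_def by (simp add: R)
  ultimately show ?thesis unfolding h_def by blast
qed

text \<open>\<open>U\<close> equals \<open>X * Y * Z\<close>, where \<open>X\<close> collects the
  pushes out of even blocks, \<open>Y\<close> those out of odd blocks and \<open>Z\<close> the
  products \<open>e * f\<close>. On each \<open>Q n\<close> one of \<open>X\<close>,
  \<open>Y\<close> acts by the outgoing push and the other by the incoming one, so equality can be
  checked block by block.\<close>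

lemma unitary_product_of_six:
  assumes U: "unitary_on 1 U"
  shows "\<exists>R1 R2 R3 R4 R5 R6. symmetry_on 1 R1 \<and> symmetry_on 1 R2 \<and> symmetry_on 1 R3 \<and>
    symmetry_on 1 R4 \<and> symmetry_on 1 R5 \<and> symmetry_on 1 R6 \<and> U = R1 * R2 * R3 * R4 * R5 * R6"
proof -
  note UD = unitary_onD[OF pr_one U]
  obtain Q where Q: "\<And>n::nat. pr (Q n)" "\<And>n. U * Q n = Q n * U" "\<And>m n. m \<noteq> n \<Longrightarrow> Q m * Q n = 0"
    and Q1: "osum UNIV Q = 1" and Qhalf: "\<And>n g. g \<unlhd> Q n \<Longrightarrow> g \<sim> Q n - g \<Longrightarrow> g \<sim> Q (Suc n)"
    using halving_sequence[of U] UD by metis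
  have QD: "Q n \<in> M" "Q n * Q n = Q n" "(Q n)\<^sup>\<star> = Q n" for n using Q(1)[of n] by (auto simp: pr_def proj_def)
  \<comment> \<open>The data for block \<open>n\<close> when \<open>\<tau>\<close> is the unitary
    pushed into it. As \<open>X\<close> stands before \<open>Y\<close>, the outgoing
    \<open>c\<close> is to the left of \<open>\<tau>\<^sup>\<star>\<close> for even \<open>n\<close>
    and to its right for odd \<open>n\<close>.\<close>
  define P where "P n \<tau> g c t e f \<longleftrightarrow> pr g \<and> g \<unlhd> Q n \<and> unitary_on g c \<and> t \<in> M \<and> t\<^sup>\<star> * t = g \<and> t * t\<^sup>\<star> = Q (Suc n) \<and>
    symmetry_on (Q n) e \<and> symmetry_on (Q n) f \<and>
    U * Q n = (if even n then (c + (Q n - g)) * \<tau>\<^sup>\<star> * (e * f) else \<tau>\<^sup>\<star> * (c + (Q n - g)) * (e * f))"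
    for n \<tau> g c t e f
  have step: "\<exists>g c t e f. P n \<tau> g c t e f" if \<tau>: "unitary_on (Q n) \<tau>" for n \<tau>
  proof -
    note \<tau>D = unitary_onD[OF Q(1) \<tau>]
    have Ustar: "U\<^sup>\<star> * Q n = Q n * U\<^sup>\<star>" using arg_cong[OF Q(2)[of n], of star] by (simp add: star_times QD)
    have UU: "U * (U\<^sup>\<star> * X) = X" "U\<^sup>\<star> * (U * X) = X" for X using UD(2,3) by (simp_all flip: mult.assoc)
    \<comment> \<open>\<open>\<tau>\<close> is absorbed on the side from which it can be split off
      again: \<open>U * Q n\<close> is \<open>d * \<tau>\<^sup>\<star>\<close> or
      \<open>\<tau>\<^sup>\<star> * d\<close>.\<close>
    define d where "d = (if even n then U * \<tau> else \<tau> * U)"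
    have "unitary_on (Q n) d"
    proof (cases "even n")
      case True
      have "U * (Q n * U\<^sup>\<star>) = Q n" using Ustar UU by metis
      then show ?thesis using True UD \<tau>D
        by (simp add: d_def unitary_on_def M_intros star_times mult.assoc times_assoc_rule[OF \<tau>D(3)] UU)
    next
      case False
      have "U\<^sup>\<star> * (Q n * U) = Q n" using Q(2)[of n] UU by metis
      then show ?thesis using False UD \<tau>D
        by (simp add: d_def unitary_on_def M_intros star_times mult.assoc times_assoc_rule[OF \<tau>D(2)] UU)
    qed
    from unitary_on_decomposition[OF Q(1) this] obtain g c e f where
      *: "pr g" "g \<unlhd> Q n" "g \<sim> Q n - g" "unitary_on g c" "symmetry_on (Q n) e" "symmetry_on (Q n) f"
      "d = (c + (Q n - g)) * e * f" by blast
    obtain t where t: "t \<in> M" "t\<^sup>\<star> * t = g" "t * t\<^sup>\<star> = Q (Suc n)"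
      using Qhalf[OF *(2,3)] unfolding eqv_def by blast
    note eD = symmetry_onD[OF Q(1) *(5)] and fD = symmetry_onD[OF Q(1) *(6)]
    show ?thesis
    proof (cases "even n")
      case False
      have "U * Q n = \<tau>\<^sup>\<star> * d"
        using False \<tau>D(2) Q(2)[of n] by (simp add: d_def flip: mult.assoc)
      then have "P n \<tau> g c t e f" unfolding P_def using False * t by (simp add: mult.assoc)
      then show ?thesis by blast
    next
      case True
      \<comment> \<open>For even \<open>n\<close>, \<open>\<tau>\<^sup>\<star>\<close> comes out
        behind \<open>e * f\<close>; conjugating both symmetries by \<open>\<tau>\<close> brings it
        in front of them.\<close>
      have conj: "symmetry_on (Q n) (\<tau> * x * \<tau>\<^sup>\<star>)" if x: "symmetry_on (Q n) x" for x
      proof -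
        note xD = symmetry_onD[OF Q(1) x]
        show ?thesis unfolding symmetry_on_def using xD \<tau>D
          by (simp add: M_intros star_times mult.assoc times_assoc_rule[OF \<tau>D(2)] times_assoc_rule[OF xD(4)]
              times_assoc_rule[OF xD(3)] times_assoc_rule[OF \<tau>D(6)])
      qed
      have "U * Q n = d * \<tau>\<^sup>\<star>" using True \<tau>D(3) by (simp add: d_def mult.assoc)
      also have "\<dots> = (c + (Q n - g)) * \<tau>\<^sup>\<star> * ((\<tau> * e * \<tau>\<^sup>\<star>) * (\<tau> * f * \<tau>\<^sup>\<star>))"
        using eD(4) fD(4)
        by (simp add: *(7) mult.assoc times_assoc_rule[OF \<tau>D(2)] times_assoc_rule[OF eD(4)] times_assoc_rule[OF fD(4)])
      finally have "P n \<tau> g c t (\<tau> * e * \<tau>\<^sup>\<star>) (\<tau> * f * \<tau>\<^sup>\<star>)"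
        unfolding P_def using True * t conj by simp
      then show ?thesis by blast
    qed
  qed
  then obtain g' c' t' e' f' where P': "\<And>n \<tau>. unitary_on (Q n) \<tau> \<Longrightarrow> P n \<tau> (g' n \<tau>) (c' n \<tau>) (t' n \<tau>) (e' n \<tau>) (f' n \<tau>)"
    by metis
  \<comment> \<open>Nothing is pushed into block \<open>0\<close>, so the recursion starts with the
    unit \<open>Q 0\<close> of that corner; afterwards \<open>\<tau>\<close> is the preceding
    \<open>c\<close> transported by \<open>t\<close>.\<close>
  define \<tau> where "\<tau> = rec_nat (Q 0) (\<lambda>n \<tau>. t' n \<tau> * c' n \<tau> * (t' n \<tau>)\<^sup>\<star>)"
  have \<tau>0: "\<tau> 0 = Q 0" and \<tau>Suc: "\<tau> (Suc n) = t' n (\<tau> n) * c' n (\<tau> n) * (t' n (\<tau> n))\<^sup>\<star>" for n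
    by (simp_all add: \<tau>_def)
  have \<tau>u: "unitary_on (Q n) (\<tau> n)" for n
  proof (induction n)
    case 0
    show ?case by (simp add: \<tau>0 unitary_on_def QD)
  next
    case (Suc n)
    define g c t where "g = g' n (\<tau> n)" and "c = c' n (\<tau> n)" and "t = t' n (\<tau> n)"
    have p: "pr g" "unitary_on g c" "t \<in> M" "t\<^sup>\<star> * t = g" "t * t\<^sup>\<star> = Q (Suc n)"
      using P'[OF Suc] unfolding P_def g_def c_def t_def by auto
    note cD = unitary_onD[OF p(1,2)]
    have tg: "t * (t\<^sup>\<star> * t) = t"
      by (rule pisom_simps(1)[OF pisom_if_initial]) (use p in \<open>simp add: pr_def\<close>)
    show ?case unfolding \<tau>Suc g_def[symmetric] c_def[symmetric] t_def[symmetric] unitary_on_def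
      using cD p tg
      by (simp add: M_intros star_times mult.assoc times_assoc_rule[OF p(4)] times_assoc_rule[OF cD(4)]
          times_assoc_rule[OF cD(6)] times_assoc_rule[OF cD(2)] times_assoc_rule[OF cD(3)]
          times_assoc_rule[OF tg[unfolded p(4)]])
  qed
  define g c t e f where "g n = g' n (\<tau> n)" and "c n = c' n (\<tau> n)" and "t n = t' n (\<tau> n)"
    and "e n = e' n (\<tau> n)" and "f n = f' n (\<tau> n)" for n
  have P: "P n (\<tau> n) (g n) (c n) (t n) (e n) (f n)" for n
    unfolding g_def c_def t_def e_def f_def by (rule P'[OF \<tau>u])
  have ef: "symmetry_on (Q n) (e n)" "symmetry_on (Q n) (f n)" for n using P[of n] by (auto simp: P_def)
  define k where "k n = c n + (Q n - g n)" for n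
  have Qk: "Q n * k n = k n" for n
  proof -
    have "pr (g n)" "g n \<unlhd> Q n" "unitary_on (g n) (c n)" using P[of n] by (auto simp: P_def)
    then have *: "g n * c n = c n" "Q n * g n = g n"
      using unitary_onD(4) by (auto simp: ple_def)
    then have "Q n * c n = c n" by (metis mult.assoc)
    then show ?thesis by (simp add: k_def distrib_left right_diff_distrib QD *(2))
  qed
  have "\<exists>a b. symmetry_on (Q n + Q (Suc n)) a \<and> symmetry_on (Q n + Q (Suc n)) b \<and>
    a * b * Q n = k n \<and> a * b * Q (Suc n) = (\<tau> (Suc n))\<^sup>\<star>" for n
    using push_unitary[OF Q(1)[of n] Q(1)[of "Suc n"] Q(3)] P[of n]
    unfolding P_def \<tau>Suc k_def t_def[symmetric] c_def[symmetric] by simp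
  then obtain a b where ab: "\<And>n. symmetry_on (Q n + Q (Suc n)) (a n)" "\<And>n. symmetry_on (Q n + Q (Suc n)) (b n)"
    "\<And>n. a n * b n * Q n = k n" "\<And>n. a n * b n * Q (Suc n) = (\<tau> (Suc n))\<^sup>\<star>" by metis
  \<comment> \<open>Even pushes act on the pairs of blocks (0,1), (2,3) and so on; odd pushes on
    (1,2), (3,4) and so on, with block \<open>0\<close> left alone and carrying the identity. Other
    indices get the zero projection, on which \<open>0\<close> is a symmetry.\<close>
  define B1 where "B1 n = (if even n then Q n + Q (Suc n) else 0)" for n
  define B2 where "B2 n = (if n = 0 then Q 0 else if odd n then Q n + Q (Suc n) else 0)" for n
  define on1 where "on1 x n = (if even n then x n else (0 :: 'a bop))" for x :: "nat \<Rightarrow> 'a bop" and n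
  define on2 where "on2 x n = (if n = 0 then Q 0 else if odd n then x n else (0 :: 'a bop))" for x :: "nat \<Rightarrow> 'a bop" and n
  have prB: "pr (B1 n)" "pr (B2 n)" for n unfolding B1_def B2_def using Q pr_zero pr_add by auto
  have orthB: "B1 m * B1 n = 0" "B2 m * B2 n = 0" if "m \<noteq> n" for m n
  proof -
    have "even m \<Longrightarrow> even n \<Longrightarrow> Suc m \<noteq> n \<and> m \<noteq> Suc n" "odd m \<Longrightarrow> odd n \<Longrightarrow> Suc m \<noteq> n \<and> m \<noteq> Suc n" by auto
    then show "B1 m * B1 n = 0" "B2 m * B2 n = 0"
      unfolding B1_def B2_def using that Q(3) by (auto simp: distrib_left distrib_right)
  qed
  have QB1: "Q n * B1 n = Q n" "B1 n * Q n = Q n" "Q (Suc n) * B1 n = Q (Suc n)" "B1 n * Q (Suc n) = Q (Suc n)" if "even n" for n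
    using that Q(3) QD(2) by (simp_all add: B1_def algebra_simps)
  have QB2: "Q n * B2 n = Q n" "B2 n * Q n = Q n" "Q (Suc n) * B2 n = Q (Suc n)" "B2 n * Q (Suc n) = Q (Suc n)" if "odd n" for n
    using that Q(3) QD(2) by (auto simp add: B2_def algebra_simps)
  have cover: "osum UNIV B = 1" if B: "\<And>n::nat. pr (B n)" "\<And>m n. m \<noteq> n \<Longrightarrow> B m * B n = 0" "\<And>n. \<exists>m. Q n \<unlhd> B m" for B
  proof -
    have pB: "proj (B n)" for n using B(1) by (simp add: pr_def)
    have "Q n \<unlhd> osum UNIV B" for n
      using B(3)[of n] ple_trans osum_projs(2)[of UNIV B, OF pB] B(2) by blast
    then have "osum UNIV Q \<unlhd> osum UNIV B"
      by (intro osum_projs(3) osum_projs(1)) (use Q B pB in \<open>auto simp: pr_def\<close>)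
    then show ?thesis by (simp add: Q1 ple_def)
  qed
  have one1: "osum UNIV B1 = 1"
  proof (rule cover[OF prB(1) orthB(1)])
    fix n show "\<exists>m. Q n \<unlhd> B1 m"
    proof (cases "even n")
      case True
      then show ?thesis using QB1[of n] by (auto simp: ple_def)
    next
      case False
      then obtain m where "n = Suc m" "even m" by (cases n) auto
      then show ?thesis using QB1[of m] by (auto simp: ple_def)
    qed
  qed auto
  have one2: "osum UNIV B2 = 1"
  proof (rule cover[OF prB(2) orthB(2)])
    fix n show "\<exists>m. Q n \<unlhd> B2 m"
    proof (cases "odd n \<or> n = 0")
      case True
      then show ?thesis using QB2[of n] QD(2) by (auto simp: ple_def B2_def intro: exI[of _ n])
    next
      case False
      then obtain m where "n = Suc m" "odd m" by (cases n) auto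
      then show ?thesis using QB2[of m] by (auto simp: ple_def)
    qed
  qed auto
  have sy1: "symmetry_on (B1 n) (on1 x n)" and sy2: "symmetry_on (B2 n) (on2 x n)"
    if "\<And>n. symmetry_on (Q n + Q (Suc n)) (x n)" for n x
    using that QD by (auto simp: B1_def B2_def on1_def on2_def symmetry_on_def M_zero)
  define X Y Z where "X = osum UNIV (on1 a) * osum UNIV (on1 b)" and "Y = osum UNIV (on2 a) * osum UNIV (on2 b)"
    and "Z = osum UNIV e * osum UNIV f"
  have XB: "X * B1 n = on1 a n * on1 b n" for n
    unfolding X_def by (rule symmetry_osum_product[OF prB(1) orthB(1) one1 sy1 sy1]) (use ab in auto)
  have YB: "Y * B2 n = on2 a n * on2 b n" for n
    unfolding Y_def by (rule symmetry_osum_product[OF prB(2) orthB(2) one2 sy2 sy2]) (use ab in auto)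
  have ZQ: "Z * Q n = e n * f n" for n
    unfolding Z_def by (rule symmetry_osum_product[OF Q(1) Q(3) Q1 ef])
  have Xe: "X * Q n = k n" "X * Q (Suc n) = (\<tau> (Suc n))\<^sup>\<star>" if "even n" for n
  proof -
    have "X * Q m = a n * b n * Q m" if "B1 n * Q m = Q m" for m
    proof -
      have "X * Q m = (X * B1 n) * Q m" using that by (simp add: mult.assoc)
      then show ?thesis using \<open>even n\<close> by (simp add: XB on1_def)
    qed
    then show "X * Q n = k n" "X * Q (Suc n) = (\<tau> (Suc n))\<^sup>\<star>" using QB1[OF that] ab(3,4)[of n] by simp_all
  qed
  have Yo: "Y * Q n = k n" "Y * Q (Suc n) = (\<tau> (Suc n))\<^sup>\<star>" if "odd n" for n
  proof -
    have n0: "n \<noteq> 0" using that by (metis even_zero)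
    have "Y * Q m = a n * b n * Q m" if "B2 n * Q m = Q m" for m
    proof -
      have "Y * Q m = (Y * B2 n) * Q m" using that by (simp add: mult.assoc)
      then show ?thesis using \<open>odd n\<close> n0 by (simp add: YB on2_def)
    qed
    then show "Y * Q n = k n" "Y * Q (Suc n) = (\<tau> (Suc n))\<^sup>\<star>" using QB2[OF that] ab(3,4)[of n] by simp_all
  qed
  have Ye: "Y * Q n = (\<tau> n)\<^sup>\<star>" if "even n" for n
  proof (cases n)
    case 0
    have "Y * B2 0 = Q 0" by (simp add: YB on2_def QD)
    then show ?thesis using 0 by (simp add: B2_def \<tau>0 QD)
  next
    case (Suc m)
    then show ?thesis using Yo(2)[of m] that by simp
  qed
  have Xo: "X * Q n = (\<tau> n)\<^sup>\<star>" if "odd n" for n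
    using that Xe(2) by (cases n) auto
  have UXYZ: "U * Q n = X * (Y * (Z * Q n))" for n
  proof -
    have "Q n * (e n * f n) = e n * f n" using symmetry_onD(4)[OF Q(1) ef(1)] by (simp flip: mult.assoc)
    then have YZ: "X * (Y * (Z * Q n)) = X * ((Y * Q n) * (e n * f n))" by (simp add: ZQ mult.assoc)
    show ?thesis
    proof (cases "even n")
      case True
      have "Q n * (\<tau> n)\<^sup>\<star> = (\<tau> n)\<^sup>\<star>" by (rule unitary_onD(6)[OF Q(1) \<tau>u])
      then have "X * ((\<tau> n)\<^sup>\<star> * (e n * f n)) = (X * Q n) * (\<tau> n)\<^sup>\<star> * (e n * f n)"
        by (metis mult.assoc)
      then show ?thesis using True P[of n] by (simp add: YZ Ye Xe(1) P_def k_def)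
    next
      case False
      have "X * (k n * (e n * f n)) = (X * Q n) * k n * (e n * f n)"
        using Qk by (metis mult.assoc)
      then show ?thesis using False P[of n] by (simp add: YZ Yo(1) Xo P_def k_def)
    qed
  qed
  have fam: "ortho_family UNIV Q" by (rule ortho_family_projI) (use Q in \<open>auto simp: pr_def\<close>)
  have "(U - X * (Y * Z)) * osum UNIV Q = 0"
    by (rule times_osum_zero[OF fam]) (simp add: UXYZ left_diff_distrib mult.assoc)
  then have "U = X * (Y * Z)" by (simp add: Q1)
  then have "U = osum UNIV (on1 a) * osum UNIV (on1 b) * osum UNIV (on2 a) * osum UNIV (on2 b) * osum UNIV e * osum UNIV f"
    by (simp add: X_def Y_def Z_def mult.assoc)
  moreover have "symmetry_on 1 (osum UNIV (on1 a))" "symmetry_on 1 (osum UNIV (on1 b))"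
    using symmetry_osum(1)[OF prB(1) orthB(1) one1 sy1] ab by auto
  moreover have "symmetry_on 1 (osum UNIV (on2 a))" "symmetry_on 1 (osum UNIV (on2 b))"
    using symmetry_osum(1)[OF prB(2) orthB(2) one2 sy2] ab by auto
  moreover have "symmetry_on 1 (osum UNIV e)" "symmetry_on 1 (osum UNIV f)"
    using symmetry_osum(1)[OF Q(1) Q(3) Q1] ef by auto
  ultimately show ?thesis by blast
qed

end

section \<open>Transfer to von Neumann algebras given as sets of functions\<close>

lemma app_one_id: "app 1 = id" and app_times_comp: "app (A * B) = app A \<circ> app B"
  by (auto simp: app_times)

lemma app_star: "app (A\<^sup>\<star>) = adj (app A)"
  by (rule star.rep_eq)

text \<open>Elements of the commutant are bounded, so they are of the form \<open>app C\<close> and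
  the two notions of bicommutant agree. An isometry is unitary because its final projection is
  equivalent to the finite projection \<open>id\<close>.\<close>

lemma type_ii1_bops:
  assumes II1: "type_II1 M"
  shows "type_ii1 {A. app A \<in> M}"
proof -
  let ?M = "{A. app A \<in> M}"
  have vN: "von_neumann_algebra M" and fin: "finite_projection M id"
    and ab: "\<And>E. abelian_projection M E \<Longrightarrow> E = (\<lambda>_. 0)" using II1 by (auto simp: type_II1_def)
  have bd: "A \<in> M \<Longrightarrow> bounded_clinear_op A" and adjM: "A \<in> M \<Longrightarrow> adj A \<in> M"
    and compM: "A \<in> M \<Longrightarrow> B \<in> M \<Longrightarrow> A \<circ> B \<in> M" for A B using vN by (auto simp: von_neumann_algebra_def)
  have bic: "commutant (commutant M) = M" using vN by (simp add: von_neumann_algebra_def)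
  have Bop: "app (Bop A) = A" if "bounded_clinear_op A" for A :: "'a \<Rightarrow> 'a" using that by (simp add: Bop_inverse)
  interpret von_neumann ?M
  proof
    show "A\<^sup>\<star> \<in> ?M" if "A \<in> ?M" for A using that adjM by (simp add: app_star)
    fix S :: "'a bop" assume S: "\<And>C. comm ?M C \<Longrightarrow> C * S = S * C"
    have "app S \<in> commutant (commutant M)"
      unfolding commutant_def[of "commutant M"]
    proof (intro CollectI conjI ballI)
      show "bounded_clinear_op (app S)" using app by auto
      fix T assume "T \<in> commutant M"
      then have T: "bounded_clinear_op T" "\<And>A. A \<in> M \<Longrightarrow> T \<circ> A = A \<circ> T" by (auto simp: commutant_def)
      have "comm ?M (Bop T)"
        unfolding comm_def using T(2) Bop[OF T(1)] by (auto simp: app_inject[symmetric] app_times_comp)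
      from arg_cong[OF S[OF this], of app] show "app S \<circ> T = T \<circ> app S"
        using Bop[OF T(1)] by (simp add: app_times_comp)
    qed
    then show "S \<in> ?M" using bic by simp
  qed
  have prM: "is_projection_in M (app p)" if "pr p" for p
    using that by (auto simp: is_projection_in_def pr_def proj_def simp flip: app_times_comp app_star)
  show ?thesis
  proof
    fix V assume V: "V \<in> ?M" "V\<^sup>\<star> * V = 1"
    have "pisom V" by (rule pisom_if_initial) (simp add: V(2))
    then have "pr (V * V\<^sup>\<star>)" using V(1) by (auto simp: pr_def proj_final app_times_comp compM app_star adjM)
    then have "is_projection_in M (app (V * V\<^sup>\<star>))" by (rule prM)
    moreover have "proj_le (app (V * V\<^sup>\<star>)) id" by (simp add: proj_le_def)
    \<comment> \<open>The witness is the adjoint of \<open>V\<close>, because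
      \<open>mvn_equiv\<close> takes its first projection as the initial one.\<close>
    moreover have "mvn_equiv M (app (V * V\<^sup>\<star>)) id"
      unfolding mvn_equiv_def
    proof (intro bexI conjI)
      show "adj (app (V\<^sup>\<star>)) \<circ> app (V\<^sup>\<star>) = app (V * V\<^sup>\<star>)" by (simp flip: app_star app_times_comp)
      show "app (V\<^sup>\<star>) \<circ> adj (app (V\<^sup>\<star>)) = id" using V(2) by (simp add: app_one_id flip: app_star app_times_comp)
      show "app (V\<^sup>\<star>) \<in> M" using V(1) adjM by (simp add: app_star)
    qed
    ultimately have "app (V * V\<^sup>\<star>) = id" using fin unfolding finite_projection_def by blast
    then show "V * V\<^sup>\<star> = 1" by (simp add: app_inject[symmetric] app_one_id)
  next
    fix e assume e: "pr e" and com: "\<And>A B. A \<in> ?M \<Longrightarrow> B \<in> ?M \<Longrightarrow> e * A * e * (e * B * e) = e * B * e * (e * A * e)"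
    have "abelian_projection M (app e)"
      unfolding abelian_projection_def
    proof (intro conjI ballI prM[OF e])
      fix A B assume AB: "A \<in> M" "B \<in> M"
      have "Bop A \<in> ?M" "Bop B \<in> ?M" using AB Bop bd by auto
      from arg_cong[OF com[OF this], of app]
      show "(app e \<circ> A \<circ> app e) \<circ> (app e \<circ> B \<circ> app e) = (app e \<circ> B \<circ> app e) \<circ> (app e \<circ> A \<circ> app e)"
        using AB Bop bd by (simp add: app_times_comp)
    qed
    then have "app e = (\<lambda>_. 0)" by (rule ab)
    then show "e = 0" by (intro bop_eqI) simp
  qed
qed

theorem theorem3p9:
  fixes M :: "('a::chilbert_space \<Rightarrow> 'a) set" and U :: "'a \<Rightarrow> 'a"
  assumes "type_II1 M" and "unitary_in M U"
  shows "\<exists>R1 R2 R3 R4 R5 R6. symmetry_in M R1 \<and> symmetry_in M R2 \<and> symmetry_in M R3 \<and>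
           symmetry_in M R4 \<and> symmetry_in M R5 \<and> symmetry_in M R6 \<and>
           U = R1 \<circ> R2 \<circ> R3 \<circ> R4 \<circ> R5 \<circ> R6"
proof -
  interpret type_ii1 "{A. app A \<in> M}" by (rule type_ii1_bops[OF assms(1)])
  have U: "U \<in> M" "adj U \<circ> U = id" "U \<circ> adj U = id" using assms(2) by (auto simp: unitary_in_def)
  have "bounded_clinear_op U" using U(1) assms(1) by (auto simp: type_II1_def von_neumann_algebra_def)
  then obtain u where u: "U = app u" by (metis Bop_inverse mem_Collect_eq)
  have "unitary_on 1 u"
    using U by (simp add: u unitary_on_def app_inject[symmetric] app_one_id app_times_comp app_star)
  then obtain R1 R2 R3 R4 R5 R6 where R: "symmetry_on 1 R1" "symmetry_on 1 R2" "symmetry_on 1 R3"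
    "symmetry_on 1 R4" "symmetry_on 1 R5" "symmetry_on 1 R6" "u = R1 * R2 * R3 * R4 * R5 * R6"
    using unitary_product_of_six by blast
  have sym: "symmetry_in M (app R)" if "symmetry_on 1 R" for R
    using that
    by (auto simp: symmetry_on_def symmetry_in_def unitary_in_def app_one_id simp flip: app_star app_times_comp)
  show ?thesis
    using sym[OF R(1)] sym[OF R(2)] sym[OF R(3)] sym[OF R(4)] sym[OF R(5)] sym[OF R(6)]
    unfolding u R(7) app_times_comp by blast
qed

end
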